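(* Let $(g,c,m)$ be an e-admissible triplet of integers with $3\le g\le c\le m$. Then: (1) if either $g=c$, or $g<c$ and $m\ge c+g/4$, then $\beta(g,c,m)=c/4$; (2) if $g<c$ and $m<c+g/4$, then $\beta(g,c,m)=m-(g+3c)/4$.
   Context: All graphs are finite, simple and connected. A graph $G$ is regarded as a geodesic metric space by identifying each edge isometrically with the real interval $[0,1]$; its points are the vertices and the interior points of edges, and $d(x,y)$ is the length of a shortest path joining $x$ and $y$. A geodesic triangle $T=\{x,y,z\}$ is a union of three geodesics $[xy],[yz],[zx]$; $\delta(T)$ is the infimum of $\delta\ge 0$ such that each side of $T$ lies in the $\delta$-neighbourhood of the union of the other two sides, and $\delta(G)=\sup\{\delta(T): T \text{ a geodesic triangle in } G\}$. The girth $g(G)$ (resp. circumference $c(G)$) is the length of a shortest (resp. longest) cycle of $G$. $\mathcal{H}(g,c,m)$ denotes the set of graphs with girth $g$, circumference $c$ and $m$ edges, and $\beta(g,c,m)=\max\{\delta(G): G\in\mathcal{H}(g,c,m)\}$. The triplet $(g,c,m)$ is called e-admissible if $\mathcal{H}(g,c,m)\neq\emptyset$. *)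

theory Defs
  imports Complex_Main "HOL-Library.Extended_Nat" "HOL-Library.Indicator_Function"
begin

record 'a ugraph =
  verts :: "'a set"
  edges :: "'a set set"

definition simple_graph :: "'a ugraph \<Rightarrow> bool" where
  "simple_graph G \<longleftrightarrow> finite (verts G) \<and> verts G \<noteq> {} \<and>
     edges G \<subseteq> {{u, v} | u v. u \<in> verts G \<and> v \<in> verts G \<and> u \<noteq> v}"

definition connected_graph :: "'a ugraph \<Rightarrow> bool" where
  "connected_graph G \<longleftrightarrow>
     (\<forall>u\<in>verts G. \<forall>v\<in>verts G. (u, v) \<in> {(x, y). {x, y} \<in> edges G}\<^sup>*)"

definition is_cycle :: "'a ugraph \<Rightarrow> 'a list \<Rightarrow> bool" where
  "is_cycle G vs \<longleftrightarrow> 3 \<le> length vs \<and> distinct vs \<and>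
     (\<forall>i<length vs. {vs ! i, vs ! (Suc i mod length vs)} \<in> edges G)"

text \<open>An acyclic graph has infinite girth and circumference 0.\<close>

definition girth :: "'a ugraph \<Rightarrow> enat" where
  "girth G = (INF vs\<in>{vs. is_cycle G vs}. enat (length vs))"

definition circumference :: "'a ugraph \<Rightarrow> enat" where
  "circumference G = (SUP vs\<in>{vs. is_cycle G vs}. enat (length vs))"

text \<open>
  Points of the metric graph are given by barycentric coordinates on the vertices:
  \<open>edge_point u v t\<close> is the point of the edge \<open>{u, v}\<close> at distance \<open>t\<close> from \<open>u\<close>,
  and the vertex \<open>v\<close> is the indicator function of \<open>{v}\<close>. In this way the points
  \<open>edge_point u v t\<close> and \<open>edge_point v u (1 - t)\<close> are equal, and so are the common
  endpoints of different edges; no quotient is needed.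
\<close>

type_synonym 'a point = "'a \<Rightarrow> real"

definition edge_point :: "'a \<Rightarrow> 'a \<Rightarrow> real \<Rightarrow> 'a point" where
  "edge_point u v t = (\<lambda>w. (1 - t) * indicator {u} w + t * indicator {v} w)"

definition points :: "'a ugraph \<Rightarrow> 'a point set" where
  "points G = {indicator {v} | v. v \<in> verts G} \<union>
     {edge_point u v t | u v t. {u, v} \<in> edges G \<and> 0 \<le> t \<and> t \<le> 1}"

text \<open>
  \<open>joined G x y L\<close>: some path of length \<open>L\<close> that is a finite concatenation of
  segments, each contained in a single edge, leads from \<open>x\<close> to \<open>y\<close>.
\<close>

inductive joined :: "'a ugraph \<Rightarrow> 'a point \<Rightarrow> 'a point \<Rightarrow> real \<Rightarrow> bool" for G where
  refl: "x \<in> points G \<Longrightarrow> joined G x x 0"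
| step: "\<lbrakk>{u, v} \<in> edges G; 0 \<le> s; s \<le> 1; 0 \<le> t; t \<le> 1; joined G (edge_point u v t) y L\<rbrakk>
         \<Longrightarrow> joined G (edge_point u v s) y (\<bar>s - t\<bar> + L)"

definition gdist :: "'a ugraph \<Rightarrow> 'a point \<Rightarrow> 'a point \<Rightarrow> real" where
  "gdist G x y = Inf {L. joined G x y L}"

definition is_geodesic :: "'a ugraph \<Rightarrow> 'a point \<Rightarrow> 'a point \<Rightarrow> 'a point set \<Rightarrow> bool" where
  "is_geodesic G x y A \<longleftrightarrow> (\<exists>\<gamma>. \<gamma> 0 = x \<and> \<gamma> (gdist G x y) = y \<and>
     A = \<gamma> ` {0..gdist G x y} \<and> A \<subseteq> points G \<and>
     (\<forall>s\<in>{0..gdist G x y}. \<forall>t\<in>{0..gdist G x y}. gdist G (\<gamma> s) (\<gamma> t) = \<bar>s - t\<bar>))"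

text \<open>A triangle is given by its sides \<open>A = [xy]\<close>, \<open>B = [yz]\<close>, \<open>C = [zx]\<close>; it may be degenerate.\<close>

definition geodesic_triangle ::
    "'a ugraph \<Rightarrow> 'a point set \<Rightarrow> 'a point set \<Rightarrow> 'a point set \<Rightarrow> bool" where
  "geodesic_triangle G A B C \<longleftrightarrow> (\<exists>x\<in>points G. \<exists>y\<in>points G. \<exists>z\<in>points G.
     is_geodesic G x y A \<and> is_geodesic G y z B \<and> is_geodesic G z x C)"

definition nbhd :: "'a ugraph \<Rightarrow> real \<Rightarrow> 'a point set \<Rightarrow> 'a point set" where
  "nbhd G \<delta> S = {p \<in> points G. \<exists>q\<in>S. gdist G p q \<le> \<delta>}"

definition triangle_delta ::
    "'a ugraph \<Rightarrow> 'a point set \<Rightarrow> 'a point set \<Rightarrow> 'a point set \<Rightarrow> real" where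
  "triangle_delta G A B C = Inf {\<delta>. 0 \<le> \<delta> \<and>
     A \<subseteq> nbhd G \<delta> (B \<union> C) \<and> B \<subseteq> nbhd G \<delta> (C \<union> A) \<and> C \<subseteq> nbhd G \<delta> (A \<union> B)}"

definition hyp_const :: "'a ugraph \<Rightarrow> real" where
  "hyp_const G = Sup {triangle_delta G A B C | A B C. geodesic_triangle G A B C}"

text \<open>Every finite graph is isomorphic to one whose vertices are natural numbers.\<close>

definition graph_class :: "nat \<Rightarrow> nat \<Rightarrow> nat \<Rightarrow> nat ugraph set" where
  "graph_class g c m = {G. simple_graph G \<and> connected_graph G \<and>
     girth G = enat g \<and> circumference G = enat c \<and> card (edges G) = m}"

definition e_admissible :: "nat \<Rightarrow> nat \<Rightarrow> nat \<Rightarrow> bool" where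
  "e_admissible g c m \<longleftrightarrow> graph_class g c m \<noteq> {}"

text \<open>
  Here \<open>GREATEST\<close> is a maximum: an element of the set that bounds it above.
  \<open>Max\<close> would agree with it, as \<open>graph_class g c m\<close>, although infinite,
  contains only finitely many graphs up to isomorphism.
\<close>

definition beta :: "nat \<Rightarrow> nat \<Rightarrow> nat \<Rightarrow> real" where
  "beta g c m = (GREATEST b. b \<in> hyp_const ` graph_class g c m)"

end

theory Submission
  imports Defs "HOL-Analysis.Function_Topology" "HOL-Analysis.Elementary_Metric_Spaces"
begin

text \<open>
  If a point \<open>p\<close> on a side of a geodesic triangle is at distance more than \<open>r\<close> from the other two
  sides, then the two points \<open>p\<^sub>-\<close>, \<open>p\<^sub>+\<close> of its side at distance \<open>r\<close> from \<open>p\<close> are joined outside the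
  open ball of radius \<open>r\<close> around \<open>p\<close>, because the rest of the triangle is connected. This outer path
  and the geodesic from \<open>p\<^sub>-\<close> to \<open>p\<^sub>+\<close> form a cycle, and as both have length at least \<open>2r\<close>, its length
  is at least \<open>4r\<close>. Hence \<open>\<delta> \<le> c / 4\<close>.

  Let \<open>g < c\<close>, \<open>m = c + k\<close> and \<open>4k < g\<close>. The symmetric difference of two cycles contains a cycle, so it
  has at least \<open>g\<close> edges, and therefore every cycle other than a fixed longest one has length at most
  \<open>c - g + 2k\<close>. So we may assume that the above cycle is the longest one fixed. A cycle of length \<open>g\<close> then
  yields an ear of it, of length \<open>l \<le> k\<close>, which together with either arc has length at least \<open>g\<close>. Wherever
  its ends lie, the detour through the ear bounds \<open>d(p\<^sub>-, p\<^sub>+) = 2r\<close> so that \<open>4r \<le> c - g + 4l\<close>.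

  The bounds are attained by a cycle of length \<open>c\<close> with a path of length \<open>min k \<lfloor>g / 2\<rfloor>\<close> that cuts off a
  cycle of length \<open>g\<close>, with pendant edges added. Distances in it are bounded from below by 1-Lipschitz
  functions.
\<close>

subsection \<open>Distances in the metric graph\<close>

text \<open>The metric is an infimum over continuous data, while the bounds count edges. The bridge
  is \<open>config\<close>: a thick point is encoded by two vertex lists, two offsets and
  inequalities over all walks \<open>R ^^ l\<close>, after which no topology occurs. The encoding
  needs the centre and the two boundary points to lie inside edges, hence a perturbation.

  The threshold \<open>g / 4\<close> is where the two values meet:
  \<open>k + (c - g) / 4 = c / 4\<close> exactly when \<open>4 * k = g\<close>. Below it, a cycle
  other than the longest gives \<open>4 * r \<le> c - g + 2 * k\<close>, which is under the desired
  \<open>c - g + 4 * k\<close>; and on the longest one, \<open>4 * k < g\<close> makes the ear too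
  short to have both ends inside the geodesic.

  On the extremal graph the thick point is balanced: it is equally far from a corner of a bigon and,
  over the chord, from the far end of the chord.\<close>

locale cgraph =
  fixes G :: "'a ugraph"
  assumes simple: "simple_graph G" and conn: "connected_graph G" and edges_ne: "edges G \<noteq> {}"
begin

text \<open>Discrete distances enter only as statements about all walks \<open>R ^^ n\<close>, so no
  metric on the vertices is introduced.\<close>

definition R :: "'a rel" where "R = {(x, y). {x, y} \<in> edges G}"

abbreviation chain :: "'a list \<Rightarrow> bool" where
  "chain \<equiv> successively (\<lambda>x y. (x, y) \<in> R)"

abbreviation vtx :: "'a \<Rightarrow> 'a point" where "vtx v \<equiv> indicator {v}"

text \<open>\<open>1 - x u\<close> is the distance from \<open>x\<close> to \<open>u\<close> inside
  the edge. Only coordinates are compared, so a vertex satisfies this for each of its edges.\<close>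

definition on_edge :: "'a point \<Rightarrow> 'a \<Rightarrow> 'a \<Rightarrow> bool" where
  "on_edge x u v \<longleftrightarrow> (u, v) \<in> R \<and> 0 \<le> x u \<and> 0 \<le> x v \<and> x u + x v = 1 \<and> (\<forall>w. w \<noteq> u \<longrightarrow> w \<noteq> v \<longrightarrow> x w = 0)"

lemma R_sym: "(u, v) \<in> R \<Longrightarrow> (v, u) \<in> R"
  by (simp add: R_def insert_commute)

lemma R_iff: "(u, v) \<in> R \<longleftrightarrow> {u, v} \<in> edges G"
  by (simp add: R_def)

lemma relpow_R_sym: "(u, v) \<in> R ^^ n \<Longrightarrow> (v, u) \<in> R ^^ n"
proof (induction n arbitrary: v)
  case (Suc n)
  then obtain w where "(u, w) \<in> R ^^ n" "(w, v) \<in> R" by auto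
  thus ?case using Suc.IH R_sym relpow_Suc_I2 by metis
qed auto

lemma R_verts: assumes "(u, v) \<in> R" shows "u \<in> verts G" "v \<in> verts G" "u \<noteq> v"
  using assms simple unfolding R_def simple_graph_def by (auto simp: doubleton_eq_iff)

lemma finite_verts: "finite (verts G)"
  using simple by (simp add: simple_graph_def)

lemma finite_edges: "finite (edges G)"
proof -
  have "edges G \<subseteq> Pow (verts G)"
    using simple by (auto simp: simple_graph_def)
  thus ?thesis using finite_verts finite_subset by blast
qed

lemma verts_R: assumes "v \<in> verts G" obtains w where "(v, w) \<in> R"
proof -
  obtain e where "e \<in> edges G" using edges_ne by blast
  then obtain a b where ab: "(a, b) \<in> R"
    using simple unfolding simple_graph_def R_def by blast
  have "(v, a) \<in> R\<^sup>*"
    using conn assms R_verts(1)[OF ab] by (auto simp: connected_graph_def R_def)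
  thus ?thesis
    by (metis ab converse_rtranclE that)
qed

lemma connected_relpow:
  assumes "u \<in> verts G" "v \<in> verts G" obtains n where "(u, v) \<in> R ^^ n"
proof -
  have "(u, v) \<in> R\<^sup>*"
    using conn assms by (auto simp: connected_graph_def R_def)
  thus ?thesis using that rtrancl_imp_relpow by blast
qed

lemma on_edge_commute: "on_edge x u v \<longleftrightarrow> on_edge x v u"
  unfolding on_edge_def using R_sym by (auto simp: add.commute)

lemma on_edge_R: "on_edge x u v \<Longrightarrow> (u, v) \<in> R"
  by (simp add: on_edge_def)

lemma on_edge_bounds: "on_edge x u v \<Longrightarrow> 0 \<le> x w \<and> x w \<le> 1"
  unfolding on_edge_def by (cases "w = u"; cases "w = v"; force)

lemma on_edge_iff: "on_edge x u v \<longleftrightarrow> (u, v) \<in> R \<and> (\<exists>t. 0 \<le> t \<and> t \<le> 1 \<and> x = edge_point u v t)"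
proof
  assume o: "on_edge x u v"
  have ne: "u \<noteq> v" using R_verts on_edge_R o by blast
  have "x = edge_point u v (x v)"
    unfolding edge_point_def using o ne by (auto simp: on_edge_def fun_eq_iff indicator_def)
  thus "(u, v) \<in> R \<and> (\<exists>t. 0 \<le> t \<and> t \<le> 1 \<and> x = edge_point u v t)"
    using o on_edge_bounds on_edge_R by blast
next
  assume a: "(u, v) \<in> R \<and> (\<exists>t. 0 \<le> t \<and> t \<le> 1 \<and> x = edge_point u v t)"
  hence "u \<noteq> v" using R_verts by blast
  with a show "on_edge x u v"
    by (auto simp: on_edge_def edge_point_def indicator_def)
qed

lemma on_edge_edge_point:
  "\<lbrakk>(u, v) \<in> R; 0 \<le> t; t \<le> 1\<rbrakk> \<Longrightarrow> on_edge (edge_point u v t) u v"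
  using on_edge_iff by blast

lemma edge_point_apply:
  assumes "(u, v) \<in> R"
  shows "edge_point u v t u = 1 - t" "edge_point u v t v = t"
  using R_verts(3)[OF assms] by (auto simp: edge_point_def)

lemma on_edge_vtx: "(u, v) \<in> R \<Longrightarrow> on_edge (vtx u) u v"
  using R_verts(3) by (force simp: on_edge_def indicator_def)

lemma points_iff: "x \<in> points G \<longleftrightarrow> (\<exists>u v. on_edge x u v)"
proof
  assume "x \<in> points G"
  then consider v where "v \<in> verts G" "x = vtx v"
    | u v t where "{u, v} \<in> edges G" "0 \<le> t" "t \<le> 1" "x = edge_point u v t"
    unfolding points_def by blast
  thus "\<exists>u v. on_edge x u v"
  proof cases
    case 1
    thus ?thesis using on_edge_vtx verts_R by metis
  next
    case 2
    thus ?thesis using on_edge_iff[of x u v] R_iff[of u v] by blast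
  qed
next
  assume "\<exists>u v. on_edge x u v"
  thus "x \<in> points G"
    unfolding on_edge_iff R_iff points_def by blast
qed

lemma on_edge_points: "on_edge x u v \<Longrightarrow> x \<in> points G"
  using points_iff by blast

lemma vtx_points: "v \<in> verts G \<Longrightarrow> vtx v \<in> points G"
  by (auto simp: points_def)

lemma on_edge_pos:
  assumes "on_edge x u v" "x w > 0" shows "w = u \<or> w = v"
  using assms by (auto simp: on_edge_def)

lemma on_edge_full:
  assumes "on_edge x u v" "x w = 1" shows "x = vtx w"
proof -
  have "w = u \<or> w = v" using assms on_edge_pos by force
  thus ?thesis using assms by (auto simp: on_edge_def fun_eq_iff indicator_def)
qed

lemma on_edge_at_pos:
  assumes "x \<in> points G" "x w > 0" obtains w' where "on_edge x w w'"
  using assms on_edge_pos points_iff on_edge_commute by metis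

lemma on_edge_interior:
  assumes "on_edge x u v" "on_edge x u' v'" "0 < x u" "x u < 1"
  shows "(u = u' \<and> v = v') \<or> (u = v' \<and> v = u')"
proof -
  have "x v > 0" using assms by (auto simp: on_edge_def)
  moreover have "u \<noteq> v" using assms on_edge_R R_verts by blast
  ultimately show ?thesis using on_edge_pos assms by blast
qed

lemma on_edge_diff:
  assumes "on_edge x u v" "on_edge y u v" shows "\<bar>x v - y v\<bar> = \<bar>x u - y u\<bar>"
  using assms by (auto simp: on_edge_def)

section \<open>Lengths of piecewise paths\<close>

lemma joined_step:
  assumes "on_edge x u v" "on_edge x' u v" "joined G x' y L"
  shows "joined G x y (\<bar>x u - x' u\<bar> + L)"
proof -
  obtain s where s: "0 \<le> s" "s \<le> 1" "x = edge_point u v s" and e: "(u, v) \<in> R"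
    using assms(1) on_edge_iff by blast
  obtain t where t: "0 \<le> t" "t \<le> 1" "x' = edge_point u v t"
    using assms(2) on_edge_iff by blast
  have "\<bar>s - t\<bar> = \<bar>x u - x' u\<bar>"
    using s t edge_point_apply[OF e] by simp
  thus ?thesis
    using joined.step[of u v G s t y L] s t e assms(3) R_iff by metis
qed

lemma joined_induct [consumes 1, case_names refl step]:
  assumes "joined G x y L"
    and "\<And>x. x \<in> points G \<Longrightarrow> P x x 0"
    and "\<And>x u v x' y L. \<lbrakk>on_edge x u v; on_edge x' u v; joined G x' y L; P x' y L\<rbrakk>
           \<Longrightarrow> P x y (\<bar>x u - x' u\<bar> + L)"
  shows "P x y L"
  using assms(1)
proof (induction rule: joined.induct)
  case (refl x)
  thus ?case using assms(2) by blast
next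
  case (step u v s t y L)
  have e: "(u, v) \<in> R" using step by (simp add: R_iff)
  have "\<bar>edge_point u v s u - edge_point u v t u\<bar> = \<bar>s - t\<bar>"
    using edge_point_apply[OF e] by simp
  thus ?case
    using assms(3)[of "edge_point u v s" u v "edge_point u v t" y L] e step
    by (auto simp: on_edge_edge_point)
qed

lemma joined_nonneg: "joined G x y L \<Longrightarrow> 0 \<le> L"
  by (induction rule: joined.induct) auto

lemma joined_points: "joined G x y L \<Longrightarrow> x \<in> points G \<and> y \<in> points G"
  by (induction rule: joined_induct) (auto simp: on_edge_points)

lemma joined_trans:
  assumes "joined G x y L" shows "joined G y z M \<Longrightarrow> joined G x z (L + M)"
  using assms
proof (induction rule: joined_induct)
  case (step x u v x' y L)
  thus ?case using joined_step[of x u v x' z "L + M"] by (simp add: add.assoc)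
qed auto

lemma joined_edge:
  assumes "on_edge x u v" "on_edge y u v" shows "joined G x y \<bar>x u - y u\<bar>"
  using joined_step[OF assms joined.refl] on_edge_points[OF assms(2)] by simp

lemma joined_sym:
  assumes "joined G x y L" shows "joined G y x L"
  using assms
proof (induction rule: joined_induct)
  case (step x u v x' y L)
  thus ?case using joined_trans[of y x' L x "\<bar>x u - x' u\<bar>"] joined_edge[of x' u v x]
    by (simp add: abs_minus_commute add.commute)
qed (auto intro: joined.refl)

lemma joined_to_vtx:
  assumes "on_edge x a a'" shows "joined G x (vtx a) (1 - x a)"
  using joined_edge[OF assms on_edge_vtx[OF on_edge_R[OF assms]]] on_edge_bounds[OF assms, of a]
  by simp

lemma joined_vtx:
  assumes "(a, b) \<in> R ^^ n" "a \<in> verts G" shows "joined G (vtx a) (vtx b) (real n)"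
  using assms(1)
proof (induction n arbitrary: b)
  case 0
  thus ?case using assms by (auto intro: joined.refl vtx_points)
next
  case (Suc n)
  then obtain c where c: "(a, c) \<in> R ^^ n" "(c, b) \<in> R" by auto
  have "joined G (vtx c) (vtx b) 1"
    using joined_to_vtx[of "vtx c" b c] on_edge_vtx[OF c(2)] R_verts(3)[OF c(2)]
    by (simp add: on_edge_commute)
  thus ?case using joined_trans[OF Suc.IH[OF c(1)]] by (simp add: add.commute)
qed

lemma joined_via:
  assumes "on_edge x a a'" "(a, b) \<in> R ^^ n" "on_edge y b b'"
  shows "joined G x y (1 - x a + n + (1 - y b))"
  using joined_trans[OF joined_trans[OF joined_to_vtx[OF assms(1)] joined_vtx[OF assms(2)]]
      joined_sym[OF joined_to_vtx[OF assms(3)]]] R_verts on_edge_R assms(1) by blast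

section \<open>Shortest paths\<close>

lemma gdist_le: "joined G x y L \<Longrightarrow> gdist G x y \<le> L"
  unfolding gdist_def by (rule cInf_lower) (auto intro: bdd_belowI joined_nonneg)

lemma points_joined:
  assumes "x \<in> points G" "y \<in> points G" obtains L where "joined G x y L"
proof -
  obtain a a' b b' where "on_edge x a a'" "on_edge y b b'"
    using assms points_iff by blast
  moreover have "a \<in> verts G" "b \<in> verts G"
    using calculation on_edge_R R_verts by blast+
  then obtain n where "(a, b) \<in> R ^^ n" by (rule connected_relpow)
  ultimately show ?thesis using joined_via that by blast
qed

text \<open>If \<open>x a = 0\<close>, then \<open>x\<close> is the vertex \<open>a'\<close>:
  starting there costs one more edge but saves a segment of length 1. Positive coordinates are
  wanted because a vertex that has one is an end of every edge containing \<open>x\<close>.\<close>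

lemma relpow_normalise:
  assumes "on_edge x a a'" "(a, b) \<in> R ^^ n"
  obtains a0 n0 where "x a0 > 0" "(a0, b) \<in> R ^^ n0" "1 - x a0 + real n0 \<le> 1 - x a + real n"
proof (cases "x a > 0")
  case True
  thus ?thesis using that assms by blast
next
  case False
  hence x: "x a = 0" "x a' = 1" using assms by (auto simp: on_edge_def)
  have "(a', b) \<in> R ^^ Suc n"
    using assms on_edge_R R_sym by (metis relpow_Suc_I2)
  thus ?thesis using that[of a' "Suc n"] x by simp
qed

text \<open>The lengths that can be minimal: along a common edge, or through two vertices.\<close>

definition route :: "'a point \<Rightarrow> 'a point \<Rightarrow> real \<Rightarrow> bool" where
  "route x y l \<longleftrightarrow> (\<exists>u v. on_edge x u v \<and> on_edge y u v \<and> l = \<bar>x u - y u\<bar>) \<or>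
     (\<exists>a b n. x a > 0 \<and> y b > 0 \<and> (a, b) \<in> R ^^ n \<and> l = 1 - x a + real n + (1 - y b))"

lemma route_joined:
  assumes "route x y l" "x \<in> points G" "y \<in> points G" shows "joined G x y l"
  using assms(1) unfolding route_def
proof (elim disjE exE conjE)
  fix a b n assume "x a > 0" "y b > 0" "(a, b) \<in> R ^^ n" and l: "l = 1 - x a + real n + (1 - y b)"
  thus "joined G x y l"
    using joined_via on_edge_at_pos assms(2,3) by metis
qed (use joined_edge in blast)

lemma route_via:
  assumes "on_edge x a a'" "(a, b) \<in> R ^^ n" "on_edge y b b'"
  shows "\<exists>l. route x y l \<and> l \<le> 1 - x a + real n + (1 - y b)"
proof -
  obtain a0 n0 where 1: "x a0 > 0" "(a0, b) \<in> R ^^ n0" "1 - x a0 + real n0 \<le> 1 - x a + real n"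
    using relpow_normalise[OF assms(1,2)] by blast
  obtain b0 n1 where 2: "y b0 > 0" "(b0, a0) \<in> R ^^ n1" "1 - y b0 + real n1 \<le> 1 - y b + real n0"
    using relpow_normalise[OF assms(3) relpow_R_sym[OF 1(2)]] by blast
  have "route x y (1 - x a0 + real n1 + (1 - y b0))"
    unfolding route_def using 1 2 relpow_R_sym by blast
  moreover have "1 - x a0 + real n1 + (1 - y b0) \<le> 1 - x a + real n + (1 - y b)"
    using 1 2 by linarith
  ultimately show ?thesis by blast
qed

text \<open>Prepending a segment inside \<open>{u, v}\<close> preserves the two shapes up to
  shortening. If the remaining route leaves through \<open>u\<close> or \<open>v\<close>, it can
  start at \<open>x\<close> instead; if it leaves through another vertex or runs along another edge,
  then \<open>x'\<close> is itself an end of \<open>{u, v}\<close>.\<close>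

lemma joined_route:
  assumes "joined G x y L" shows "\<exists>l. route x y l \<and> l \<le> L"
  using assms
proof (induction rule: joined_induct)
  case (refl x)
  then obtain u v where "on_edge x u v" using points_iff by blast
  hence "route x x 0" unfolding route_def by fastforce
  thus ?case by blast
next
  case (step x u v x' y L)
  then obtain l where l: "route x' y l" "l \<le> L" by blast
  have *: "\<exists>l'. route x y l' \<and> l' \<le> \<bar>x u - x' u\<bar> + l"
    if h: "(a, b) \<in> R ^^ n" "l = 1 - x' a + real n + (1 - y b)" "on_edge x' a a'" "on_edge y b b'"
    for a b n a' b'
  proof (cases "a \<in> {u, v}")
    case True
    then obtain w where w: "on_edge x a w" "\<bar>x a - x' a\<bar> = \<bar>x u - x' u\<bar>"
      using step.hyps on_edge_commute on_edge_diff by (metis insert_iff singletonD)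
    obtain l' where "route x y l'" "l' \<le> 1 - x a + real n + (1 - y b)"
      using route_via[OF w(1) h(1,4)] by blast
    thus ?thesis using w(2) h(2) by (intro exI[of _ l']) linarith
  next
    case False
    hence a: "x' a = 0" "x' a' = 1" using step.hyps(2) h(3) by (auto simp: on_edge_def)
    hence "a' \<in> {u, v}" using on_edge_pos[OF step.hyps(2), of a'] by simp
    then obtain w where w: "on_edge x a' w" "\<bar>x a' - x' a'\<bar> = \<bar>x u - x' u\<bar>"
      using step.hyps on_edge_commute on_edge_diff by (metis insert_iff singletonD)
    have "(a', b) \<in> R ^^ Suc n"
      using h(1,3) on_edge_R R_sym by (metis relpow_Suc_I2)
    then obtain l' where "route x y l'" "l' \<le> 1 - x a' + real (Suc n) + (1 - y b)"
      using route_via[OF w(1) _ h(4)] by blast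
    thus ?thesis using w(2) h(2) a by (intro exI[of _ l']) auto
  qed
  have "\<exists>l'. route x y l' \<and> l' \<le> \<bar>x u - x' u\<bar> + l"
    using l(1)[unfolded route_def]
  proof (elim disjE exE conjE)
    fix a b n assume h: "x' a > 0" "y b > 0" "(a, b) \<in> R ^^ n" "l = 1 - x' a + real n + (1 - y b)"
    have "y \<in> points G" "x' \<in> points G" using step.hyps(3) joined_points by auto
    then obtain a' b' where "on_edge x' a a'" "on_edge y b b'"
      using h on_edge_at_pos by metis
    thus ?thesis using * h by blast
  next
    fix u2 v2 assume h: "on_edge x' u2 v2" "on_edge y u2 v2" "l = \<bar>x' u2 - y u2\<bar>"
    show ?thesis
    proof (cases "{u2, v2} = {u, v}")
      case True
      hence y: "on_edge y u v" "l = \<bar>x' u - y u\<bar>"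
        using h on_edge_commute on_edge_diff[OF h(1,2)] by (auto simp: doubleton_eq_iff)
      hence "route x y \<bar>x u - y u\<bar>" using step.hyps(1) by (auto simp: route_def)
      thus ?thesis using y(2) by (intro exI[of _ "\<bar>x u - y u\<bar>"]) linarith
    next
      case False
      have "\<not> (0 < x' u2 \<and> x' u2 < 1)"
        using on_edge_interior[OF h(1) step.hyps(2)] False by blast
      hence "x' u2 = 1 \<or> x' v2 = 1"
        using h(1) by (auto simp: on_edge_def)
      thus ?thesis
      proof
        assume 1: "x' u2 = 1"
        hence "l = 1 - x' u2 + real 0 + (1 - y u2)"
          using h(2,3) on_edge_bounds[OF h(2), of u2] by simp
        thus ?thesis using *[of u2 u2 0] h(1,2) by auto
      next
        assume 1: "x' v2 = 1"
        hence "l = 1 - x' v2 + real 0 + (1 - y v2)"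
          using h(3) on_edge_bounds[OF h(2), of v2] on_edge_diff[OF h(1,2)] by simp
        thus ?thesis using *[of v2 v2 0] h(1,2) on_edge_commute by auto
      qed
    qed
  qed
  thus ?case using l(2) by (meson add_left_mono order_trans)
qed

text \<open>A length of at most \<open>M\<close> bounds the number \<open>n\<close> of whole edges.
  So only finitely many lengths compete below a given path, and the infimum in \<open>gdist\<close>
  is attained.\<close>

lemma finite_routes:
  assumes "x \<in> points G" "y \<in> points G"
  shows "finite {l. route x y l \<and> l \<le> M}"
proof -
  let ?V = "verts G"
  have "{l. route x y l \<and> l \<le> M} \<subseteq> (\<lambda>u. \<bar>x u - y u\<bar>) ` ?V \<union>
     (\<lambda>(a, b, n). 1 - x a + real n + (1 - y b)) ` (?V \<times> ?V \<times> {..nat \<lceil>M\<rceil>})"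
  proof
    fix l assume "l \<in> {l. route x y l \<and> l \<le> M}"
    hence l: "route x y l" "l \<le> M" by auto
    from l(1) show "l \<in> (\<lambda>u. \<bar>x u - y u\<bar>) ` ?V \<union>
     (\<lambda>(a, b, n). 1 - x a + real n + (1 - y b)) ` (?V \<times> ?V \<times> {..nat \<lceil>M\<rceil>})"
      unfolding route_def
    proof (elim disjE exE conjE)
      fix a b n assume h: "x a > 0" "y b > 0" "(a, b) \<in> R ^^ n" "l = 1 - x a + real n + (1 - y b)"
      then obtain a' b' where o: "on_edge x a a'" "on_edge y b b'"
        using assms on_edge_at_pos by metis
      hence "a \<in> ?V" "b \<in> ?V" using on_edge_R R_verts by blast+
      moreover have "x a \<le> 1" "y b \<le> 1" using o on_edge_bounds by blast+
      hence "real n \<le> M" using h l(2) by linarith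
      hence "n \<le> nat \<lceil>M\<rceil>" by linarith
      ultimately show ?thesis using h(4) by force
    qed (use on_edge_R R_verts in blast)
  qed
  thus ?thesis by (rule finite_subset) (auto simp: finite_verts)
qed

lemma route_gdist:
  assumes "x \<in> points G" "y \<in> points G" shows "route x y (gdist G x y)"
proof -
  obtain L where L: "joined G x y L" using points_joined[OF assms] by blast
  let ?S = "{l. route x y l \<and> l \<le> L}"
  have fin: "finite ?S" using finite_routes[OF assms] .
  have ne: "?S \<noteq> {}" using joined_route[OF L] by blast
  have in_S: "route x y (Min ?S)" using Min_in[OF fin ne] by blast
  have "gdist G x y = Min ?S"
    unfolding gdist_def
  proof (rule cInf_eq_minimum)
    show "Min ?S \<in> {L. joined G x y L}" using route_joined[OF in_S assms] by simp
    fix M assume "M \<in> {L. joined G x y L}"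
    then obtain l where l: "route x y l" "l \<le> M" using joined_route by blast
    show "Min ?S \<le> M"
    proof (cases "l \<le> L")
      case True
      thus ?thesis using l Min_le[OF fin, of l] by auto
    next
      case False
      moreover have "Min ?S \<le> L" using Min_in[OF fin ne] by blast
      ultimately show ?thesis using l by linarith
    qed
  qed
  thus ?thesis using in_S by simp
qed

lemma gdist_cases:
  assumes "x \<in> points G" "y \<in> points G"
  obtains (edge) u v where "on_edge x u v" "on_edge y u v" "gdist G x y = \<bar>x u - y u\<bar>"
  | (via) a b n where "x a > 0" "y b > 0" "(a, b) \<in> R ^^ n"
      "gdist G x y = 1 - x a + real n + (1 - y b)"
  using route_gdist[OF assms] unfolding route_def by blast

lemma joined_gdist: "x \<in> points G \<Longrightarrow> y \<in> points G \<Longrightarrow> joined G x y (gdist G x y)"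
  using route_joined route_gdist by blast

lemma gdist_triangle:
  assumes "x \<in> points G" "y \<in> points G" "z \<in> points G"
  shows "gdist G x z \<le> gdist G x y + gdist G y z"
  using joined_trans joined_gdist gdist_le assms by metis

lemma gdist_sym: "gdist G x y = gdist G y x"
proof -
  have "joined G x y = joined G y x" using joined_sym by blast
  thus ?thesis by (simp add: gdist_def)
qed

lemma gdist_nonneg: "x \<in> points G \<Longrightarrow> y \<in> points G \<Longrightarrow> 0 \<le> gdist G x y"
  using joined_gdist joined_nonneg by blast

lemma gdist_refl: "x \<in> points G \<Longrightarrow> gdist G x x = 0"
  using gdist_le[OF joined.refl] gdist_nonneg by (metis order_antisym)

lemma gdist_via:
  assumes "on_edge x a a'" "(a, b) \<in> R ^^ n" "on_edge y b b'"
  shows "gdist G x y \<le> 1 - x a + real n + (1 - y b)"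
  using gdist_le[OF joined_via[OF assms]] .

lemma gdist_edge:
  assumes "on_edge x u v" "on_edge y u v" shows "gdist G x y \<le> \<bar>x u - y u\<bar>"
  using gdist_le[OF joined_edge[OF assms]] .

lemma gdist_to_vtx: "on_edge x a a' \<Longrightarrow> gdist G x (vtx a) \<le> 1 - x a"
  using gdist_le[OF joined_to_vtx] .

lemma gdist_vtx: "\<lbrakk>(a, b) \<in> R ^^ n; a \<in> verts G\<rbrakk> \<Longrightarrow> gdist G (vtx a) (vtx b) \<le> real n"
  using gdist_le[OF joined_vtx] .

text \<open>Along a segment each coordinate changes by at most the length travelled. This ties
  \<open>gdist\<close> to the product topology on coordinate functions, in which connectedness is
  meant below.\<close>

lemma coordinate_lipschitz:
  assumes "x \<in> points G" "y \<in> points G" shows "\<bar>x w - y w\<bar> \<le> gdist G x y"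
proof -
  have "\<bar>x w - y w\<bar> \<le> L" if "joined G x y L" for x y L
    using that
  proof (induction rule: joined_induct)
    case (step x u v x' y L)
    have "\<bar>x w - x' w\<bar> \<le> \<bar>x u - x' u\<bar>"
      using on_edge_diff[OF step.hyps(1,2)] step.hyps(1,2)
      by (cases "w = u"; cases "w = v") (auto simp: on_edge_def)
    thus ?case using step.IH by linarith
  qed simp
  thus ?thesis using joined_gdist[OF assms] by blast
qed

lemma isometric_continuous:
  assumes "\<And>s. s \<in> S \<Longrightarrow> \<gamma> s \<in> points G"
    and "\<And>s t. s \<in> S \<Longrightarrow> t \<in> S \<Longrightarrow> gdist G (\<gamma> s) (\<gamma> t) = \<bar>s - t\<bar>"
  shows "continuous_on (S :: real set) \<gamma>"
proof (rule continuous_on_coordinatewise_then_product)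
  fix w
  have "\<bar>\<gamma> s w - \<gamma> t w\<bar> \<le> \<bar>s - t\<bar>" if "s \<in> S" "t \<in> S" for s t
    using coordinate_lipschitz[of "\<gamma> s" "\<gamma> t" w] assms that by simp
  thus "continuous_on S (\<lambda>s. \<gamma> s w)"
    unfolding continuous_on_iff dist_real_def by (meson le_less_trans)
qed

end

subsection \<open>Cycles around thick points of a triangle\<close>

context cgraph
begin

section \<open>Walks in the graph and the outside of a ball\<close>

lemma chain_relpow:
  assumes "chain xs" "i \<le> j" "j < length xs" shows "(xs ! i, xs ! j) \<in> R ^^ (j - i)"
  using assms(2,3)
proof (induction j rule: dec_induct)
  case (step j)
  have "(xs ! j, xs ! Suc j) \<in> R"
    using assms(1) step.prems by (simp add: successively_conv_nth)
  thus ?case using step by (auto simp: Suc_diff_le)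
qed simp

lemma relpow_chain:
  assumes "(a, b) \<in> R ^^ n"
  obtains xs where "chain xs" "length xs = Suc n" "hd xs = a" "last xs = b"
proof -
  obtain f where f: "f 0 = a" "f n = b" "\<And>i. i < n \<Longrightarrow> (f i, f (Suc i)) \<in> R"
    using assms by (auto simp: relpow_fun_conv)
  have "chain (map f [0..<Suc n])"
    unfolding successively_conv_nth using f(3) by (auto simp del: upt_Suc)
  moreover have "hd (map f [0..<Suc n]) = a" using f(1) by (simp add: hd_map del: upt_Suc)
  moreover have "last (map f [0..<Suc n]) = b" using f(2) by simp
  ultimately show ?thesis using that by (metis length_map length_upt minus_nat.diff_0)
qed

lemma rtrancl_distinct_chain:
  assumes "(a, b) \<in> (R \<inter> V \<times> V)\<^sup>*" "a \<in> V"
  obtains xs where "chain xs" "distinct xs" "xs \<noteq> []" "hd xs = a" "last xs = b" "set xs \<subseteq> V"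
proof -
  have "\<exists>xs. chain xs \<and> distinct xs \<and> xs \<noteq> [] \<and> hd xs = a \<and> last xs = b \<and> set xs \<subseteq> V"
    using assms(1)
  proof (induction rule: rtrancl_induct)
    case base
    show ?case by (rule exI[of _ "[a]"]) (use assms(2) in auto)
  next
    case (step y z)
    then obtain xs where xs: "chain xs" "distinct xs" "xs \<noteq> []" "hd xs = a" "last xs = y" "set xs \<subseteq> V"
      by blast
    show ?case
    proof (cases "z \<in> set xs")
      case True
      then obtain ys zs where "xs = ys @ z # zs" using split_list[OF True] by blast
      hence s: "xs = (ys @ [z]) @ zs" by simp
      have "chain (ys @ [z])" using xs(1) unfolding s successively_append_iff by blast
      moreover have "hd (ys @ [z]) = a" using xs(4) s by (cases ys) auto
      ultimately show ?thesis using xs(2,6) s by (intro exI[of _ "ys @ [z]"]) auto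
    next
      case False
      have "chain (xs @ [z])" using xs step(2) by (auto simp: successively_append_iff)
      thus ?thesis using False xs step(2) by (intro exI[of _ "xs @ [z]"]) auto
    qed
  qed
  thus ?thesis using that by blast
qed

lemma coordinate_IVT:
  fixes T :: "'a point set" and f :: "'a point \<Rightarrow> real"
  assumes "connected T" "s \<in> T" "s' \<in> T" "continuous_on UNIV f" "f s' < \<epsilon>" "\<epsilon> < f s"
  obtains q where "q \<in> T" "f q = \<epsilon>"
proof -
  have "connected (f ` T)"
    using assms(1,4) connected_continuous_image continuous_on_subset by blast
  hence "{f s'..f s} \<subseteq> f ` T"
    by (rule connected_contains_Icc) (use assms in auto)
  moreover have "\<epsilon> \<in> {f s'..f s}" using assms(5,6) by simp
  ultimately obtain q where "q \<in> T" "\<epsilon> = f q" by blast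
  thus ?thesis using that by blast
qed

text \<open>A connected set that avoids the open ball cannot leave an edge both of whose ends lie in the ball.\<close>

lemma outer_end:
  assumes T: "connected T" "T \<subseteq> points G" "\<And>q. q \<in> T \<Longrightarrow> r \<le> gdist G p q" "p \<in> points G"
    and s: "s \<in> T" "s' \<in> T" "on_edge s a b" "0 < s a" "0 < s b" "\<not> on_edge s' a b"
    and b: "gdist G p (vtx b) < r"
  shows "r \<le> gdist G p (vtx a)"
proof (rule ccontr)
  assume a: "\<not> r \<le> gdist G p (vtx a)"
  \<comment> \<open>Among the points of the graph, \<open>f\<close> is positive exactly inside the
    edge \<open>{a, b}\<close>, and a small positive value means closeness to one of its ends. Both
    ends lie in the ball with more than \<open>\<epsilon>\<close> to spare, so \<open>T\<close> has
    no point where \<open>f\<close> equals \<open>\<epsilon>\<close>.\<close>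
  define f :: "'a point \<Rightarrow> real" where "f = (\<lambda>q. min (q a) (q b))"
  define \<epsilon> where "\<epsilon> = min (f s) (min (r - gdist G p (vtx a)) (r - gdist G p (vtx b))) / 2"
  have \<epsilon>: "0 < \<epsilon>" "\<epsilon> < f s" "gdist G p (vtx a) + \<epsilon> < r" "gdist G p (vtx b) + \<epsilon> < r"
    using s(4,5) b a unfolding \<epsilon>_def f_def by (auto simp: min_def field_simps)
  have "f s' \<le> 0"
  proof (rule ccontr)
    assume "\<not> f s' \<le> 0"
    hence "s' a > 0" "s' b > 0" by (auto simp: f_def)
    moreover obtain u v where "on_edge s' u v" using s(2) T(2) points_iff by blast
    moreover have "a \<noteq> b" using s(3) on_edge_R R_verts by blast
    ultimately show False using on_edge_pos on_edge_commute s(6) by metis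
  qed
  hence "f s' < \<epsilon>" using \<epsilon>(1) by linarith
  moreover have "continuous_on UNIV f"
    unfolding f_def by (intro continuous_on_min continuous_on_product_coordinates)
  ultimately obtain q where q: "q \<in> T" "f q = \<epsilon>"
    using coordinate_IVT T(1) s(1,2) \<epsilon>(2) by metis
  have pos: "q a > 0" "q b > 0" using q \<epsilon> by (auto simp: f_def min_def split: if_splits)
  obtain u v where uv: "on_edge q u v" using q T(2) points_iff by blast
  have "a \<noteq> b" using s(3) on_edge_R R_verts by blast
  hence ab: "on_edge q a b" using uv pos on_edge_pos on_edge_commute by metis
  have close: False if "q c = 1 - \<epsilon>" "on_edge q c d" "gdist G p (vtx c) + \<epsilon> < r" for c d
  proof -
    have c: "vtx c \<in> points G" using that(2) on_edge_R R_verts vtx_points by blast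
    have "gdist G p q \<le> gdist G p (vtx c) + gdist G q (vtx c)"
      using gdist_triangle[of p "vtx c" q] gdist_sym[of q] T q c by auto
    also have "\<dots> < r" using gdist_to_vtx[OF that(2)] that by simp
    finally show False using T(3)[OF q(1)] by simp
  qed
  have "q a + q b = 1" using ab by (simp add: on_edge_def)
  moreover have "q a = \<epsilon> \<or> q b = \<epsilon>" using q(2) by (auto simp: f_def min_def split: if_splits)
  ultimately show False
    using close[of a b] close[of b a] ab on_edge_commute \<epsilon>(3,4) by fastforce
qed

text \<open>An edge that leaves the component \<open>K\<close> of \<open>a\<close> among the outer
  vertices ends at an inner vertex. If \<open>a'\<close> were not in \<open>K\<close>, the connected
  set \<open>T\<close> would contain a point of total weight \<open>\<epsilon>\<close> on
  \<open>K\<close>; such a point is within \<open>\<epsilon>\<close> of an inner vertex, hence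
  inside the ball.\<close>

lemma outer_connected:
  assumes T: "connected T" "T \<subseteq> points G" "\<And>q. q \<in> T \<Longrightarrow> r \<le> gdist G p q" "p \<in> points G"
    and s: "s \<in> T" "on_edge s a b" "0 < s a" "gdist G p (vtx b) < r"
    and s': "s' \<in> T" "on_edge s' a' b'" "gdist G p (vtx b') < r"
    and V: "V = {w \<in> verts G. r \<le> gdist G p (vtx w)}" "a \<in> V" "a' \<in> V"
  shows "(a, a') \<in> (R \<inter> V \<times> V)\<^sup>*"
proof (rule ccontr)
  assume na: "(a, a') \<notin> (R \<inter> V \<times> V)\<^sup>*"
  define K where "K = {w. (a, w) \<in> (R \<inter> V \<times> V)\<^sup>*}"
  have KV: "K \<subseteq> V"
  proof
    fix w assume "w \<in> K"
    hence "(a, w) \<in> (R \<inter> V \<times> V)\<^sup>*" by (simp add: K_def)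
    thus "w \<in> V" using V(2) by (cases rule: rtranclE) auto
  qed
  have fK: "finite K" using KV V(1) finite_verts finite_subset by fastforce
  define f :: "'a point \<Rightarrow> real" where "f = (\<lambda>q. \<Sum>w\<in>K. q w)"
  have f_ge: "q w \<le> f q" if "q \<in> points G" "w \<in> K" for q w
    unfolding f_def using that fK points_iff on_edge_bounds by (metis member_le_sum Diff_iff)
  define U where "U = verts G - V"
  \<comment> \<open>One \<open>\<epsilon>\<close> has to serve all inner vertices at once: it is
    below each of their margins to the radius and below the weight of \<open>s\<close> at
    \<open>a\<close>.\<close>
  define D where "D = insert (s a) ((\<lambda>w. r - gdist G p (vtx w)) ` U)"
  have fD: "finite D" "D \<noteq> {}" using finite_verts by (auto simp: D_def U_def)
  have "\<And>d. d \<in> D \<Longrightarrow> 0 < d" using s(3) V(1) by (auto simp: D_def U_def)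
  hence D0: "0 < Min D" using fD by simp
  define \<epsilon> where "\<epsilon> = Min D / 2"
  have \<epsilon>: "0 < \<epsilon>" "\<epsilon> < d" if "d \<in> D" for d
    using D0 Min_le[OF fD(1) that] by (auto simp: \<epsilon>_def)
  have \<epsilon>s: "0 < \<epsilon>" "\<epsilon> < s a" using \<epsilon>[of "s a"] by (auto simp: D_def)
  have aK: "a \<in> K" by (simp add: K_def)
  have "s a \<le> 1" using on_edge_bounds s(2) by blast
  have "s a \<le> f s" using f_ge aK s(1) T(2) by blast
  hence 1: "\<epsilon> < f s" using \<epsilon>s by linarith
  have "w \<in> K \<Longrightarrow> s' w = 0" for w
    using s'(2,3) na KV V(1) unfolding on_edge_def K_def by auto
  hence "f s' = 0" by (simp add: f_def)
  hence 2: "f s' < \<epsilon>" using \<epsilon>s by simp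
  have "continuous_on UNIV f"
    unfolding f_def by (intro continuous_on_sum continuous_on_product_coordinates)
  then obtain q where q: "q \<in> T" "f q = \<epsilon>"
    using coordinate_IVT T(1) s(1) s'(1) 1 2 by metis
  have qp: "q \<in> points G" using q T(2) by blast
  obtain w where w: "w \<in> K" "q w > 0"
  proof (rule ccontr)
    assume "\<not> thesis"
    hence "\<forall>w\<in>K. q w \<le> 0" using that by force
    hence "f q \<le> 0" unfolding f_def by (simp add: sum_nonpos)
    thus False using q \<epsilon>s by simp
  qed
  obtain w' where ww: "on_edge q w w'" using on_edge_at_pos qp w(2) by blast
  have ne: "w \<noteq> w'" using ww on_edge_R R_verts by blast
  have sum1: "q w + q w' = 1" using ww by (simp add: on_edge_def)
  show False
  proof (cases "w' \<in> K")
    \<comment> \<open>With both ends in \<open>K\<close> the weight would be 1, but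
      \<open>\<epsilon> < s a \<le> 1\<close>.\<close>
    case True
    have "sum q {w, w'} \<le> f q"
      unfolding f_def by (rule sum_mono2[OF fK]) (use w True on_edge_bounds[OF ww] in auto)
    thus False using ne sum1 q \<epsilon>s \<open>s a \<le> 1\<close> by simp
  next
    case False
    have "w' \<in> verts G" using ww on_edge_R R_verts by blast
    moreover have "w' \<notin> V"
    proof
      assume "w' \<in> V"
      hence "(w, w') \<in> R \<inter> V \<times> V" using on_edge_R[OF ww] w(1) KV by blast
      moreover have "(a, w) \<in> (R \<inter> V \<times> V)\<^sup>*" using w(1) by (simp add: K_def)
      ultimately have "w' \<in> K" unfolding K_def by (blast intro: rtrancl_into_rtrancl)
      thus False using False by simp
    qed
    ultimately have U: "w' \<in> U" by (simp add: U_def)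
    have "q w \<le> \<epsilon>" using f_ge[OF qp w(1)] q(2) by simp
    moreover have "gdist G q (vtx w') \<le> 1 - q w'"
      using gdist_to_vtx ww on_edge_commute by blast
    ultimately have "gdist G p q \<le> gdist G p (vtx w') + \<epsilon>"
      using gdist_triangle[of p "vtx w'" q] gdist_sym[of q] T(4) qp sum1 vtx_points[OF \<open>w' \<in> verts G\<close>]
      by simp
    moreover have "r - gdist G p (vtx w') \<in> D" using U by (simp add: D_def)
    ultimately have "gdist G p q < r" using \<epsilon>(2) by fastforce
    thus False using T(3)[OF q(1)] by simp
  qed
qed

text \<open>
  A shortest way from \<open>p\<close>, inside the edge \<open>{e, e'}\<close>, through \<open>e\<close> and the vertices \<open>xs\<close> to the
  point \<open>q\<close>, which lies between the end of \<open>e' # xs\<close> and \<open>v\<close>. The list \<open>xs\<close> is empty when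
  \<open>q\<close> lies between \<open>p\<close> and \<open>e = v\<close>.
\<close>

definition ray :: "'a point \<Rightarrow> 'a \<Rightarrow> 'a \<Rightarrow> 'a point \<Rightarrow> real \<Rightarrow> 'a list \<Rightarrow> 'a \<Rightarrow> bool" where
  "ray p e e' q r xs v \<longleftrightarrow> on_edge p e e' \<and> chain (xs @ [v]) \<and> hd (xs @ [v]) = e \<and>
     on_edge q v (last (e' # xs)) \<and> r = real (length xs) - p e + q v"

lemma ray_exists:
  assumes p: "on_edge p e1 e2" "0 < p e1" "p e1 < 1" and q: "q \<in> points G" "\<And>w. q w < 1"
  obtains e e' xs v where "(e = e1 \<and> e' = e2) \<or> (e = e2 \<and> e' = e1)"
    "ray p e e' q (gdist G p q) xs v"
proof -
  have pp: "p \<in> points G" using p on_edge_points by blast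
  have cm: "on_edge p e2 e1" using p on_edge_commute by blast
  from pp q(1) show ?thesis
  proof (cases rule: gdist_cases)
    case (edge u v)
    have s: "(e1 = u \<and> e2 = v) \<or> (e1 = v \<and> e2 = u)"
      using on_edge_interior[OF p(1) edge(1) p(2,3)] .
    \<comment> \<open>The end with the larger coordinate at \<open>q\<close> is the one towards
      which \<open>q\<close> lies; the ray starts there and has no vertices before
      \<open>q\<close>.\<close>
    consider "p u \<le> q u" | "p v \<le> q v"
      using on_edge_diff[OF edge(1,2)] edge(1,2) by (force simp: on_edge_def)
    thus ?thesis
    proof cases
      case 1
      have "ray p u v q (gdist G p q) [] u"
        using edge 1 by (auto simp: ray_def)
      thus ?thesis using that s by blast
    next
      case 2
      have "ray p v u q (gdist G p q) [] v"
        using edge 2 on_edge_commute on_edge_diff[OF edge(1,2)] by (auto simp: ray_def)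
      thus ?thesis using that s by blast
    qed
  next
    case (via a b n)
    obtain b' where b': "on_edge q b b'" using on_edge_at_pos q(1) via(2) by blast
    obtain xs where xs: "chain xs" "length xs = Suc n" "hd xs = a" "last xs = b"
      using relpow_chain via(3) by blast
    have ne: "xs \<noteq> []" using xs(2) by auto
    have a: "a = e1 \<or> a = e2" using on_edge_pos p(1) via(1) by blast
    define e' where "e' = (if a = e1 then e2 else e1)"
    have "on_edge p a e'" using a p(1) cm by (auto simp: e'_def)
    moreover have "chain (xs @ [b'])"
      using xs ne b' on_edge_R by (auto simp: successively_append_iff)
    moreover have "gdist G p q = real (length xs) - p a + q b'"
      using via(4) xs(2) b' by (auto simp: on_edge_def)
    ultimately have "ray p a e' q (gdist G p q) xs b'"
      using ne xs b' on_edge_commute by (auto simp: ray_def)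
    thus ?thesis using that a unfolding e'_def by metis
  qed
qed

text \<open>The absolute value covers both positions of \<open>q\<close>: beyond \<open>e\<close>,
  or between \<open>p\<close> and \<open>e\<close>, where \<open>xs\<close> is empty.\<close>

lemma ray_bound:
  assumes "ray p e e' q r xs v"
  shows "gdist G (vtx e) q \<le> \<bar>r - (1 - p e)\<bar>"
proof (cases "xs = []")
  case True
  hence "on_edge q e e'" "r = q e - p e" using assms by (auto simp: ray_def)
  thus ?thesis using gdist_to_vtx[of q e e'] gdist_sym[of q] on_edge_bounds[of q e e' e] by simp
next
  case False
  have o: "on_edge q (last xs) v" "chain xs" "hd xs = e"
    using assms False on_edge_commute by (auto simp: ray_def successively_append_iff)
  have "(xs ! 0, xs ! (length xs - 1)) \<in> R ^^ (length xs - 1 - 0)"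
    using chain_relpow[OF o(2), of 0 "length xs - 1"] False by simp
  hence r: "(e, last xs) \<in> R ^^ (length xs - 1)"
    using False o(3) by (simp add: hd_conv_nth last_conv_nth)
  have pe: "on_edge p e e'" using assms by (simp add: ray_def)
  have "gdist G (vtx e) q \<le> 1 - vtx e e + real (length xs - 1) + (1 - q (last xs))"
    using gdist_via[OF on_edge_vtx[OF on_edge_R[OF pe]] r o(1)] .
  also have "\<dots> = r - (1 - p e)"
  proof -
    have "q (last xs) + q v = 1" using o(1) by (simp add: on_edge_def)
    moreover have "real (length xs - 1) = real (length xs) - 1" using False by (cases xs) auto
    ultimately show ?thesis using assms by (auto simp: ray_def)
  qed
  finally show ?thesis by simp
qed

lemma ray_dist:
  assumes "ray p e e' q r xs v" "i < length xs"
  shows "gdist G p (vtx (xs ! i)) \<le> 1 - p e + real i"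
proof -
  have xs: "on_edge p e e'" "chain xs" "xs \<noteq> []"
    using assms by (auto simp: ray_def successively_append_iff)
  hence "hd xs = e" using assms by (simp add: ray_def)
  hence r: "(e, xs ! i) \<in> R ^^ i"
    using chain_relpow[OF xs(2), of 0 i] assms(2) xs(3) by (simp add: hd_conv_nth)
  have c: "chain (xs @ [v])" using assms(1) by (simp add: ray_def)
  have "((xs @ [v]) ! i, (xs @ [v]) ! Suc i) \<in> R"
    using c assms(2) unfolding successively_conv_nth by simp
  hence "(xs ! i, (xs @ [v]) ! Suc i) \<in> R" using assms(2) by (simp add: nth_append)
  thus ?thesis using gdist_via[OF xs(1) r on_edge_vtx] by simp
qed

text \<open>
  The cycle \<open>ws @ us\<close> passes through the two points at distance \<open>r\<close> from \<open>p\<close>: one at distance \<open>\<alpha>\<close>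
  before \<open>hd ws\<close>, one at distance \<open>\<alpha>'\<close> behind \<open>last ws\<close>. The vertices \<open>ws\<close> lie in the open ball
  of radius \<open>r\<close> around \<open>p\<close>, the vertices \<open>us\<close> do not.
\<close>

definition config :: "real \<Rightarrow> 'a list \<Rightarrow> 'a list \<Rightarrow> real \<Rightarrow> real \<Rightarrow> bool" where
  "config r ws us \<alpha> \<alpha>' \<longleftrightarrow> ws \<noteq> [] \<and> us \<noteq> [] \<and> distinct (ws @ us) \<and> chain (ws @ us) \<and>
     (last us, hd ws) \<in> R \<and> 0 < \<alpha> \<and> \<alpha> < 1 \<and> 0 < \<alpha>' \<and> \<alpha>' < 1 \<and> \<alpha> + (real (length ws) - 1) + \<alpha>' = 2 * r \<and>
     (\<forall>l. (hd us, last us) \<in> R ^^ l \<longrightarrow> 2 * r \<le> 1 - \<alpha>' + real l + (1 - \<alpha>)) \<and>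
     (\<forall>l. (last ws, last us) \<in> R ^^ l \<longrightarrow> 2 * r \<le> \<alpha>' + real l + (1 - \<alpha>)) \<and>
     (\<forall>l. (hd us, hd ws) \<in> R ^^ l \<longrightarrow> 2 * r \<le> 1 - \<alpha>' + real l + \<alpha>) \<and>
     (\<forall>l. (hd ws, last ws) \<in> R ^^ l \<longrightarrow> 2 * r \<le> \<alpha> + real l + \<alpha>') \<and>
     (\<forall>i<length ws. \<forall>u\<in>set us. \<forall>l. (ws ! i, u) \<in> R ^^ l \<longrightarrow>
        \<alpha> + real i \<le> real l \<or> \<alpha>' + real (length ws - 1 - i) \<le> real l)"

text \<open>The shortest ways from \<open>p\<close> to \<open>q\<close> and to \<open>q'\<close>
  leave the edge of \<open>p\<close> through different ends, as a common end would bring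
  \<open>q\<close> and \<open>q'\<close> closer than \<open>2 * r\<close>. Joined at
  \<open>p\<close> they run through \<open>ws\<close>; \<open>outer_connected\<close> supplies
  \<open>us\<close>, and the remaining clauses are triangle inequalities.\<close>

lemma config_exists:
  assumes p: "on_edge p e1 e2" "0 < p e1" "p e1 < 1"
    and q: "q \<in> points G" "\<And>w. q w < 1" and q': "q' \<in> points G" "\<And>w. q' w < 1"
    and r: "gdist G p q = r" "gdist G p q' = r" "gdist G q q' = 2 * r" "1 < 2 * r"
    and T: "connected T" "T \<subseteq> points G" "\<And>t. t \<in> T \<Longrightarrow> r \<le> gdist G p t" "q \<in> T" "q' \<in> T"
  obtains ws us \<alpha> \<alpha>' where "config r ws us \<alpha> \<alpha>'"
proof -
  obtain e e' xs a where e: "(e = e1 \<and> e' = e2) \<or> (e = e2 \<and> e' = e1)" and ray1: "ray p e e' q r xs a"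
    using ray_exists[OF p q] r(1) by metis
  obtain h h' ys a' where h: "(h = e1 \<and> h' = e2) \<or> (h = e2 \<and> h' = e1)" and ray2: "ray p h h' q' r ys a'"
    using ray_exists[OF p q'] r(2) by metis
  have pe: "on_edge p e e'" using ray1 by (simp add: ray_def)
  have pp: "p \<in> points G" using p on_edge_points by blast
  have pos: "0 < p e" "p e < 1" "p e + p e' = 1"
    using e p by (auto simp: on_edge_def)
  have hh: "h = e'" "h' = e"
  proof -
    have "h \<noteq> e"
    proof
      \<comment> \<open>The way from \<open>q\<close> to \<open>q'\<close> over \<open>e\<close> has
        length at most \<open>2 * \<bar>r - (1 - p e)\<bar>\<close>, and \<open>1 < 2 * r\<close>
        makes this less than \<open>2 * r\<close> even if both points lie before
        \<open>e\<close>.\<close>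
      assume "h = e"
      hence "gdist G (vtx e) q' \<le> \<bar>r - (1 - p e)\<bar>" using ray_bound[OF ray2] by simp
      moreover have "gdist G (vtx e) q \<le> \<bar>r - (1 - p e)\<bar>" using ray_bound[OF ray1] .
      moreover have "vtx e \<in> points G" using pe on_edge_R R_verts vtx_points by blast
      ultimately have "2 * r \<le> 2 * \<bar>r - (1 - p e)\<bar>"
        using gdist_triangle[of q "vtx e" q'] gdist_sym[of q] q(1) q'(1) r(3) by simp
      thus False using pos r(4) by (simp add: abs_if split: if_splits)
    qed
    thus "h = e'" "h' = e" using e h by blast+
  qed
  define \<alpha> \<alpha>' where "\<alpha> = q a" and "\<alpha>' = q' a'"
  define ws where "ws = rev xs @ ys"
  have c1: "chain (xs @ [a])" "hd (xs @ [a]) = e" "on_edge q a (last (e' # xs))" "r = real (length xs) - p e + \<alpha>"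
    using ray1 by (auto simp: ray_def \<alpha>_def)
  have c2: "chain (ys @ [a'])" "hd (ys @ [a']) = e'" "on_edge q' a' (last (e # ys))" "r = real (length ys) - p e' + \<alpha>'"
    using ray2 by (auto simp: ray_def \<alpha>'_def hh)
  have \<alpha>1: "\<alpha> < 1" "\<alpha>' < 1" using q(2) q'(2) by (auto simp: \<alpha>_def \<alpha>'_def)
  have "q (last (e' # xs)) < 1" "q' (last (e # ys)) < 1" using q(2) q'(2) by blast+
  hence \<alpha>0: "0 < \<alpha>" "0 < \<alpha>'" using c1(3) c2(3) unfolding \<alpha>_def \<alpha>'_def on_edge_def by linarith+
  have len: "\<alpha> + (real (length ws) - 1) + \<alpha>' = 2 * r"
    using c1(4) c2(4) pos(3) by (simp add: ws_def)
  hence "ws \<noteq> []" using r(4) \<alpha>1 by auto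
  have rev_eq: "successively (\<lambda>y x. (x, y) \<in> R) zs = chain zs" for zs
    using successively_cong[of zs] by (metis (mono_tags) R_sym)
  have crev: "chain (a # rev xs)"
  proof -
    have "chain (rev (xs @ [a]))" unfolding successively_rev rev_eq by (rule c1(1))
    thus ?thesis by simp
  qed
  have chain_ws: "chain (a # ws @ [a'])"
  proof -
    have "last (a # rev xs) = e" using c1(2) by (cases xs) auto
    hence "chain ((a # rev xs) @ (ys @ [a']))"
      using crev c2(1,2) on_edge_R[OF pe] successively_append_iff[of _ "a # rev xs" "ys @ [a']"]
      by (metis list.distinct(1) snoc_eq_iff_butlast)
    thus ?thesis by (simp add: ws_def)
  qed
  hence cws: "(a, hd ws) \<in> R" "(last ws, a') \<in> R" "chain ws"
    using \<open>ws \<noteq> []\<close> by (auto simp: successively_append_iff successively_Cons)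
  have hdws: "hd ws = last (e' # xs)"
    using c2(2) \<open>ws \<noteq> []\<close> by (cases xs rule: rev_cases) (auto simp: ws_def)
  have lastws: "last ws = last (e # ys)"
  proof (cases "ys = []")
    case True
    hence "xs \<noteq> []" using \<open>ws \<noteq> []\<close> by (simp add: ws_def)
    thus ?thesis using True c1(2) by (simp add: ws_def last_rev)
  qed (simp add: ws_def)
  have oq: "on_edge q a (hd ws)" "on_edge q (hd ws) a" and oq': "on_edge q' a' (last ws)" "on_edge q' (last ws) a'"
    using c1(3) c2(3) hdws lastws on_edge_commute by auto
  have \<alpha>eq: "q a = \<alpha>" "q (hd ws) = 1 - \<alpha>" "q' a' = \<alpha>'" "q' (last ws) = 1 - \<alpha>'"
    using oq oq' by (auto simp: \<alpha>_def \<alpha>'_def on_edge_def)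
  \<comment> \<open>Each of \<open>q\<close> and \<open>q'\<close> can be left through two ends of
    its edge; the four combinations are the four walk inequalities of \<open>config\<close>.\<close>
  have via: "2 * r \<le> 1 - q b + real l + (1 - q' b')" if "on_edge q b c" "(b, b') \<in> R ^^ l" "on_edge q' b' c'" for b b' c c' l
    using gdist_via[OF that] r(3) by simp
  have D1: "\<alpha>' + real l + (1 - \<alpha>) \<ge> 2 * r" if "(last ws, a) \<in> R ^^ l" for l
    using via[OF oq(1) relpow_R_sym[OF that] oq'(2)] \<alpha>eq by simp
  have D2: "1 - \<alpha>' + real l + (1 - \<alpha>) \<ge> 2 * r" if "(a', a) \<in> R ^^ l" for l
    using via[OF oq(1) relpow_R_sym[OF that] oq'(1)] \<alpha>eq by simp
  have D3: "1 - \<alpha>' + real l + \<alpha> \<ge> 2 * r" if "(a', hd ws) \<in> R ^^ l" for l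
    using via[OF oq(2) relpow_R_sym[OF that] oq'(1)] \<alpha>eq by simp
  have D4: "\<alpha> + real l + \<alpha>' \<ge> 2 * r" if "(hd ws, last ws) \<in> R ^^ l" for l
    using via[OF oq(2) that oq'(2)] \<alpha>eq by simp
  \<comment> \<open>Two alternatives, since \<open>ws ! i\<close> lies on the ray to
    \<open>q\<close> or on the ray to \<open>q'\<close>; each bound counts back from distance
    \<open>r\<close> at the end of that ray.\<close>
  have ball: "gdist G p (vtx (ws ! i)) \<le> r - \<alpha> - real i \<or>
      gdist G p (vtx (ws ! i)) \<le> r - \<alpha>' - real (length ws - 1 - i)" if i: "i < length ws" for i
  proof (cases "i < length xs")
    case True
    hence "ws ! i = xs ! (length xs - 1 - i)" by (simp add: ws_def nth_append rev_nth)
    hence "gdist G p (vtx (ws ! i)) \<le> 1 - p e + real (length xs - 1 - i)"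
      using ray_dist[OF ray1, of "length xs - 1 - i"] True by simp
    thus ?thesis using True c1(4) by (simp add: of_nat_diff)
  next
    case False
    hence "ws ! i = ys ! (i - length xs)" by (simp add: ws_def nth_append)
    moreover have il: "i - length xs < length ys" using False i by (simp add: ws_def)
    ultimately have "gdist G p (vtx (ws ! i)) \<le> 1 - p e' + real (i - length xs)"
      using ray_dist[OF ray2[unfolded hh] il] by simp
    moreover have "real (length ws - 1 - i) = real (length ys) - 1 - real (i - length xs)"
      using False i by (auto simp: ws_def of_nat_diff)
    ultimately show ?thesis using c2(4) by simp
  qed
  have ball': "gdist G p (vtx w) < r" if w: "w \<in> set ws" for w
  proof -
    obtain i where "i < length ws" "w = ws ! i" using w by (metis in_set_conv_nth)
    thus ?thesis using ball[of i] \<alpha>0 by fastforce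
  qed
  have wsv: "set ws \<subseteq> verts G"
  proof
    fix w assume "w \<in> set ws"
    then obtain i where i: "i < length ws" "w = ws ! i" by (metis in_set_conv_nth)
    have "((a # ws @ [a']) ! i, (a # ws @ [a']) ! Suc i) \<in> R"
      using chain_ws i(1) unfolding successively_conv_nth by simp
    hence "((a # ws @ [a']) ! i, w) \<in> R" using i by (simp add: nth_append)
    thus "w \<in> verts G" using R_verts by blast
  qed
  \<comment> \<open>An edge has length \<open>1 < 2 * r\<close>. This provides the point of
    \<open>T\<close> off the given edge that \<open>outer_end\<close> asks for.\<close>
  have not_same: "\<not> on_edge q' u v" if "on_edge q u v" for u v
  proof
    assume "on_edge q' u v"
    hence "2 * r \<le> \<bar>q u - q' u\<bar>" using gdist_edge[OF that, of q'] r(3) by linarith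
    moreover have "\<bar>q u - q' u\<bar> \<le> 1"
      using on_edge_bounds[OF that, of u] on_edge_bounds[OF \<open>on_edge q' u v\<close>, of u] by linarith
    ultimately show False using r(4) by linarith
  qed
  have in_ws: "hd ws \<in> set ws" "last ws \<in> set ws" using \<open>ws \<noteq> []\<close> by auto
  have av: "a \<in> verts G" "a' \<in> verts G" using cws R_verts by blast+
  have "r \<le> gdist G p (vtx a)"
    by (rule outer_end[OF T(1-3) pp T(4,5) oq(1) _ _ not_same[OF oq(1)] ball'[OF in_ws(1)]])
      (use \<alpha>eq \<alpha>0 \<alpha>1 in auto)
  moreover have "r \<le> gdist G p (vtx a')"
    by (rule outer_end[OF T(1-3) pp T(5,4) oq'(1) _ _ _ ball'[OF in_ws(2)]])
      (use \<alpha>eq \<alpha>0 \<alpha>1 not_same oq'(1) in auto)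
  moreover define V where "V = {w \<in> verts G. r \<le> gdist G p (vtx w)}"
  ultimately have aV: "a \<in> V" "a' \<in> V" using av by auto
  have "(a', a) \<in> (R \<inter> V \<times> V)\<^sup>*"
    by (rule outer_connected[OF T(1-3) pp T(5) oq'(1) _ ball'[OF in_ws(2)] T(4) oq(1) ball'[OF in_ws(1)] V_def aV(2,1)])
      (use \<alpha>eq \<alpha>0 in auto)
  then obtain us where us: "chain us" "distinct us" "us \<noteq> []" "hd us = a'" "last us = a" "set us \<subseteq> V"
    using rtrancl_distinct_chain aV(2) by blast
  have disj: "set ws \<inter> set us = {}" using us(6) ball' by (force simp: V_def)
  \<comment> \<open>A shortcut between two vertices of \<open>ws\<close> would shorten the walk from
    \<open>hd ws\<close> to \<open>last ws\<close>, against \<open>D4\<close>. The case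
    \<open>l = 0\<close> yields distinctness.\<close>
  have geo: "j - i \<le> l" if "(ws ! i, ws ! j) \<in> R ^^ l" "i \<le> j" "j < length ws" for i j l
  proof -
    have "(ws ! 0, ws ! i) \<in> R ^^ (i - 0)" "(ws ! j, ws ! (length ws - 1)) \<in> R ^^ (length ws - 1 - j)"
      using chain_relpow[OF cws(3), of 0 i] chain_relpow[OF cws(3), of j "length ws - 1"] that by auto
    hence "(hd ws, last ws) \<in> R ^^ (i + l + (length ws - 1 - j))"
      using that(1) \<open>ws \<noteq> []\<close> unfolding relpow_add hd_conv_nth[OF \<open>ws \<noteq> []\<close>] last_conv_nth[OF \<open>ws \<noteq> []\<close>]
      by (metis diff_zero relcompI)
    from D4[OF this] have "real (length ws) - 1 \<le> real (i + l + (length ws - 1 - j))"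
      using len by simp
    thus ?thesis using that by linarith
  qed
  have "distinct ws"
    unfolding distinct_conv_nth
  proof (intro allI impI)
    fix i j assume ij: "i < length ws" "j < length ws" "i \<noteq> j"
    show "ws ! i \<noteq> ws ! j"
    proof
      assume "ws ! i = ws ! j"
      hence "(ws ! i, ws ! j) \<in> R ^^ 0" "(ws ! j, ws ! i) \<in> R ^^ 0" by auto
      thus False using geo[of i j 0] geo[of j i 0] ij by linarith
    qed
  qed
  hence dis: "distinct (ws @ us)" using us disj by simp
  have chn: "chain (ws @ us)" using cws us by (simp add: successively_append_iff)
  have last: "\<alpha> + real i \<le> real l \<or> \<alpha>' + real (length ws - 1 - i) \<le> real l"
    if i: "i < length ws" and u: "u \<in> set us" and l: "(ws ! i, u) \<in> R ^^ l" for i u l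
  proof -
    have "r \<le> gdist G p (vtx u)" using u us(6) by (auto simp: V_def)
    moreover have iv: "ws ! i \<in> verts G" using wsv i by auto
    moreover have "u \<in> verts G" using u us(6) by (auto simp: V_def)
    ultimately have "r \<le> gdist G p (vtx (ws ! i)) + real l"
      using gdist_triangle[OF pp vtx_points[OF iv] vtx_points] gdist_vtx[OF l iv] by fastforce
    thus ?thesis using ball[OF i] by linarith
  qed
  have "config r ws us \<alpha> \<alpha>'"
    unfolding config_def
    using \<open>ws \<noteq> []\<close> us(3-5) dis chn \<alpha>0 \<alpha>1 len cws(1) D1 D2 D3 D4 last by auto
  thus ?thesis using that by blast
qed

end

section \<open>Sides of geodesic triangles and the hyperbolicity constant\<close>

context cgraph
begin

lemma geodesicE:
  assumes "is_geodesic G x y A" "x \<in> points G" "y \<in> points G"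
  obtains \<gamma> L where "0 \<le> L" "\<gamma> 0 = x" "\<gamma> L = y" "A = \<gamma> ` {0..L}" "A \<subseteq> points G"
    "\<And>s t. s \<in> {0..L} \<Longrightarrow> t \<in> {0..L} \<Longrightarrow> gdist G (\<gamma> s) (\<gamma> t) = \<bar>s - t\<bar>" "continuous_on {0..L} \<gamma>"
proof -
  obtain \<gamma> where g: "\<gamma> 0 = x" "\<gamma> (gdist G x y) = y" "A = \<gamma> ` {0..gdist G x y}" "A \<subseteq> points G"
    "\<forall>s\<in>{0..gdist G x y}. \<forall>t\<in>{0..gdist G x y}. gdist G (\<gamma> s) (\<gamma> t) = \<bar>s - t\<bar>"
    using assms(1) unfolding is_geodesic_def by blast
  moreover have "continuous_on {0..gdist G x y} \<gamma>"
    by (rule isometric_continuous) (use g in auto)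
  ultimately show ?thesis using that[of "gdist G x y" \<gamma>] gdist_nonneg assms by blast
qed

lemma geodesic_connected:
  assumes "is_geodesic G x y A" "x \<in> points G" "y \<in> points G"
  shows "connected A" "x \<in> A" "y \<in> A" "A \<subseteq> points G"
proof -
  obtain \<gamma> L where g: "(0::real) \<le> L" "\<gamma> 0 = x" "\<gamma> L = y" "A = \<gamma> ` {0..L}" "A \<subseteq> points G" "continuous_on {0..L} \<gamma>"
    using geodesicE[OF assms] by metis
  show "connected A" using g connected_continuous_image connected_Icc by blast
  show "x \<in> A" "y \<in> A" "A \<subseteq> points G" using g by auto
qed

text \<open>By compactness, a strict lower bound on the distances from \<open>p\<close> to a side
  leaves a positive gap, which is the room for the perturbation below.\<close>

lemma geodesic_nearest:
  assumes "is_geodesic G x y A" "x \<in> points G" "y \<in> points G" "p \<in> points G"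
  obtains q where "q \<in> A" "\<And>q'. q' \<in> A \<Longrightarrow> gdist G p q \<le> gdist G p q'"
proof -
  obtain \<gamma> L where g: "(0::real) \<le> L" "A = \<gamma> ` {0..L}" "A \<subseteq> points G"
    and iso: "\<And>s t. s \<in> {0..L} \<Longrightarrow> t \<in> {0..L} \<Longrightarrow> gdist G (\<gamma> s) (\<gamma> t) = \<bar>s - t\<bar>"
    using geodesicE[OF assms(1-3)] by metis
  have "\<bar>gdist G p (\<gamma> s) - gdist G p (\<gamma> t)\<bar> \<le> \<bar>s - t\<bar>" if "s \<in> {0..L}" "t \<in> {0..L}" for s t
  proof -
    have "\<gamma> s \<in> points G" "\<gamma> t \<in> points G" using g that by auto
    thus ?thesis
      using gdist_triangle[of p "\<gamma> s" "\<gamma> t"] gdist_triangle[of p "\<gamma> t" "\<gamma> s"] iso[of s t] iso[of t s] that assms(4)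
      by auto
  qed
  hence "continuous_on {0..L} (\<lambda>t. gdist G p (\<gamma> t))"
    unfolding continuous_on_iff dist_real_def by (meson le_less_trans)
  then obtain t where "t \<in> {0..L}" "\<forall>s\<in>{0..L}. gdist G p (\<gamma> t) \<le> gdist G p (\<gamma> s)"
    using continuous_attains_inf[of "{0..L}"] g(1) by force
  thus ?thesis using that g(2) by blast
qed

lemma interval_avoiding_finite:
  assumes "finite F" "(a::real) < b" obtains t where "a < t" "t < b" "t \<notin> F"
proof -
  have "infinite ({a<..<b} - F)"
    using assms infinite_Ioo by (simp add: Diff_infinite_finite)
  hence "{a<..<b} - F \<noteq> {}" by (metis finite.emptyI)
  then obtain t where "t \<in> {a<..<b} - F" by blast
  thus ?thesis using that by auto
qed

text \<open>
  Since only finitely many points of a side are vertices, \<open>p\<close> and the radius can be perturbed so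
  that neither \<open>p\<close> nor the two points of the side at distance \<open>r\<close> from it are vertices.
\<close>

lemma thick_side_config:
  assumes pts: "x \<in> points G" "y \<in> points G" "z \<in> points G"
    and geo: "is_geodesic G x y A" "is_geodesic G y z B" "is_geodesic G z x C"
    and p: "p \<in> A" "\<And>q. q \<in> B \<union> C \<Longrightarrow> R0 < gdist G p q" and R0: "1 / 2 \<le> R0"
  obtains r ws us \<alpha> \<alpha>' where "R0 < r" "config r ws us \<alpha> \<alpha>'"
proof -
  obtain \<gamma> L where g: "0 \<le> L" "\<gamma> 0 = x" "\<gamma> L = y" "A = \<gamma> ` {0..L}" "A \<subseteq> points G"
    and iso: "\<And>s t. s \<in> {0..L} \<Longrightarrow> t \<in> {0..L} \<Longrightarrow> gdist G (\<gamma> s) (\<gamma> t) = \<bar>s - t\<bar>"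
    and cont: "continuous_on {0..L} \<gamma>"
    using geodesicE[OF geo(1) pts(1,2)] by metis
  note B = geodesic_connected[OF geo(2) pts(2,3)] and C = geodesic_connected[OF geo(3) pts(3,1)]
  have pp: "p \<in> points G" using p(1) g(5) by blast
  have \<gamma>p: "\<gamma> t \<in> points G" if "t \<in> {0..L}" for t using that g by blast
  obtain t0 where t0: "t0 \<in> {0..L}" "p = \<gamma> t0" using p(1) g(4) by blast
  obtain qB where qB: "qB \<in> B" "\<And>q'. q' \<in> B \<Longrightarrow> gdist G p qB \<le> gdist G p q'"
    using geodesic_nearest[OF geo(2) pts(2,3) pp] by blast
  obtain qC where qC: "qC \<in> C" "\<And>q'. q' \<in> C \<Longrightarrow> gdist G p qC \<le> gdist G p q'"
    using geodesic_nearest[OF geo(3) pts(3,1) pp] by blast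
  define \<rho> where "\<rho> = min (gdist G p qB) (gdist G p qC)"
  have \<rho>: "R0 < \<rho>" "\<And>q. q \<in> B \<union> C \<Longrightarrow> \<rho> \<le> gdist G p q"
    using p(2) qB qC unfolding \<rho>_def by (auto simp: min_le_iff_disj)
  \<comment> \<open>Half of the gap pays for moving \<open>p\<close> by less than
    \<open>\<eta>\<close>, the other half for raising \<open>R0\<close> to \<open>r\<close> by less
    than \<open>\<eta>\<close>; the moved point still has distance more than \<open>r\<close> from
    \<open>B\<close> and \<open>C\<close>.\<close>
  define \<eta> where "\<eta> = (\<rho> - R0) / 2"
  have \<eta>: "0 < \<eta>" "R0 + \<eta> = \<rho> - \<eta>" using \<rho>(1) by (auto simp: \<eta>_def field_simps)
  define F where "F = {t \<in> {0..L}. \<exists>w. \<gamma> t w = 1}"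
  have "\<gamma> ` F \<subseteq> vtx ` verts G"
  proof
    fix q assume "q \<in> \<gamma> ` F"
    then obtain t w where t: "q = \<gamma> t" "t \<in> {0..L}" "q w = 1" by (auto simp: F_def)
    then obtain w' where "on_edge q w w'" using on_edge_at_pos[of q w] \<gamma>p by auto
    thus "q \<in> vtx ` verts G" using on_edge_full t(3) on_edge_R R_verts by blast
  qed
  moreover have "inj_on \<gamma> F"
  proof
    fix s t assume st: "s \<in> F" "t \<in> F" "\<gamma> s = \<gamma> t"
    have "\<bar>s - t\<bar> = gdist G (\<gamma> s) (\<gamma> s)" using st iso[of s t] by (auto simp: F_def)
    also have "\<dots> = \<bar>s - s\<bar>" using st iso[of s s] by (auto simp: F_def)
    finally show "s = t" by simp
  qed
  ultimately have fF: "finite F"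
    using finite_verts by (meson finite_imageD finite_imageI finite_subset)
  have nonvertex: "\<gamma> t w < 1" if t: "t \<in> {0..L}" "t \<notin> F" for t w
  proof -
    obtain u v where "on_edge (\<gamma> t) u v" using \<gamma>p t(1) points_iff by blast
    hence "\<gamma> t w \<le> 1" using on_edge_bounds by blast
    moreover have "\<gamma> t w \<noteq> 1" using t by (auto simp: F_def)
    ultimately show ?thesis by simp
  qed
  \<comment> \<open>The corners \<open>x\<close> and \<open>y\<close> belong to the other two sides,
    so the side extends by at least \<open>\<rho>\<close> to both sides of \<open>p\<close>.\<close>
  have ends: "\<rho> \<le> t0" "\<rho> \<le> L - t0"
    using \<rho>(2)[of x] \<rho>(2)[of y] B C iso[of t0 0] iso[of t0 L] t0 g(1-3) by auto
  obtain t1 where t1: "t0 - \<eta> < t1" "t1 < t0 + \<eta>" "t1 \<notin> F"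
    using interval_avoiding_finite[OF fF, of "t0 - \<eta>" "t0 + \<eta>"] \<eta>(1) by auto
  obtain r where r: "R0 < r" "r < R0 + \<eta>" "r \<notin> (\<lambda>t. \<bar>t1 - t\<bar>) ` F"
    using interval_avoiding_finite[of "(\<lambda>t. \<bar>t1 - t\<bar>) ` F" R0 "R0 + \<eta>"] fF \<eta>(1) by auto
  have r0: "0 < r" using r R0 by linarith
  have I: "t1 \<in> {0..L}" "t1 - r \<in> {0..L}" "t1 + r \<in> {0..L}"
    using ends t1 r \<eta> r0 by auto
  have nF: "t1 - r \<notin> F" "t1 + r \<notin> F"
    using r(3) r0 by (auto simp: image_iff)
  define p' where "p' = \<gamma> t1"
  have p'p: "p' \<in> points G" using \<gamma>p I by (simp add: p'_def)
  obtain e1 e2 where e: "on_edge p' e1 e2" using p'p points_iff by blast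
  have "p' e1 < 1" "p' e2 < 1" using nonvertex I t1 by (auto simp: p'_def)
  hence e1: "0 < p' e1" "p' e1 < 1" using e by (auto simp: on_edge_def)
  define T where "T = \<gamma> ` {0..t1 - r} \<union> (C \<union> (B \<union> \<gamma> ` {t1 + r..L}))"
  have cT: "connected (\<gamma> ` {0..t1 - r})" "connected (\<gamma> ` {t1 + r..L})"
    using I r0 by (auto intro!: connected_continuous_image continuous_on_subset[OF cont])
  have xin: "x \<in> \<gamma> ` {0..t1 - r}" "y \<in> \<gamma> ` {t1 + r..L}" using I g(2,3) by force+
  have "connected (B \<union> \<gamma> ` {t1 + r..L})"
    using connected_Un[OF B(1) cT(2)] B xin by blast
  hence "connected (C \<union> (B \<union> \<gamma> ` {t1 + r..L}))"
    using connected_Un[OF C(1)] B C by blast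
  hence T1: "connected T"
    unfolding T_def using connected_Un[OF cT(1)] C xin by blast
  have T2: "T \<subseteq> points G" using B C I r0 \<gamma>p by (auto simp: T_def)
  have T3: "r \<le> gdist G p' t" if "t \<in> T" for t
  proof -
    consider "t \<in> B \<union> C" | s where "t = \<gamma> s" "s \<in> {0..L}" "s \<le> t1 - r \<or> t1 + r \<le> s"
    proof -
      have "\<gamma> ` {0..t1 - r} \<union> \<gamma> ` {t1 + r..L} \<subseteq> \<gamma> ` {s \<in> {0..L}. s \<le> t1 - r \<or> t1 + r \<le> s}"
        using I r0 by auto
      thus ?thesis using that \<open>t \<in> T\<close> unfolding T_def by blast
    qed
    thus ?thesis
    proof cases
      case 1
      hence "\<rho> \<le> gdist G p t" by (rule \<rho>(2))
      also have "\<dots> \<le> gdist G p p' + gdist G p' t"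
        using gdist_triangle[OF pp p'p] T2 that by blast
      also have "gdist G p p' \<le> \<eta>" using iso[OF t0(1) I(1)] t0(2) t1 by (auto simp: p'_def)
      finally show ?thesis using r(2) \<eta>(2) by linarith
    next
      case 2
      thus ?thesis using iso[OF I(1), of s] by (auto simp: p'_def)
    qed
  qed
  have T4: "\<gamma> (t1 - r) \<in> T" "\<gamma> (t1 + r) \<in> T" using I by (auto simp: T_def)
  obtain ws us \<alpha> \<alpha>' where "config r ws us \<alpha> \<alpha>'"
  proof (rule config_exists[OF e e1 \<gamma>p[OF I(2)] _ \<gamma>p[OF I(3)] _ _ _ _ _ T1 T2 T3 T4])
    show "\<gamma> (t1 - r) w < 1" "\<gamma> (t1 + r) w < 1" for w using nonvertex I nF by auto
    show "gdist G p' (\<gamma> (t1 - r)) = r" "gdist G p' (\<gamma> (t1 + r)) = r"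
      using iso[OF I(1,2)] iso[OF I(1,3)] r0 by (auto simp: p'_def)
    show "gdist G (\<gamma> (t1 - r)) (\<gamma> (t1 + r)) = 2 * r" using iso[OF I(2,3)] r0 by simp
    show "1 < 2 * r" using r R0 by linarith
  qed
  thus ?thesis using that r(1) by blast
qed

text \<open>A side that leaves the neighbourhood would give a \<open>config\<close> of radius above
  \<open>R0\<close>. The value \<open>1 / 2\<close> is the radius up to which two points at distance
  \<open>2 * r\<close> may share an edge.\<close>

lemma triangle_sides_in_nbhd:
  assumes tri: "geodesic_triangle G A B C" and R0: "1 / 2 \<le> R0"
    and no: "\<And>r ws us \<alpha> \<alpha>'. config r ws us \<alpha> \<alpha>' \<Longrightarrow> r \<le> R0"
  shows "A \<subseteq> nbhd G R0 (B \<union> C)" "B \<subseteq> nbhd G R0 (C \<union> A)" "C \<subseteq> nbhd G R0 (A \<union> B)"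
proof -
  have *: "A \<subseteq> nbhd G R0 (B \<union> C)"
    if xyz: "x \<in> points G" "y \<in> points G" "z \<in> points G"
      "is_geodesic G x y A" "is_geodesic G y z B" "is_geodesic G z x C" for x y z A B C
  proof
    fix p assume pA: "p \<in> A"
    have "\<exists>q\<in>B \<union> C. gdist G p q \<le> R0"
    proof (rule ccontr)
      assume "\<not> ?thesis"
      hence "\<And>q. q \<in> B \<union> C \<Longrightarrow> R0 < gdist G p q" by force
      then obtain r ws us \<alpha> \<alpha>' where "R0 < r" "config r ws us \<alpha> \<alpha>'"
        using thick_side_config[OF xyz pA _ R0] by metis
      thus False using no by fastforce
    qed
    moreover have "p \<in> points G" using geodesic_connected(4)[OF that(4,1,2)] pA by blast
    ultimately show "p \<in> nbhd G R0 (B \<union> C)" by (simp add: nbhd_def)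
  qed
  obtain x y z where "x \<in> points G" "y \<in> points G" "z \<in> points G"
    "is_geodesic G x y A" "is_geodesic G y z B" "is_geodesic G z x C"
    using tri unfolding geodesic_triangle_def by blast
  thus "A \<subseteq> nbhd G R0 (B \<union> C)" "B \<subseteq> nbhd G R0 (C \<union> A)" "C \<subseteq> nbhd G R0 (A \<union> B)"
    using *[of x y z A B C] *[of y z x B C A] *[of z x y C A B] by blast+
qed

lemma trivial_geodesic:
  assumes "x \<in> points G" shows "is_geodesic G x x {x}"
  unfolding is_geodesic_def using assms by (intro exI[of _ "\<lambda>_. x"]) (auto simp: gdist_refl)

context
  fixes R0 :: real
  assumes R0: "1 / 2 \<le> R0" and no: "\<And>r ws us \<alpha> \<alpha>'. config r ws us \<alpha> \<alpha>' \<Longrightarrow> r \<le> R0"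
begin

lemma triangle_delta_bounded:
  assumes tri: "geodesic_triangle G A B C" shows "triangle_delta G A B C \<le> R0"
  unfolding triangle_delta_def
proof (rule cInf_lower)
  show "R0 \<in> {\<delta>. 0 \<le> \<delta> \<and> A \<subseteq> nbhd G \<delta> (B \<union> C) \<and> B \<subseteq> nbhd G \<delta> (C \<union> A) \<and> C \<subseteq> nbhd G \<delta> (A \<union> B)}"
    using triangle_sides_in_nbhd[OF tri R0 no] R0 by auto
qed (auto intro: bdd_belowI)

lemma hyp_const_le: "hyp_const G \<le> R0"
  unfolding hyp_const_def
proof (rule cSup_least)
  obtain u v where "(u, v) \<in> R" using edges_ne simple unfolding simple_graph_def R_def by blast
  hence "vtx u \<in> points G" using R_verts vtx_points by blast
  hence "geodesic_triangle G {vtx u} {vtx u} {vtx u}"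
    unfolding geodesic_triangle_def using trivial_geodesic by blast
  thus "{triangle_delta G A B C |A B C. geodesic_triangle G A B C} \<noteq> {}" by blast
qed (use triangle_delta_bounded in blast)

text \<open>A bigon, seen as a triangle with the trivial side \<open>{x}\<close>, is enough for
  lower bounds. The upper bound \<open>R0\<close> ensures that the \<open>Inf\<close> is over a
  nonempty set and the \<open>Sup\<close> over a bounded one; otherwise their real values would say
  nothing.\<close>

lemma le_hyp_const:
  assumes x: "x \<in> points G" "y \<in> points G" "is_geodesic G x y A" "is_geodesic G y x B"
    and p: "p \<in> A" "\<And>q. q \<in> B \<Longrightarrow> r \<le> gdist G p q"
  shows "r \<le> hyp_const G"
proof -
  have tri: "geodesic_triangle G A B {x}"
    unfolding geodesic_triangle_def using x trivial_geodesic by blast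
  have "x \<in> B" using geodesic_connected[OF x(4,2,1)] by simp
  have "r \<le> triangle_delta G A B {x}"
    unfolding triangle_delta_def
  proof (rule cInf_greatest)
    show "{\<delta>. 0 \<le> \<delta> \<and> A \<subseteq> nbhd G \<delta> (B \<union> {x}) \<and> B \<subseteq> nbhd G \<delta> ({x} \<union> A) \<and> {x} \<subseteq> nbhd G \<delta> (A \<union> B)} \<noteq> {}"
      using triangle_sides_in_nbhd[OF tri R0 no] R0 by force
    fix \<delta> assume "\<delta> \<in> {\<delta>. 0 \<le> \<delta> \<and> A \<subseteq> nbhd G \<delta> (B \<union> {x}) \<and> B \<subseteq> nbhd G \<delta> ({x} \<union> A) \<and> {x} \<subseteq> nbhd G \<delta> (A \<union> B)}"
    hence "p \<in> nbhd G \<delta> (B \<union> {x})" using p(1) by blast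
    then obtain q where "q \<in> B" "gdist G p q \<le> \<delta>" using \<open>x \<in> B\<close> by (auto simp: nbhd_def)
    thus "r \<le> \<delta>" using p(2) by fastforce
  qed
  also have "\<dots> \<le> hyp_const G"
    unfolding hyp_const_def
  proof (rule cSup_upper)
    show "triangle_delta G A B {x} \<in> {triangle_delta G A B C |A B C. geodesic_triangle G A B C}"
      using tri by blast
  qed (auto intro!: bdd_aboveI[of _ R0] triangle_delta_bounded)
  finally show ?thesis .
qed

end

end

subsection \<open>Cycles and their edge sets\<close>

definition cyc_edges :: "'a list \<Rightarrow> 'a set set" where
  "cyc_edges vs = (\<lambda>i. {vs ! i, vs ! (Suc i mod length vs)}) ` {..<length vs}"

lemma is_cycle_iff:
  "is_cycle G vs \<longleftrightarrow> 3 \<le> length vs \<and> distinct vs \<and> cyc_edges vs \<subseteq> edges G"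
  by (auto simp: is_cycle_def cyc_edges_def)

lemma Suc_mod_if: "i < n \<Longrightarrow> Suc i mod n = (if Suc i = n then 0 else Suc i)"
  by auto

lemma inj_cyc_edges:
  assumes "3 \<le> length vs" "distinct vs"
  shows "inj_on (\<lambda>i. {vs ! i, vs ! (Suc i mod length vs)}) {..<length vs}"
proof
  fix i j assume ij: "i \<in> {..<length vs}" "j \<in> {..<length vs}"
    and eq: "{vs ! i, vs ! (Suc i mod length vs)} = {vs ! j, vs ! (Suc j mod length vs)}"
  let ?n = "length vs"
  have n0: "0 < ?n" using assms(1) by linarith
  have lt: "i < ?n" "j < ?n" "Suc i mod ?n < ?n" "Suc j mod ?n < ?n" using ij mod_less_divisor[OF n0] by auto
  \<comment> \<open>In the reversed match the length of the cycle would divide 2.\<close>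
  have "i = j \<or> (i = Suc j mod ?n \<and> Suc i mod ?n = j)"
    using eq lt assms(2) by (auto simp: doubleton_eq_iff nth_eq_iff_index_eq)
  thus "i = j" using lt assms(1) by (auto simp: Suc_mod_if split: if_splits)
qed

lemma card_cyc_edges:
  assumes "3 \<le> length vs" "distinct vs" shows "card (cyc_edges vs) = length vs"
  unfolding cyc_edges_def using card_image[OF inj_cyc_edges[OF assms]] by simp

lemma finite_cyc_edges: "finite (cyc_edges vs)"
  by (simp add: cyc_edges_def)

lemma cyc_edges_verts: "e \<in> cyc_edges vs \<Longrightarrow> e \<subseteq> set vs"
  by (auto simp: cyc_edges_def intro!: nth_mem mod_less_divisor)

definition star :: "'a set set \<Rightarrow> 'a \<Rightarrow> 'a set set" where
  "star F x = {e \<in> F. x \<in> e}"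

lemma star_cycle:
  assumes "3 \<le> length vs" "distinct vs"
  shows "card (star (cyc_edges vs) x) = (if x \<in> set vs then 2 else 0)"
proof (cases "x \<in> set vs")
  case False
  hence "star (cyc_edges vs) x = {}" using cyc_edges_verts by (fastforce simp: star_def)
  thus ?thesis using False by simp
next
  case True
  let ?n = "length vs" and ?e = "\<lambda>i. {vs ! i, vs ! (Suc i mod length vs)}"
  obtain i where i: "i < ?n" "x = vs ! i" using True by (metis in_set_conv_nth)
  define j where "j = (if i = 0 then ?n - 1 else i - 1)"
  have j: "j < ?n" "Suc j mod ?n = i" "i \<noteq> j" using i assms(1) by (auto simp: j_def)
  have "star (cyc_edges vs) x = ?e ` {i, j}"
  proof
    show "?e ` {i, j} \<subseteq> star (cyc_edges vs) x"
      using i j by (auto simp: star_def cyc_edges_def)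
    show "star (cyc_edges vs) x \<subseteq> ?e ` {i, j}"
    proof
      fix e assume "e \<in> star (cyc_edges vs) x"
      then obtain l where l: "l < ?n" "e = ?e l" "x \<in> ?e l" by (auto simp: star_def cyc_edges_def)
      have m: "Suc l mod ?n < ?n" using l(1) by (intro mod_less_divisor) linarith
      have "l = i \<or> Suc l mod ?n = i"
        using l i m assms(2) nth_eq_iff_index_eq by auto
      moreover have "l = j" if "Suc l mod ?n = i" "l \<noteq> i"
        using that l(1) by (auto simp: j_def Suc_mod_if split: if_splits)
      ultimately show "e \<in> ?e ` {i, j}" using l(2) by blast
    qed
  qed
  moreover have "inj_on ?e {i, j}"
    by (rule inj_on_subset[OF inj_cyc_edges[OF assms]]) (use i j in auto)
  ultimately have "card (star (cyc_edges vs) x) = card {i, j}" using card_image by metis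
  thus ?thesis using j True by simp
qed

lemma cyc_edges_chain:
  assumes "successively (\<lambda>x y. {x, y} \<in> F) vs" "{last vs, hd vs} \<in> F" "vs \<noteq> []"
  shows "cyc_edges vs \<subseteq> F"
proof
  fix e assume "e \<in> cyc_edges vs"
  then obtain i where i: "i < length vs" "e = {vs ! i, vs ! (Suc i mod length vs)}"
    by (auto simp: cyc_edges_def)
  show "e \<in> F"
  proof (cases "Suc i = length vs")
    case True
    hence "e = {last vs, hd vs}" using i assms(3) by (simp add: last_conv_nth hd_conv_nth flip: True)
    thus ?thesis using assms(2) by simp
  next
    case False
    thus ?thesis using i assms(1) by (simp add: successively_conv_nth)
  qed
qed

text \<open>At a common vertex the two edges of \<open>vs'\<close> are the two edges of
  \<open>vs\<close>. So going around \<open>vs\<close> from a vertex of \<open>vs'\<close> never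
  leaves \<open>vs'\<close>, and all of \<open>vs\<close> is covered.\<close>

lemma cyc_edges_subset_length:
  assumes vs: "3 \<le> length vs" "distinct vs" and vs': "3 \<le> length vs'" "distinct vs'"
    and sub: "cyc_edges vs' \<subseteq> cyc_edges vs"
  shows "length vs \<le> length vs'"
proof -
  have next_in: "vs ! (Suc i mod length vs) \<in> set vs'" if i: "i < length vs" "vs ! i \<in> set vs'" for i
  proof -
    let ?x = "vs ! i"
    have "star (cyc_edges vs') ?x \<subseteq> star (cyc_edges vs) ?x" using sub by (auto simp: star_def)
    moreover have "card (star (cyc_edges vs') ?x) = card (star (cyc_edges vs) ?x)"
      using star_cycle[OF vs] star_cycle[OF vs'] i by simp
    moreover have "finite (star (cyc_edges vs) ?x)" by (simp add: star_def finite_cyc_edges)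
    ultimately have "star (cyc_edges vs') ?x = star (cyc_edges vs) ?x" by (metis card_subset_eq)
    moreover have "{vs ! i, vs ! (Suc i mod length vs)} \<in> star (cyc_edges vs) ?x"
      using i(1) unfolding star_def cyc_edges_def by blast
    ultimately have "{vs ! i, vs ! (Suc i mod length vs)} \<in> cyc_edges vs'" unfolding star_def by blast
    thus ?thesis using cyc_edges_verts by fastforce
  qed
  have "cyc_edges vs' \<noteq> {}" using card_cyc_edges[OF vs'] vs'(1) by auto
  then obtain e where "e \<in> cyc_edges vs'" by blast
  hence "e \<subseteq> set vs'" "e \<subseteq> set vs" "e \<noteq> {}"
  proof -
    show "e \<subseteq> set vs'" "e \<subseteq> set vs" using sub cyc_edges_verts \<open>e \<in> cyc_edges vs'\<close> by blast+
    show "e \<noteq> {}" using \<open>e \<in> cyc_edges vs'\<close> by (auto simp: cyc_edges_def)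
  qed
  then obtain i0 where i0: "i0 < length vs" "vs ! i0 \<in> set vs'"
    by (metis all_not_in_conv in_set_conv_nth subsetD)
  have all: "vs ! ((i0 + d) mod length vs) \<in> set vs'" for d
  proof (induction d)
    case 0
    thus ?case using i0 by simp
  next
    case (Suc d)
    have "(i0 + d) mod length vs < length vs" using vs(1) by (intro mod_less_divisor) linarith
    thus ?case using next_in[OF _ Suc.IH] by (simp add: mod_Suc_eq)
  qed
  have "set vs \<subseteq> set vs'"
  proof
    fix x assume "x \<in> set vs"
    then obtain i where "i < length vs" "x = vs ! i" by (metis in_set_conv_nth)
    thus "x \<in> set vs'" using all[of "length vs - i0 + i"] i0 by simp
  qed
  hence "card (set vs) \<le> card (set vs')" by (intro card_mono) auto
  thus ?thesis using distinct_card vs(2) vs'(2) by metis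
qed

text \<open>The first vertex of a longest path in \<open>F\<close> has a second edge in
  \<open>F\<close>, as its degree is not 1. By maximality this edge leads back to the path and
  closes a cycle.\<close>

lemma even_edge_set_cycle:
  assumes F: "F \<subseteq> edges G" "F \<noteq> {}" and G: "simple_graph G" and ev: "\<And>x. card (star F x) \<noteq> 1"
  obtains vs where "is_cycle G vs" "cyc_edges vs \<subseteq> F"
proof -
  let ?adj = "\<lambda>x y. {x, y} \<in> F"
  let ?P = "\<lambda>xs. distinct xs \<and> 2 \<le> length xs \<and> successively ?adj xs"
  have Fv: "\<And>x y. {x, y} \<in> F \<Longrightarrow> x \<in> verts G \<and> y \<in> verts G \<and> x \<noteq> y"
    using F(1) G unfolding simple_graph_def by (fastforce simp: doubleton_eq_iff)
  have form: "\<And>e. e \<in> F \<Longrightarrow> \<exists>x y. e = {x, y}"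
    using F(1) G unfolding simple_graph_def by blast
  obtain a b where ab: "{a, b} \<in> F" using F(2) form by blast
  hence "?P [a, b]" using Fv by auto
  moreover have "\<forall>xs. ?P xs \<longrightarrow> length xs \<le> card (verts G)"
  proof (intro allI impI)
    fix xs assume P: "?P xs"
    have "set xs \<subseteq> verts G"
    proof
      fix x assume "x \<in> set xs"
      then obtain i where i: "i < length xs" "x = xs ! i" by (metis in_set_conv_nth)
      show "x \<in> verts G"
      proof (cases i)
        case 0
        thus ?thesis using P i Fv[of "xs ! 0" "xs ! Suc 0"] by (auto simp: successively_conv_nth)
      next
        case (Suc j)
        thus ?thesis using P i Fv[of "xs ! j" "xs ! Suc j"] by (auto simp: successively_conv_nth)
      qed
    qed
    hence "card (set xs) \<le> card (verts G)" using G by (intro card_mono) (auto simp: simple_graph_def)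
    thus "length xs \<le> card (verts G)" using P distinct_card by metis
  qed
  ultimately obtain xs where xs: "?P xs" "\<forall>ys. ?P ys \<longrightarrow> length ys \<le> length xs"
    using ex_has_greatest_nat[of ?P "[a, b]" length "Suc (card (verts G))"] by (metis less_Suc_eq_le)
  let ?x = "xs ! 0"
  have ne: "xs \<noteq> []" using xs by auto
  have e: "{?x, xs ! 1} \<in> star F ?x" using xs(1) by (auto simp: star_def successively_conv_nth)
  have "star F ?x \<noteq> {{?x, xs ! 1}}" using ev[of ?x] by auto
  then obtain e' where e': "e' \<in> star F ?x" "e' \<noteq> {?x, xs ! 1}" using e by blast
  obtain y where y: "e' = {?x, y}" using e'(1) form unfolding star_def by blast
  hence yF: "{?x, y} \<in> F" "y \<noteq> xs ! 1" using e' by (auto simp: star_def)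
  have "y \<in> set xs"
  proof (rule ccontr)
    assume "y \<notin> set xs"
    hence "?P (y # xs)" using xs(1) yF ne
      by (auto simp: successively_Cons hd_conv_nth insert_commute)
    hence "length (y # xs) \<le> length xs" using xs(2) by blast
    thus False by simp
  qed
  then obtain j where j: "j < length xs" "y = xs ! j" by (metis in_set_conv_nth)
  have "j \<noteq> 0" using Fv[OF yF(1)] j by metis
  moreover have "j \<noteq> 1" using yF(2) j by metis
  ultimately have j2: "2 \<le> j" by simp
  let ?vs = "take (Suc j) xs"
  have "successively ?adj ?vs" using xs(1) j by (auto simp: successively_conv_nth)
  moreover have "last ?vs = y" using j ne by (simp add: take_Suc_conv_app_nth)
  moreover have "hd ?vs = ?x" using ne by (simp add: hd_conv_nth)
  ultimately have "cyc_edges ?vs \<subseteq> F"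
    using yF(1) ne by (intro cyc_edges_chain) (auto simp: insert_commute)
  moreover have "is_cycle G ?vs" unfolding is_cycle_iff using calculation xs(1) F(1) j j2 by auto
  ultimately show ?thesis using that by blast
qed

lemma girth_le: "\<lbrakk>girth G = enat g; is_cycle G vs\<rbrakk> \<Longrightarrow> g \<le> length vs"
  unfolding girth_def by (metis INF_lower enat_ord_simps(1) mem_Collect_eq)

lemma girth_cycle:
  assumes "girth G = enat g" obtains vs where "is_cycle G vs" "length vs = g"
proof -
  let ?A = "(\<lambda>vs. enat (length vs)) ` {vs. is_cycle G vs}"
  have "Inf ?A = enat g" using assms by (simp add: girth_def)
  hence ne: "?A \<noteq> {}" and "(LEAST x. x \<in> ?A) = enat g"
    by (auto simp: Inf_enat_def split: if_splits)
  moreover have "(LEAST x. x \<in> ?A) \<in> ?A" using ne by (metis LeastI ex_in_conv)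
  ultimately show ?thesis using that by auto
qed

lemma le_circumference: "\<lbrakk>circumference G = enat c; is_cycle G vs\<rbrakk> \<Longrightarrow> length vs \<le> c"
  unfolding circumference_def by (metis SUP_upper enat_ord_simps(1) mem_Collect_eq)

text \<open>In \<open>enat\<close> the supremum of the empty set is 0 and that of an infinite set is
  infinity, so a finite nonzero value is a maximum.\<close>

lemma circumference_cycle:
  assumes "circumference G = enat c" "c \<noteq> 0" obtains vs where "is_cycle G vs" "length vs = c"
proof -
  let ?A = "(\<lambda>vs. enat (length vs)) ` {vs. is_cycle G vs}"
  have "Sup ?A = enat c" using assms by (simp add: circumference_def)
  hence ne: "?A \<noteq> {}" "finite ?A" and "Max ?A = enat c"
    using assms(2) by (auto simp: Sup_enat_def zero_enat_def split: if_splits)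
  hence "enat c \<in> ?A" using Max_in by metis
  thus ?thesis using that by auto
qed

lemma star_parity:
  assumes "finite F" "finite F'" "even (card (star F x))" "even (card (star F' x))"
  shows "card (star (F - F' \<union> (F' - F)) x) \<noteq> 1"
proof -
  let ?A = "star F x" and ?B = "star F' x"
  have fin: "finite ?A" "finite ?B" using assms by (auto simp: star_def)
  have "card (star (F - F' \<union> (F' - F)) x) = card (?A - ?B) + card (?B - ?A)"
    using fin by (subst card_Un_disjoint[symmetric]) (auto simp: star_def intro!: arg_cong[of _ _ card])
  moreover have "card ?A = card (?A - ?B) + card (?A \<inter> ?B)" "card ?B = card (?B - ?A) + card (?A \<inter> ?B)"
    using fin by (subst card_Un_disjoint[symmetric]; auto intro!: arg_cong[of _ _ card])+
  ultimately show ?thesis using assms(3,4) by presburger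
qed

text \<open>The symmetric difference of two cycles has even degrees, so it contains a cycle.\<close>

lemma girth_le_sym_diff:
  assumes G: "simple_graph G" "girth G = enat g"
    and vs: "is_cycle G vs" "is_cycle G vs'" "cyc_edges vs \<noteq> cyc_edges vs'"
  shows "g \<le> card (cyc_edges vs - cyc_edges vs') + card (cyc_edges vs' - cyc_edges vs)"
proof -
  let ?C = "cyc_edges vs" and ?D = "cyc_edges vs'"
  let ?F = "?C - ?D \<union> (?D - ?C)"
  have v: "3 \<le> length vs" "distinct vs" "3 \<le> length vs'" "distinct vs'" "?C \<subseteq> edges G" "?D \<subseteq> edges G"
    using vs by (auto simp: is_cycle_iff)
  have "card (star ?F x) \<noteq> 1" for x
    by (rule star_parity) (auto simp: finite_cyc_edges star_cycle v)
  moreover have "?F \<subseteq> edges G" "?F \<noteq> {}" using v vs(3) by auto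
  ultimately obtain us where us: "is_cycle G us" "cyc_edges us \<subseteq> ?F"
    using even_edge_set_cycle G(1) by metis
  have "g \<le> length us" using girth_le G(2) us(1) by blast
  also have "\<dots> = card (cyc_edges us)" using us(1) card_cyc_edges by (metis is_cycle_iff)
  also have "\<dots> \<le> card ?F" using us(2) by (intro card_mono) (auto simp: finite_cyc_edges)
  also have "\<dots> = card (?C - ?D) + card (?D - ?C)"
    by (rule card_Un_disjoint) (auto simp: finite_cyc_edges)
  finally show ?thesis .
qed

text \<open>The second path is stated together with its two ends on the first, so that
  \<open>bs = []\<close>, a single closing edge, is included.\<close>

lemma append_is_cycle:
  assumes "as \<noteq> []" "distinct as" "distinct bs" "set as \<inter> set bs = {}" "3 \<le> length as + length bs"
    and "successively (\<lambda>x y. {x, y} \<in> edges G) as"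
    and "successively (\<lambda>x y. {x, y} \<in> edges G) (last as # bs @ [hd as])"
  shows "is_cycle G (as @ bs)"
proof -
  let ?adj = "\<lambda>x y. {x, y} \<in> edges G"
  have "successively ?adj (as @ bs)" "{last (as @ bs), hd (as @ bs)} \<in> edges G"
    using assms(1,6,7) by (cases "bs = []"; auto simp: successively_append_iff successively_Cons)+
  thus ?thesis
    unfolding is_cycle_iff using assms by (auto dest: cyc_edges_chain)
qed

text \<open>
  An arc of the cycle \<open>vs\<close> from \<open>a\<close> to \<open>b\<close>, together with a path through \<open>is\<close> that is
  otherwise disjoint from the cycle.
\<close>

lemma ear_cycles:
  assumes vs: "is_cycle G vs" and g: "girth G = enat g" and ab: "a < b" "b < length vs"
    and "is": "distinct is" "set is \<inter> set vs = {}" "successively (\<lambda>x y. {x, y} \<in> edges G) (vs ! b # is @ [vs ! a])"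
    and new: "is = [] \<Longrightarrow> {vs ! b, vs ! a} \<notin> cyc_edges vs"
  shows "g \<le> b - a + Suc (length is)" "g \<le> length vs - (b - a) + Suc (length is)"
proof -
  let ?n = "length vs" and ?adj = "\<lambda>x y. {x, y} \<in> edges G"
  have v: "3 \<le> ?n" "distinct vs" "cyc_edges vs \<subseteq> edges G" using vs by (auto simp: is_cycle_iff)
  have nxt: "{vs ! i, vs ! Suc i} \<in> cyc_edges vs" if "Suc i < ?n" for i
    unfolding cyc_edges_def using that by (intro image_eqI[of _ _ i]) auto
  have chain: "successively ?adj vs" using nxt v(3) by (auto simp: successively_conv_nth)
  have cls: "{vs ! (?n - 1), vs ! 0} \<in> cyc_edges vs"
  proof -
    have "Suc (?n - 1) = ?n" "?n - 1 < ?n" using v(1) by auto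
    hence "Suc (?n - 1) mod ?n = 0" "?n - 1 < ?n" by simp_all
    thus ?thesis unfolding cyc_edges_def by (metis (no_types, lifting) image_eqI lessThan_iff)
  qed
  have cls': "{last vs, hd vs} \<in> edges G"
    using cls v by (metis last_conv_nth hd_conv_nth list.size(3) not_numeral_le_zero subsetD)
  let ?arc = "drop a (take (Suc b) vs)"
  have arc: "?arc \<noteq> []" "length ?arc = Suc b - a" "hd ?arc = vs ! a" "last ?arc = vs ! b"
    "distinct ?arc" "set ?arc \<subseteq> set vs" "successively ?adj ?arc"
  proof -
    show "?arc \<noteq> []" "length ?arc = Suc b - a" "hd ?arc = vs ! a" "last ?arc = vs ! b"
      using ab by (auto simp: hd_drop_conv_nth take_Suc_conv_app_nth nth_append)
    show "distinct ?arc" using v(2) by (intro distinct_drop distinct_take)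
    show "set ?arc \<subseteq> set vs" by (auto dest: in_set_dropD in_set_takeD)
    show "successively ?adj ?arc" using ab chain by (auto simp: successively_conv_nth)
  qed
  have sub: "successively ?adj (is @ [vs ! a])" "successively ?adj is"
    using "is"(3) by (auto simp: successively_Cons successively_append_iff)
  \<comment> \<open>An ear without inner vertices is a single edge outside the cycle; its ends are
    not consecutive, and so the arc has at least three vertices.\<close>
  have "is = [] \<Longrightarrow> b \<noteq> Suc a"
  proof
    assume "is = []" "b = Suc a"
    thus False using new nxt[of a] ab by (simp add: insert_commute)
  qed
  hence "3 \<le> length ?arc + length is" using ab arc(2) by (cases "is") auto
  hence "is_cycle G (?arc @ is)"
    using arc "is" by (intro append_is_cycle) auto
  from girth_le[OF g this] show "g \<le> b - a + Suc (length is)" using arc(2) ab by simp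
  \<comment> \<open>The complementary arc runs from \<open>b\<close> across the closing edge of the
    list to \<open>a\<close>, so the ear is traversed backwards.\<close>
  let ?arc2 = "drop b vs @ take (Suc a) vs"
  have tk: "last (take (Suc a) vs) = vs ! a" "hd (take (Suc a) vs) = hd vs" "last (drop b vs) = last vs"
    "hd (drop b vs) = vs ! b" "take (Suc a) vs \<noteq> []" "drop b vs \<noteq> []"
  proof -
    have "vs \<noteq> []" using ab by auto
    thus "last (take (Suc a) vs) = vs ! a" "hd (take (Suc a) vs) = hd vs" "last (drop b vs) = last vs"
      "hd (drop b vs) = vs ! b" "take (Suc a) vs \<noteq> []" "drop b vs \<noteq> []"
      using ab by (auto simp: take_Suc_conv_app_nth hd_drop_conv_nth hd_append hd_conv_nth)
  qed
  have arc2: "?arc2 \<noteq> []" "length ?arc2 = ?n - b + Suc a" "hd ?arc2 = vs ! b" "last ?arc2 = vs ! a"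
    using tk ab by auto
  have "distinct ?arc2"
    using v(2) ab set_take_disj_set_drop_if_distinct[OF v(2), of "Suc a" b] by auto
  moreover have "set ?arc2 \<subseteq> set vs" by (auto dest: in_set_dropD in_set_takeD)
  moreover have "successively ?adj ?arc2"
  proof -
    have "successively ?adj (drop b vs)" "successively ?adj (take (Suc a) vs)"
      using chain by (auto simp: successively_conv_nth)
    thus ?thesis using cls' tk by (simp add: successively_append_iff)
  qed
  ultimately have arc2': "distinct ?arc2" "set ?arc2 \<subseteq> set vs" "successively ?adj ?arc2" by auto
  have revis: "successively ?adj (vs ! a # rev is @ [vs ! b])"
  proof -
    have "successively ?adj (rev (vs ! b # is @ [vs ! a]))"
      unfolding successively_rev using "is"(3) by (simp add: insert_commute)
    thus ?thesis by simp
  qed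
  have "is = [] \<Longrightarrow> \<not> (a = 0 \<and> b = ?n - 1)"
  proof
    assume "is = []" "a = 0 \<and> b = ?n - 1"
    thus False using new cls by simp
  qed
  hence "3 \<le> length ?arc2 + length (rev is)" using ab arc2(2) by (cases "is") auto
  hence "is_cycle G (?arc2 @ rev is)"
    using arc2 arc2' "is"(1,2) revis by (intro append_is_cycle) auto
  from girth_le[OF g this] show "g \<le> ?n - (b - a) + Suc (length is)" using arc2(2) ab by simp
qed

context cgraph
begin

text \<open>A maximal run of edges of the cycle \<open>vs'\<close> outside the cycle \<open>vs\<close> is a short ear of \<open>vs\<close>.\<close>

lemma ear_exists:
  assumes vs: "is_cycle G vs" and vs': "is_cycle G vs'" and g: "girth G = enat g"
    and new: "\<not> cyc_edges vs' \<subseteq> cyc_edges vs" and k: "card (cyc_edges vs' - cyc_edges vs) \<le> k" "k < g"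
  obtains a b l where "a < b" "b < length vs" "l \<le> k" "(vs ! a, vs ! b) \<in> R ^^ l"
    "g \<le> b - a + l" "g \<le> length vs - (b - a) + l"
proof -
  let ?C = "cyc_edges vs" and ?n = "length vs'"
  have v': "3 \<le> ?n" "distinct vs'" "cyc_edges vs' \<subseteq> edges G" using vs' by (auto simp: is_cycle_iff)
  \<comment> \<open>Edges are indexed by all natural numbers with period \<open>?n\<close>, so that
    a run may cross the end of the list.\<close>
  define E where "E t = {vs' ! (t mod ?n), vs' ! (Suc t mod ?n)}" for t
  have Emod: "E (t mod ?n) = E t" for t by (simp add: E_def mod_Suc_eq)
  have Eadd: "E (t + ?n) = E t" "E (t + i * ?n) = E t" for t i
    using Emod[of "t + ?n"] Emod[of "t + i * ?n"] Emod[of t] by simp_all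
  have E_image: "cyc_edges vs' = E ` {..<?n}" by (auto simp: cyc_edges_def E_def)
  have n0: "0 < ?n" using v'(1) by linarith
  \<comment> \<open>The cycle \<open>vs'\<close> has at least \<open>g > k\<close> edges, hence
    shares one with \<open>vs\<close>; the search for a run starts there.\<close>
  have "\<not> cyc_edges vs' \<subseteq> cyc_edges vs' - ?C"
  proof
    assume "cyc_edges vs' \<subseteq> cyc_edges vs' - ?C"
    hence "cyc_edges vs' - ?C = cyc_edges vs'" by blast
    hence "?n \<le> k" using k(1) card_cyc_edges[OF v'(1,2)] by simp
    thus False using girth_le[OF g vs'] k(2) by linarith
  qed
  then obtain e where "e \<in> cyc_edges vs'" "e \<in> ?C" by blast
  then obtain t1 where t1: "E t1 \<in> ?C" unfolding E_image by blast
  obtain e0 where "e0 \<in> cyc_edges vs'" "e0 \<notin> ?C" using new by blast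
  then obtain t0 where "E t0 \<notin> ?C" unfolding E_image by blast
  hence "E (t0 + (t1 + 1) * ?n) \<notin> ?C" using Eadd by metis
  moreover have "t1 < t0 + (t1 + 1) * ?n"
  proof -
    have "t1 + 1 \<le> (t1 + 1) * ?n" using n0 by (metis Suc_leI mult.right_neutral mult_le_mono2 One_nat_def)
    thus ?thesis by linarith
  qed
  ultimately have ex: "\<exists>t. t1 < t \<and> E t \<notin> ?C" by blast
  \<comment> \<open>The first new edge after a shared one, so the edge before it lies on
    \<open>vs\<close>.\<close>
  define t where "t = (LEAST t. t1 < t \<and> E t \<notin> ?C)"
  have t: "t1 < t" "E t \<notin> ?C" using LeastI_ex[OF ex] by (auto simp: t_def)
  have tp: "E (t - 1) \<in> ?C"
  proof (cases "t - 1 = t1")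
    case False
    hence "t1 < t - 1" "t - 1 < t" using t(1) by auto
    thus ?thesis using not_less_Least[of "t - 1" "\<lambda>t. t1 < t \<and> E t \<notin> ?C"] by (auto simp: t_def)
  qed (use t1 in simp)
  define f where "f s = vs' ! ((t + s) mod ?n)" for s
  have E_f: "E (t + s) = {f s, f (Suc s)}" for s by (simp add: E_def f_def)
  have E_inj: "inj_on E {..<?n}"
    using inj_cyc_edges[OF v'(1,2)] by (simp add: inj_on_def E_def)
  have mod_inj: "inj_on (\<lambda>s. (t + s) mod ?n) {..<?n}"
  proof
    fix x y assume "x \<in> {..<?n}" "y \<in> {..<?n}" "(t + x) mod ?n = (t + y) mod ?n"
    moreover have "y \<le> x" if y: "y < ?n" "(t + x) mod ?n = (t + y) mod ?n" for x y
    proof (rule ccontr)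
      assume "\<not> y \<le> x"
      hence "?n dvd (t + y) - (t + x)" "0 < y - x"
        using y(2) mod_eq_dvd_iff_nat[of "t + x" "t + y" ?n] by auto
      hence "?n \<le> y - x" by (auto intro: dvd_imp_le)
      thus False using y(1) by linarith
    qed
    ultimately show "x = y" by (simp add: order_antisym)
  qed
  have f_inj: "inj_on f {..<?n}"
  proof
    fix x y assume xy: "x \<in> {..<?n}" "y \<in> {..<?n}" "f x = f y"
    hence "(t + x) mod ?n = (t + y) mod ?n"
      using v'(2) n0 by (simp add: f_def nth_eq_iff_index_eq)
    thus "x = y" using mod_inj xy unfolding inj_on_def by blast
  qed
  have Ef_inj: "inj_on (\<lambda>s. E (t + s)) {..<?n}"
  proof
    fix x y assume xy: "x \<in> {..<?n}" "y \<in> {..<?n}" "E (t + x) = E (t + y)"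
    hence "E ((t + x) mod ?n) = E ((t + y) mod ?n)" using Emod by simp
    hence "(t + x) mod ?n = (t + y) mod ?n"
      using E_inj n0 unfolding inj_on_def by (simp add: inj_on_def)
    thus "x = y" using mod_inj xy unfolding inj_on_def by blast
  qed
  have f_R: "(f s, f (Suc s)) \<in> R" for s
  proof -
    have "E ((t + s) mod ?n) \<in> cyc_edges vs'" using E_image n0 by auto
    thus ?thesis using v'(3) Emod E_f R_iff by (metis subsetD)
  qed
  have last_edge: "{f (?n - 1), f 0} \<in> ?C"
  proof -
    have "t + (?n - 1) = t - 1 + ?n" using n0 t(1) by linarith
    hence "E (t + (?n - 1)) \<in> ?C" using tp Eadd(1) by simp
    moreover have "f (Suc (?n - 1)) = f 0" using n0 by (simp add: f_def)
    ultimately show ?thesis using E_f by metis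
  qed
  hence ends: "f 0 \<in> set vs" "f (?n - 1) \<in> set vs" using cyc_edges_verts by fastforce+
  \<comment> \<open>The first return to \<open>vs\<close>. The edge before \<open>t\<close> starts
    at a vertex of \<open>vs\<close>, so the return happens by step \<open>?n - 1\<close>, before
    \<open>vs'\<close> closes up, and the ear has two distinct ends.\<close>
  define j where "j = (LEAST j. 1 \<le> j \<and> f j \<in> set vs)"
  have j: "1 \<le> j" "f j \<in> set vs" "j \<le> ?n - 1" and jmin: "\<And>s. 1 \<le> s \<Longrightarrow> s < j \<Longrightarrow> f s \<notin> set vs"
  proof -
    have 1: "1 \<le> ?n - 1 \<and> f (?n - 1) \<in> set vs" using ends v'(1) by simp
    show "1 \<le> j" "f j \<in> set vs"
      using LeastI[of "\<lambda>j. 1 \<le> j \<and> f j \<in> set vs", OF 1] by (auto simp: j_def)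
    show "j \<le> ?n - 1"
      using Least_le[of "\<lambda>j. 1 \<le> j \<and> f j \<in> set vs", OF 1] by (simp add: j_def)
    show "\<And>s. 1 \<le> s \<Longrightarrow> s < j \<Longrightarrow> f s \<notin> set vs"
      unfolding j_def using not_less_Least by blast
  qed
  have jn: "j < ?n" using j(3) n0 by linarith
  have newE: "E (t + s) \<in> cyc_edges vs' - ?C" if "s < j" for s
  proof
    show "E (t + s) \<in> cyc_edges vs'" using E_image n0 Emod by (metis imageI lessThan_iff mod_less_divisor)
    show "E (t + s) \<notin> ?C"
    proof (cases s)
      case 0
      thus ?thesis using t(2) by simp
    next
      case (Suc s')
      hence "f s \<notin> set vs" using jmin that by simp
      thus ?thesis using E_f cyc_edges_verts by (metis insertI1 subsetD)
    qed
  qed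
  have "j = card ((\<lambda>s. E (t + s)) ` {..<j})"
    using card_image[OF inj_on_subset[OF Ef_inj]] jn by simp
  also have "\<dots> \<le> card (cyc_edges vs' - ?C)"
    using newE by (intro card_mono) (auto simp: finite_cyc_edges)
  finally have jk: "j \<le> k" using k(1) by linarith
  have path: "(f s, f (s + d)) \<in> R ^^ d" for s d
  proof (induction d)
    case (Suc d)
    thus ?case using f_R[of "s + d"] by auto
  qed simp
  obtain x y where xy: "x < length vs" "f 0 = vs ! x" "y < length vs" "f j = vs ! y"
    using ends(1) j(2) by (metis in_set_conv_nth)
  have "f 0 \<noteq> f j" using f_inj jn j(1) n0 by (auto simp: inj_on_def)
  hence "x \<noteq> y" using xy by metis
  define ms where "ms = map f [1..<j]"
  have ms: "distinct ms" "set ms \<inter> set vs = {}" "length ms = j - 1"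
  proof -
    have "inj_on f {1..<j}" by (rule inj_on_subset[OF f_inj]) (use jn in auto)
    thus "distinct ms" by (simp add: ms_def distinct_map)
    show "set ms \<inter> set vs = {}" "length ms = j - 1" using jmin by (auto simp: ms_def)
  qed
  have full: "f 0 # ms @ [f j] = map f [0..<Suc j]"
    using j(1) by (simp add: ms_def upt_rec[of 0])
  have ch: "successively (\<lambda>x y. {x, y} \<in> edges G) (f 0 # ms @ [f j])"
    unfolding full successively_conv_nth using f_R by (simp add: R_iff del: upt_Suc)
  have ms0: "ms = [] \<Longrightarrow> {f 0, f j} \<notin> ?C"
  proof -
    assume "ms = []"
    hence "j = 1" using ms(3) j(1) by simp
    thus "{f 0, f j} \<notin> ?C" using newE[of 0] E_f[of 0] by simp
  qed
  show ?thesis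
  proof (cases "y < x")
    case True
    have "g \<le> x - y + Suc (length ms)" "g \<le> length vs - (x - y) + Suc (length ms)"
      using ear_cycles[OF vs g True xy(1) ms(1,2)] ch ms0 xy by auto
    moreover have "(vs ! y, vs ! x) \<in> R ^^ j" using path[of 0 j] xy relpow_R_sym by simp
    ultimately show ?thesis using that[OF True xy(1) jk] ms(3) j(1) by simp
  next
    case False
    hence lt: "x < y" using \<open>x \<noteq> y\<close> by simp
    have "successively (\<lambda>x y. {x, y} \<in> edges G) (rev (f 0 # ms @ [f j]))"
      unfolding successively_rev using ch by (simp add: insert_commute)
    hence ch': "successively (\<lambda>x y. {x, y} \<in> edges G) (vs ! y # rev ms @ [vs ! x])" using xy by simp
    have "g \<le> y - x + Suc (length (rev ms))" "g \<le> length vs - (y - x) + Suc (length (rev ms))"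
      using ear_cycles[OF vs g lt xy(3) _ _ ch'] ms(1,2) ms0 xy by (auto simp: insert_commute)
    moreover have "(vs ! x, vs ! y) \<in> R ^^ j" using path[of 0 j] xy by simp
    ultimately show ?thesis using that[OF lt xy(3) jk] ms(3) j(1) by simp
  qed
qed

end

subsection \<open>Upper bounds\<close>

text \<open>Only \<open>k\<close> edges lie outside the cycle \<open>ws\<close> of length
  \<open>c\<close>. As the symmetric difference has at least \<open>g\<close> edges,
  \<open>vs\<close> misses at least \<open>g - k\<close> edges of \<open>ws\<close>; so it has at
  most \<open>c - g + k\<close> edges on \<open>ws\<close> and at most \<open>k\<close>
  others.\<close>

lemma girth_circumference_bounds:
  assumes G: "simple_graph G" "girth G = enat g" "circumference G = enat c"
    and gc: "3 \<le> g" "g < c" and m: "card (edges G) = c + k" "finite (edges G)"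
    and vs: "is_cycle G vs" "cyc_edges vs \<noteq> cyc_edges ws" "is_cycle G ws" "length ws = c"
  shows "length vs + g \<le> c + 2 * k" "card (cyc_edges vs - cyc_edges ws) \<le> k"
proof -
  let ?C = "cyc_edges vs" and ?D = "cyc_edges ws"
  have v: "3 \<le> length vs" "distinct vs" "3 \<le> length ws" "distinct ws" "?C \<subseteq> edges G" "?D \<subseteq> edges G"
    using vs by (auto simp: is_cycle_iff)
  have cards: "card ?C = length vs" "card ?D = c" using card_cyc_edges v vs(4) by auto
  have "card (?C - ?D) \<le> card (edges G - ?D)" using v m by (intro card_mono) auto
  also have "\<dots> = k" using card_Diff_subset[OF finite_cyc_edges v(6)] cards m by simp
  finally show 1: "card (?C - ?D) \<le> k" .
  have "g \<le> card (?C - ?D) + card (?D - ?C)" using girth_le_sym_diff[OF G(1,2) vs(1,3,2)] .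
  moreover have "card (?C - ?D) + card (?C \<inter> ?D) = length vs" "card (?D - ?C) + card (?C \<inter> ?D) = c"
    using cards card_Diff_subset_Int[of ?C ?D] card_Diff_subset_Int[of ?D ?C] finite_cyc_edges[of vs] finite_cyc_edges[of ws]
      card_mono[of ?C "?C \<inter> ?D"] card_mono[of ?D "?C \<inter> ?D"]
    by (auto simp: Int_commute)
  ultimately show "length vs + g \<le> c + 2 * k" using 1 by linarith
qed

lemma not_subset_longer_cycle:
  assumes "is_cycle G vs" "is_cycle G ws" "length vs < length ws"
  shows "\<not> cyc_edges vs \<subseteq> cyc_edges ws"
  using cyc_edges_subset_length[of ws vs] assms unfolding is_cycle_iff by auto

text \<open>A shortest cycle is compared with a longest one. The results are what the extremal theta
  graph needs: \<open>2 * (g - k) \<le> c\<close>, and at least one edge for the chord.\<close>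

lemma admissible_bounds:
  assumes G: "simple_graph G" "girth G = enat g" "circumference G = enat c"
    and gc: "3 \<le> g" "g < c" and m: "card (edges G) = c + k" "finite (edges G)"
  shows "2 * g \<le> c + 2 * k" "1 \<le> k"
proof -
  obtain vs where vs: "is_cycle G vs" "length vs = g" using girth_cycle G(2) by blast
  obtain ws where ws: "is_cycle G ws" "length ws = c" using circumference_cycle G(3) gc by (metis not_less0)
  have ns: "\<not> cyc_edges vs \<subseteq> cyc_edges ws" using not_subset_longer_cycle vs ws gc by metis
  hence ne: "cyc_edges vs \<noteq> cyc_edges ws" by blast
  note b = girth_circumference_bounds[OF G gc m vs(1) ne ws]
  show "2 * g \<le> c + 2 * k" using b(1) vs by simp
  have "card (cyc_edges vs - cyc_edges ws) \<noteq> 0" using ns finite_cyc_edges[of vs] by auto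
  thus "1 \<le> k" using b(2) by linarith
qed

context cgraph
begin

lemma chain_edges: "chain xs \<Longrightarrow> successively (\<lambda>x y. {x, y} \<in> edges G) xs"
  by (simp add: R_iff)

lemma config_length:
  assumes "config r ws us \<alpha> \<alpha>'" shows "4 * r \<le> real (length (ws @ us))"
proof -
  have c: "us \<noteq> []" "chain (ws @ us)" "\<alpha> + (real (length ws) - 1) + \<alpha>' = 2 * r"
    and d: "\<And>l. (hd us, last us) \<in> R ^^ l \<Longrightarrow> 2 * r \<le> 1 - \<alpha>' + real l + (1 - \<alpha>)"
    using assms by (auto simp: config_def)
  have "chain us" using c(2) by (simp add: successively_append_iff)
  hence "(us ! 0, us ! (length us - 1)) \<in> R ^^ (length us - 1 - 0)"
    using chain_relpow[of us 0 "length us - 1"] c(1) by simp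
  hence "(hd us, last us) \<in> R ^^ (length us - 1)" using c(1) by (simp add: hd_conv_nth last_conv_nth)
  from d[OF this] have "2 * r \<le> 1 - \<alpha>' + (real (length us) - 1) + (1 - \<alpha>)"
    using c(1) by (cases us) auto
  thus ?thesis using c(3) by simp
qed

text \<open>\<open>config\<close> alone admits two vertices joined by a single edge; a length of at
  least \<open>4 * r > 3\<close> excludes this. Radii up to \<open>3 / 4\<close> lie below both
  upper bounds anyway.\<close>

lemma config_cycle:
  assumes "config r ws us \<alpha> \<alpha>'" "3 / 4 < r" shows "is_cycle G (ws @ us)"
proof -
  have c: "ws \<noteq> []" "us \<noteq> []" "distinct (ws @ us)" "chain (ws @ us)" "(last us, hd ws) \<in> R"
    using assms(1) by (auto simp: config_def)
  have "3 \<le> length (ws @ us)" using config_length[OF assms(1)] assms(2) by linarith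
  moreover have "cyc_edges (ws @ us) \<subseteq> edges G"
    using chain_edges[OF c(4)] c by (intro cyc_edges_chain) (auto simp: R_iff)
  ultimately show ?thesis using c(3) by (simp add: is_cycle_iff)
qed

lemma config_le_circumference:
  assumes "config r ws us \<alpha> \<alpha>'" "circumference G = enat c" "3 \<le> c" shows "r \<le> real c / 4"
proof (cases "3 / 4 < r")
  case True
  have "length (ws @ us) \<le> c" using le_circumference assms(2) config_cycle[OF assms(1) True] by blast
  thus ?thesis using config_length[OF assms(1)] by linarith
next
  case False
  thus ?thesis using assms(3) by simp
qed

text \<open>
  An ear of the cycle \<open>ws @ us\<close> cannot start and end in \<open>ws\<close>, as \<open>ws\<close> is a geodesic. If it meets
  \<open>us\<close>, it opens a detour between the two points at distance \<open>r\<close> from the centre.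
\<close>

lemma config_ear:
  assumes conf: "config r ws us \<alpha> \<alpha>'"
    and ear: "i < j" "j < length (ws @ us)" "((ws @ us) ! i, (ws @ us) ! j) \<in> R ^^ l"
    and g: "g \<le> j - i + l" "g \<le> length (ws @ us) - (j - i) + l" "2 * l < g"
  shows "4 * r + real g \<le> real (length (ws @ us)) + 4 * real l"
proof -
  let ?n = "length ws" and ?q = "length us"
  have c: "ws \<noteq> []" "us \<noteq> []" "chain (ws @ us)"
    and \<alpha>: "0 < \<alpha>" "\<alpha> < 1" "0 < \<alpha>'" "\<alpha>' < 1" and len: "\<alpha> + (real ?n - 1) + \<alpha>' = 2 * r"
    and d1: "\<And>l. (hd us, last us) \<in> R ^^ l \<Longrightarrow> 2 * r \<le> 1 - \<alpha>' + real l + (1 - \<alpha>)"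
    and d2: "\<And>l. (last ws, last us) \<in> R ^^ l \<Longrightarrow> 2 * r \<le> \<alpha>' + real l + (1 - \<alpha>)"
    and d3: "\<And>l. (hd us, hd ws) \<in> R ^^ l \<Longrightarrow> 2 * r \<le> 1 - \<alpha>' + real l + \<alpha>"
    and d4: "\<And>l. (hd ws, last ws) \<in> R ^^ l \<Longrightarrow> 2 * r \<le> \<alpha> + real l + \<alpha>'"
    and d5: "\<And>i u l. i < ?n \<Longrightarrow> u \<in> set us \<Longrightarrow> (ws ! i, u) \<in> R ^^ l \<Longrightarrow>
        \<alpha> + real i \<le> real l \<or> \<alpha>' + real (?n - 1 - i) \<le> real l"
    using conf by (auto simp: config_def)
  have ch: "chain ws" "chain us" using c(3) by (auto simp: successively_append_iff)
  have n: "1 \<le> ?n" "1 \<le> ?q" using c(1,2) by (auto simp: Suc_le_eq)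
  have to_hd_w: "(ws ! s, hd ws) \<in> R ^^ s" and from_hd_w: "(hd ws, ws ! s) \<in> R ^^ s" if "s < ?n" for s
    using chain_relpow[OF ch(1), of 0 s] that c(1) relpow_R_sym by (auto simp: hd_conv_nth)
  have to_last_w: "(ws ! s, last ws) \<in> R ^^ (?n - 1 - s)" and from_last_w: "(last ws, ws ! s) \<in> R ^^ (?n - 1 - s)" if "s < ?n" for s
    using chain_relpow[OF ch(1), of s "?n - 1"] that c(1) relpow_R_sym by (auto simp: last_conv_nth)
  have from_hd_u: "(hd us, us ! s) \<in> R ^^ s" if "s < ?q" for s
    using chain_relpow[OF ch(2), of 0 s] that c(2) by (auto simp: hd_conv_nth)
  have to_last_u: "(us ! s, last us) \<in> R ^^ (?q - 1 - s)" if "s < ?q" for s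
    using chain_relpow[OF ch(2), of s "?q - 1"] that c(2) by (auto simp: last_conv_nth)
  have comp: "(x, z) \<in> R ^^ (a + b)" if "(x, y) \<in> R ^^ a" "(y, z) \<in> R ^^ b" for x y z a b
    using that by (auto simp: relpow_add)
  consider "j < ?n" | "i < ?n" "?n \<le> j" | "?n \<le> i" using ear(1) by linarith
  thus ?thesis
  proof cases
    case 1
    \<comment> \<open>Both ends in \<open>ws\<close>: the ear cannot shorten a geodesic, so
      \<open>j - i \<le> l\<close>, and the cycle that it closes would have at most
      \<open>2 * l < g\<close> edges.\<close>
    hence "(ws ! i, ws ! j) \<in> R ^^ l" using ear by (simp add: nth_append)
    hence "(hd ws, last ws) \<in> R ^^ (i + l + (?n - 1 - j))"
      using comp[OF comp[OF from_hd_w _] to_last_w] 1 ear(1) by simp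
    from d4[OF this] have "real ?n - 1 \<le> real (i + l + (?n - 1 - j))" using len by linarith
    hence "j - i \<le> l" using 1 ear(1) by linarith
    thus ?thesis using g(1,3) by linarith
  next
    case 2
    define j' where "j' = j - ?n"
    have j': "j = ?n + j'" "j' < ?q" using 2 ear(2) by (auto simp: j'_def)
    have e: "(ws ! i, us ! j') \<in> R ^^ l" using ear(3) 2(1) j' by (simp add: nth_append)
    \<comment> \<open>The end of the ear in \<open>ws\<close> is within \<open>l\<close> of one of
      the two boundary points along \<open>ws\<close>. The piece between them is counted in the
      detour and in the girth bound and so costs at most \<open>2 * l\<close>; the ear, counted in
      both as well, costs the other \<open>2 * l\<close>.\<close>
    from d5[OF 2(1) _ e] j'(2) have "\<alpha> + real i \<le> real l \<or> \<alpha>' + real (?n - 1 - i) \<le> real l" by simp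
    thus ?thesis
    proof
      assume near: "\<alpha> + real i \<le> real l"
      have "(hd us, hd ws) \<in> R ^^ (j' + l + i)"
        using comp[OF comp[OF from_hd_u[OF j'(2)] relpow_R_sym[OF e]] to_hd_w[OF 2(1)]] .
      from d3[OF this] have "2 * r \<le> 1 - \<alpha>' + (real j' + real l + real i) + \<alpha>" by simp
      moreover have "real g \<le> real ?n + real ?q - (real ?n + real j' - real i) + real l"
        using g(2) j' 2(1) ear(1,2) by (simp add: of_nat_diff)
      ultimately show ?thesis using near len by simp
    next
      assume near: "\<alpha>' + real (?n - 1 - i) \<le> real l"
      have "(last ws, last us) \<in> R ^^ ((?n - 1 - i) + l + (?q - 1 - j'))"
        using comp[OF comp[OF from_last_w[OF 2(1)] e] to_last_u[OF j'(2)]] .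
      from d2[OF this] have "2 * r \<le> \<alpha>' + (real (?n - 1 - i) + real l + real (?q - 1 - j')) + (1 - \<alpha>)" by simp
      moreover have "real (?n - 1 - i) = real ?n - 1 - real i" "real (?q - 1 - j') = real ?q - 1 - real j'"
        using 2(1) j'(2) n by linarith+
      moreover have "real g \<le> real ?n + real j' - real i + real l"
        using g(1) j' 2(1) ear(1) by linarith
      ultimately show ?thesis using near len by simp
    qed
  next
    case 3
    \<comment> \<open>Both ends in \<open>us\<close>: the ear shortens the outer path only, and even
      \<open>4 * r + g \<le> length (ws @ us) + 2 * l\<close> results.\<close>
    define i' j' where "i' = i - ?n" and "j' = j - ?n"
    have ij: "i = ?n + i'" "j = ?n + j'" "i' < ?q" "j' < ?q" "i' < j'"
      using 3 ear(1,2) by (auto simp: i'_def j'_def)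
    have e: "(us ! i', us ! j') \<in> R ^^ l" using ear(3) ij by (simp add: nth_append)
    have "(hd us, last us) \<in> R ^^ (i' + l + (?q - 1 - j'))"
      using comp[OF comp[OF from_hd_u[OF ij(3)] e] to_last_u[OF ij(4)]] .
    from d1[OF this] have "2 * r \<le> 1 - \<alpha>' + (real i' + real l + real (?q - 1 - j')) + (1 - \<alpha>)" by simp
    moreover have "real (?q - 1 - j') = real ?q - 1 - real j'" using ij by linarith
    moreover have "real g \<le> real j' - real i' + real l" using g(1) ij by linarith
    ultimately show ?thesis using len by simp
  qed
qed

lemma config_le_few_edges:
  assumes conf: "config r ws us \<alpha> \<alpha>'" and G: "girth G = enat g" "circumference G = enat c"
    and gc: "3 \<le> g" "g < c" and m: "card (edges G) = c + k" and k: "4 * k < g"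
  shows "r \<le> real k + (real c - real g) / 4"
proof (cases "3 / 4 < r")
  case False
  \<comment> \<open>Small radii are covered because \<open>1 \<le> k\<close> and
    \<open>g < c\<close> make the bound exceed 1.\<close>
  have "1 \<le> k" using admissible_bounds[OF simple G gc m finite_edges] by simp
  hence "1 \<le> real k" by simp
  moreover have "real g < real c" using gc by simp
  ultimately show ?thesis using False by argo
next
  case True
  let ?vs = "ws @ us"
  have cyc: "is_cycle G ?vs" using config_cycle[OF conf True] .
  obtain cs where cs: "is_cycle G cs" "length cs = c" using circumference_cycle G(2) gc by (metis not_less0)
  obtain gs where gs: "is_cycle G gs" "length gs = g" using girth_cycle G(1) by blast
  show ?thesis
  proof (cases "cyc_edges ?vs = cyc_edges cs")
    case False
    hence "length ?vs + g \<le> c + 2 * k"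
      using girth_circumference_bounds(1)[OF simple G gc m finite_edges cyc _ cs] by blast
    hence "real (length ?vs) + real g \<le> real c + 2 * real k" by linarith
    moreover have "0 \<le> real k" by simp
    ultimately show ?thesis using config_length[OF conf] by argo
  next
    case eq: True
    have len: "length ?vs = c"
      using card_cyc_edges[of ?vs] card_cyc_edges[of cs] cyc cs eq by (metis is_cycle_iff)
    have ns: "\<not> cyc_edges gs \<subseteq> cyc_edges ?vs"
      using not_subset_longer_cycle[OF gs(1) cyc] len gs(2) gc by simp
    have card_k: "card (cyc_edges gs - cyc_edges ?vs) \<le> k"
      using girth_circumference_bounds(2)[OF simple G gc m finite_edges gs(1) _ cyc len] ns by blast
    obtain i j l where e: "i < j" "j < length ?vs" "l \<le> k" "(?vs ! i, ?vs ! j) \<in> R ^^ l"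
      "g \<le> j - i + l" "g \<le> length ?vs - (j - i) + l"
      using ear_exists[OF cyc gs(1) G(1) ns card_k] k by auto
    have "4 * r + real g \<le> real (length ?vs) + 4 * real l"
      using config_ear[OF conf e(1,2,4,5,6)] e(3) k by linarith
    moreover have "real (length ?vs) = real c" "real l \<le> real k" using len e(3) by simp_all
    ultimately show ?thesis by argo
  qed
qed

end

subsection \<open>Theta graphs\<close>

text \<open>
  A cycle \<open>0, \<dots>, c - 1\<close> with a path of length \<open>k\<close> through the vertices \<open>c, \<dots>, c + k - 2\<close> from \<open>0\<close>
  to \<open>a\<close>, and \<open>t\<close> pendant edges at \<open>0\<close>. If \<open>k = 0\<close> then \<open>a = 0\<close> and the path is absent.
\<close>

definition chord :: "nat \<Rightarrow> nat \<Rightarrow> nat \<Rightarrow> nat \<Rightarrow> nat" where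
  "chord c a k i = (if i = 0 then 0 else if i = k then a else c + i - 1)"

definition theta_graph :: "nat \<Rightarrow> nat \<Rightarrow> nat \<Rightarrow> nat \<Rightarrow> nat ugraph" where
  "theta_graph c a k t =
     \<lparr>verts = {..<c} \<union> chord c a k ` {..k} \<union> (\<lambda>j. c + k + j) ` {..<t},
      edges = (\<lambda>i. {i, Suc i mod c}) ` {..<c} \<union>
        (\<lambda>i. {chord c a k i, chord c a k (Suc i)}) ` {..<k} \<union> (\<lambda>j. {0, c + k + j}) ` {..<t}\<rparr>"

text \<open>The three paths between the branch vertices have lengths
  \<open>k \<le> a \<le> c - a\<close>, so the base cycle is the longest of the three cycles, and
  the chord closes the shortest one with the arc from \<open>0\<close> to \<open>a\<close>. The last
  assumption keeps a chord of length 1 from doubling an edge.\<close>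

locale theta =
  fixes c a k t :: nat
  assumes c3: "3 \<le> c" and ka: "k \<le> a" and ac: "2 * a \<le> c" and k0: "k = 0 \<Longrightarrow> a = 0"
    and ka3: "k \<noteq> 0 \<Longrightarrow> 3 \<le> k + a"
begin

abbreviation "G \<equiv> theta_graph c a k t"
abbreviation "q \<equiv> chord c a k"

definition eC :: "nat \<Rightarrow> nat set" where "eC i = {i, Suc i mod c}"
definition eK :: "nat \<Rightarrow> nat set" where "eK i = {q i, q (Suc i)}"
definition eP :: "nat \<Rightarrow> nat set" where "eP j = {0, c + k + j}"

lemma edges_G: "edges G = eC ` {..<c} \<union> eK ` {..<k} \<union> eP ` {..<t}"
  by (simp add: theta_graph_def eC_def eK_def eP_def image_def)

lemma verts_G: "verts G = {..<c} \<union> q ` {..k} \<union> (\<lambda>j. c + k + j) ` {..<t}"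
  by (simp add: theta_graph_def)

lemma eC_cyc: "eC ` {..<c} = cyc_edges [0..<c]"
proof -
  have "\<And>i. i < c \<Longrightarrow> {[0..<c] ! i, [0..<c] ! (Suc i mod length [0..<c])} = eC i"
    by (auto simp: eC_def)
  thus ?thesis unfolding cyc_edges_def by (intro image_cong) auto
qed

lemma inj_eC: "inj_on eC {..<c}"
proof -
  have "inj_on (\<lambda>i. {[0..<c] ! i, [0..<c] ! (Suc i mod length [0..<c])}) {..<length [0..<c]}"
    by (rule inj_cyc_edges) (use c3 in auto)
  moreover have "\<And>i. i < c \<Longrightarrow> {[0..<c] ! i, [0..<c] ! (Suc i mod length [0..<c])} = eC i"
    by (auto simp: eC_def)
  ultimately show ?thesis by (simp add: inj_on_def)
qed

lemma ac': "a < c" using ac c3 by linarith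

lemma q_eq: "i \<le> k \<Longrightarrow> j \<le> k \<Longrightarrow> q i = q j \<longleftrightarrow> i = j"
  using ac' ka by (auto simp: chord_def split: if_splits)

lemma q_ge: "0 < i \<Longrightarrow> i < k \<Longrightarrow> q i = c + i - 1"
  by (simp add: chord_def)

lemma q_less: "i \<le> k \<Longrightarrow> q i < c + k"
  using ac' by (auto simp: chord_def)

lemma q_ends: "q 0 = 0" "q k = a"
  using k0 by (auto simp: chord_def)

lemma q_small: "i \<le> k \<Longrightarrow> q i < c \<longleftrightarrow> i = 0 \<or> i = k"
  using ac' by (auto simp: chord_def)

lemma inj_eK: "inj_on eK {..<k}"
proof
  fix i j assume "i \<in> {..<k}" "j \<in> {..<k}" "eK i = eK j"
  thus "i = j" using q_eq[of i j] q_eq[of i "Suc j"] q_eq[of "Suc i" j]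
    by (auto simp: eK_def doubleton_eq_iff)
qed

lemma inj_eP: "inj_on eP {..<t}"
  using c3 by (auto simp: inj_on_def eP_def doubleton_eq_iff)

lemma eC_less: "i < c \<Longrightarrow> x \<in> eC i \<Longrightarrow> x < c"
  using c3 by (auto simp: eC_def intro!: mod_less_divisor)

lemma eK_less: "i < k \<Longrightarrow> x \<in> eK i \<Longrightarrow> x < c + k"
  using q_less by (auto simp: eK_def)

text \<open>Both ends of a chord edge lie on the base cycle only if \<open>k = 1\<close>, and then
  \<open>2 \<le> a \<le> c - 2\<close> keeps \<open>0\<close> and \<open>a\<close> from being
  neighbours there.\<close>

lemma eC_eK: assumes "i < c" "j < k" shows "eC i \<noteq> eK j"
proof
  assume eq: "eC i = eK j"
  hence "q j < c" "q (Suc j) < c" using eC_less assms(1) by (auto simp: eK_def)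
  hence "j = 0" "k = 1" using q_small assms(2) by auto
  have "eK j = {q j, q (Suc j)}" by (simp add: eK_def)
  moreover have "Suc j = k" using \<open>j = 0\<close> \<open>k = 1\<close> by simp
  ultimately have "eK j = {q 0, q k}" using \<open>j = 0\<close> by metis
  hence "eC i = {0, a}" using eq q_ends by simp
  moreover have "2 \<le> a" "a + 2 \<le> c" using ka3 ac c3 \<open>k = 1\<close> by auto
  ultimately show False using assms(1) by (auto simp: eC_def doubleton_eq_iff Suc_mod_if split: if_splits)
qed

lemma eP_new: "eP j \<notin> eC ` {..<c} \<union> eK ` {..<k}"
proof
  assume "eP j \<in> eC ` {..<c} \<union> eK ` {..<k}"
  moreover have "c + k + j \<in> eP j" by (simp add: eP_def)
  ultimately have "c + k + j < c + k" using eC_less eK_less by fastforce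
  thus False by simp
qed

lemma card_edges_G: "card (edges G) = c + k + t"
proof -
  have "card (eC ` {..<c} \<union> eK ` {..<k}) = c + k"
    using eC_eK by (subst card_Un_disjoint) (auto simp: card_image inj_eC inj_eK)
  moreover have "(eC ` {..<c} \<union> eK ` {..<k}) \<inter> eP ` {..<t} = {}" using eP_new by auto
  ultimately show ?thesis
    unfolding edges_G by (subst card_Un_disjoint) (auto simp: card_image inj_eP)
qed

lemma simple_G: "simple_graph G"
proof -
  have "e \<in> {{u, v} |u v. u \<in> verts G \<and> v \<in> verts G \<and> u \<noteq> v}" if "e \<in> edges G" for e
  proof -
    from that consider i where "i < c" "e = eC i" | i where "i < k" "e = eK i" | j where "j < t" "e = eP j"
      unfolding edges_G by blast
    thus ?thesis
    proof cases
      case (1 i)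
      have "Suc i mod c < c" "Suc i mod c \<noteq> i" using c3 1(1) by (auto simp: Suc_mod_if)
      moreover have "i \<in> verts G" "Suc i mod c \<in> verts G" using 1(1) \<open>Suc i mod c < c\<close> by (simp_all add: verts_G)
      ultimately show ?thesis unfolding 1(2) eC_def by blast
    next
      case (2 i)
      have "q i \<noteq> q (Suc i)" using q_eq[of i "Suc i"] 2(1) by simp
      moreover have "q i \<in> verts G" "q (Suc i) \<in> verts G" using 2(1) by (auto simp: verts_G)
      ultimately show ?thesis unfolding 2(2) eK_def by blast
    next
      case (3 j)
      have "0 \<in> verts G" "c + k + j \<in> verts G" "0 \<noteq> c + k + j" using c3 3(1) by (auto simp: verts_G)
      thus ?thesis using 3(2) unfolding eP_def by blast
    qed
  qed
  moreover have "0 \<in> verts G" using c3 by (simp add: verts_G)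
  ultimately show ?thesis unfolding simple_graph_def by (auto simp: verts_G)
qed

lemma connected_G: "connected_graph G"
proof -
  let ?S = "{(x, y). {x, y} \<in> edges G}"
  have step: "(0, v) \<in> ?S\<^sup>*" if "(0, u) \<in> ?S\<^sup>*" "{u, v} \<in> edges G" for u v
    using that by (meson case_prodI mem_Collect_eq rtrancl.rtrancl_into_rtrancl)
  have C: "(0, i) \<in> ?S\<^sup>*" if "i < c" for i
    using that
  proof (induction i)
    case (Suc i)
    hence "eC i = {i, Suc i}" by (simp add: eC_def)
    thus ?case using Suc step[of i "Suc i"] unfolding edges_G by force
  qed simp
  have K: "(0, q i) \<in> ?S\<^sup>*" if "i \<le> k" for i
    using that
  proof (induction i)
    case (Suc i)
    thus ?case using step[of "q i" "q (Suc i)"] unfolding edges_G eK_def by force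
  qed (simp add: q_ends)
  have P: "(0, c + k + j) \<in> ?S\<^sup>*" if "j < t" for j
    using step[of 0 "c + k + j"] that unfolding edges_G eP_def by force
  have all: "(0, v) \<in> ?S\<^sup>*" if "v \<in> verts G" for v
    using that C K P unfolding verts_G by auto
  have "sym ?S" by (auto simp: sym_def insert_commute)
  hence "(v, 0) \<in> ?S\<^sup>*" if "v \<in> verts G" for v
    using all[OF that] by (meson symD sym_rtrancl)
  thus ?thesis unfolding connected_graph_def using all by (meson rtrancl_trans)
qed

sublocale cgraph G
proof
  have "0 < c" using c3 by linarith
  hence "eC 0 \<in> edges G" unfolding edges_G by blast
  thus "edges G \<noteq> {}" by blast
qed (rule simple_G connected_G)+

text \<open>Degrees in a cycle are 0 or 2, so at a vertex with at most two edges it uses both or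
  none. Taking \<open>e = e'\<close> covers leaves, whose edge lies on no cycle.\<close>

lemma even_star_edges:
  assumes "is_cycle G vs" "star (edges G) x \<subseteq> {e, e'}"
  shows "e \<in> cyc_edges vs \<and> x \<in> e \<longleftrightarrow> e' \<in> cyc_edges vs \<and> x \<in> e'" "e = e' \<Longrightarrow> \<not> (e \<in> cyc_edges vs \<and> x \<in> e)"
proof -
  let ?S = "star (cyc_edges vs) x"
  have v: "3 \<le> length vs" "distinct vs" "cyc_edges vs \<subseteq> edges G" using assms(1) by (auto simp: is_cycle_iff)
  have sub: "?S \<subseteq> {e, e'}" using assms(2) v(3) by (auto simp: star_def)
  have "card ?S = 2 \<or> card ?S = 0" using star_cycle[OF v(1,2)] by simp
  hence "(?S = {e, e'} \<and> e \<noteq> e') \<or> ?S = {}"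
  proof
    assume 2: "card ?S = 2"
    hence "card ?S \<le> card {e, e'}" using sub by (intro card_mono) auto
    hence "e \<noteq> e'" using 2 by auto
    moreover have "?S = {e, e'}"
      by (rule card_subset_eq) (use sub 2 \<open>e \<noteq> e'\<close> in auto)
    ultimately show ?thesis by simp
  next
    assume "card ?S = 0"
    thus ?thesis using sub finite_subset by fastforce
  qed
  thus "e \<in> cyc_edges vs \<and> x \<in> e \<longleftrightarrow> e' \<in> cyc_edges vs \<and> x \<in> e'" "e = e' \<Longrightarrow> \<not> (e \<in> cyc_edges vs \<and> x \<in> e)"
    by (auto simp: star_def)
qed

lemma in_eC: "i < c \<Longrightarrow> j < c \<Longrightarrow> i \<in> eC j \<longleftrightarrow> j = i \<or> Suc j mod c = i"
  by (auto simp: eC_def)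

lemma star_C:
  assumes "0 < i" "i < c" "i \<noteq> a" shows "star (edges G) i \<subseteq> {eC (i - 1), eC i}"
proof
  fix e assume "e \<in> star (edges G) i"
  hence e: "e \<in> edges G" "i \<in> e" by (auto simp: star_def)
  from e(1) consider j where "j < c" "e = eC j" | j where "j < k" "e = eK j" | j where "j < t" "e = eP j"
    unfolding edges_G by blast
  thus "e \<in> {eC (i - 1), eC i}"
  proof cases
    case (1 j)
    hence "j = i \<or> j = i - 1" using in_eC[of i j] e(2) assms by (auto simp: Suc_mod_if split: if_splits)
    thus ?thesis using 1 by auto
  next
    case (2 j)
    hence "i = q j \<or> i = q (Suc j)" using e(2) by (auto simp: eK_def)
    hence "i \<in> {q 0, q k}" using q_small[of j] q_small[of "Suc j"] assms(2) 2(1) by auto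
    thus ?thesis using q_ends assms by auto
  next
    case (3 j)
    thus ?thesis using e(2) assms by (auto simp: eP_def)
  qed
qed

lemma star_K:
  assumes "0 < i" "i < k" shows "star (edges G) (q i) \<subseteq> {eK (i - 1), eK i}"
proof
  fix e assume "e \<in> star (edges G) (q i)"
  hence e: "e \<in> edges G" "q i \<in> e" by (auto simp: star_def)
  have big: "c \<le> q i" "q i < c + k" using q_small[of i] q_less[of i] assms by auto
  from e(1) consider j where "j < c" "e = eC j" | j where "j < k" "e = eK j" | j where "j < t" "e = eP j"
    unfolding edges_G by blast
  thus "e \<in> {eK (i - 1), eK i}"
  proof cases
    case (1 j)
    thus ?thesis using eC_less e(2) big by fastforce
  next
    case (2 j)
    hence "i = j \<or> i = Suc j" using e(2) q_eq[of i j] q_eq[of i "Suc j"] assms by (auto simp: eK_def)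
    thus ?thesis using 2 by auto
  next
    case (3 j)
    thus ?thesis using e(2) big c3 by (auto simp: eP_def)
  qed
qed

lemma star_P: assumes "j < t" shows "star (edges G) (c + k + j) \<subseteq> {eP j}"
proof
  fix e assume "e \<in> star (edges G) (c + k + j)"
  hence e: "e \<in> edges G" "c + k + j \<in> e" by (auto simp: star_def)
  from e(1) consider i where "i < c" "e = eC i" | i where "i < k" "e = eK i" | i where "i < t" "e = eP i"
    unfolding edges_G by blast
  thus "e \<in> {eP j}"
    using eC_less eK_less e(2) c3 by cases (fastforce simp: eP_def)+
qed

text \<open>A cycle contains each of the three paths between the branch vertices completely or not at all.\<close>

lemma cycle_lengths:
  assumes vs: "is_cycle G vs"
  shows "length vs = c \<or> (k \<noteq> 0 \<and> (length vs = a + k \<or> length vs = c - a + k))"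
proof -
  let ?F = "cyc_edges vs"
  have v: "3 \<le> length vs" "distinct vs" "?F \<subseteq> edges G" using vs by (auto simp: is_cycle_iff)
  have nP: "eP j \<notin> ?F" if "j < t" for j
    using even_star_edges(2)[OF vs, of "c + k + j" "eP j" "eP j"] star_P[OF that] by (auto simp: eP_def)
  have C_step: "eC i \<in> ?F \<longleftrightarrow> eC (Suc i) \<in> ?F" if "Suc i < c" "Suc i \<noteq> a" for i
    using even_star_edges(1)[OF vs, of "Suc i" "eC i" "eC (Suc i)"] star_C[of "Suc i"] that
    by (auto simp: eC_def)
  have K_step: "eK i \<in> ?F \<longleftrightarrow> eK (Suc i) \<in> ?F" if "Suc i < k" for i
    using even_star_edges(1)[OF vs, of "q (Suc i)" "eK i" "eK (Suc i)"] star_K[of "Suc i"] that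
    by (auto simp: eK_def)
  have X: "eC i \<in> ?F \<longleftrightarrow> eC 0 \<in> ?F" if "i < a" for i
    using that
  proof (induction i)
    case (Suc i)
    thus ?case using C_step[of i] ac' by auto
  qed simp
  have Y: "eC (a + i) \<in> ?F \<longleftrightarrow> eC a \<in> ?F" if "a + i < c" for i
    using that
  proof (induction i)
    case (Suc i)
    thus ?case using C_step[of "a + i"] by auto
  qed simp
  have Z: "eK i \<in> ?F \<longleftrightarrow> eK 0 \<in> ?F" if "i < k" for i
    using that
  proof (induction i)
    case (Suc i)
    thus ?case using K_step[of i] by auto
  qed simp
  define IX IY IZ where "IX = {i. i < a \<and> eC 0 \<in> ?F}" and "IY = {i. a \<le> i \<and> i < c \<and> eC a \<in> ?F}"
    and "IZ = {i. i < k \<and> eK 0 \<in> ?F}"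
  have "?F = eC ` (IX \<union> IY) \<union> eK ` IZ"
  proof
    show "?F \<subseteq> eC ` (IX \<union> IY) \<union> eK ` IZ"
    proof
      fix e assume e: "e \<in> ?F"
      hence "e \<in> edges G" using v(3) by blast
      then consider i where "i < c" "e = eC i" | i where "i < k" "e = eK i" | j where "j < t" "e = eP j"
        unfolding edges_G by blast
      thus "e \<in> eC ` (IX \<union> IY) \<union> eK ` IZ"
      proof cases
        case (1 i)
        hence "i \<in> IX \<union> IY" using e X[of i] Y[of "i - a"] by (cases "i < a") (auto simp: IX_def IY_def)
        thus ?thesis using 1 by blast
      next
        case (2 i)
        thus ?thesis using e Z[of i] by (auto simp: IZ_def)
      next
        case (3 j)
        thus ?thesis using nP e by blast
      qed
    qed
    have "eC i \<in> ?F" if "i \<in> IX \<union> IY" for i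
      using that X[of i] Y[of "i - a"] by (auto simp: IX_def IY_def)
    moreover have "eK i \<in> ?F" if "i \<in> IZ" for i
      using that Z[of i] by (auto simp: IZ_def)
    ultimately show "eC ` (IX \<union> IY) \<union> eK ` IZ \<subseteq> ?F" by blast
  qed
  moreover have "eC ` (IX \<union> IY) \<inter> eK ` IZ = {}"
    using eC_eK ac' by (fastforce simp: IX_def IY_def IZ_def)
  moreover have "inj_on eC (IX \<union> IY)" by (rule inj_on_subset[OF inj_eC]) (use ac' in \<open>auto simp: IX_def IY_def\<close>)
  moreover have "inj_on eK IZ" by (rule inj_on_subset[OF inj_eK]) (auto simp: IZ_def)
  moreover have fin: "finite IX" "finite IY" "finite IZ" by (auto simp: IX_def IY_def IZ_def)
  ultimately have "card ?F = card (IX \<union> IY) + card IZ"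
    by (simp add: card_Un_disjoint card_image)
  moreover have "card (IX \<union> IY) = card IX + card IY"
    using fin by (intro card_Un_disjoint) (auto simp: IX_def IY_def)
  moreover have "card IX = (if eC 0 \<in> ?F then a else 0)"
    by (simp add: IX_def lessThan_def[symmetric])
  moreover have "IY = (if eC a \<in> ?F then {a..<c} else {})" by (auto simp: IY_def)
  hence "card IY = (if eC a \<in> ?F then c - a else 0)" by simp
  moreover have "card IZ = (if eK 0 \<in> ?F then k else 0)"
    by (simp add: IZ_def lessThan_def[symmetric])
  ultimately have len: "length vs = (if eC 0 \<in> ?F then a else 0) + (if eC a \<in> ?F then c - a else 0) + (if eK 0 \<in> ?F then k else 0)"
    using card_cyc_edges[OF v(1,2)] by linarith
  show ?thesis
  proof (cases "k = 0")
    case True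
    thus ?thesis using len k0 v(1) by (auto split: if_splits)
  next
    case False
    \<comment> \<open>The three paths start at the branch vertex \<open>0\<close> with the edges
      \<open>eC 0\<close>, \<open>eC (c - 1)\<close> and \<open>eK 0\<close>. A degree of 0 or 2
      there leaves exactly two of the paths, as the cycle is not empty.\<close>
    have last: "eC (c - 1) \<in> ?F \<longleftrightarrow> eC a \<in> ?F" using Y[of "c - 1 - a"] ac' by simp
    have in0: "0 \<in> eC 0" "0 \<in> eC (c - 1)" "0 \<in> eK 0"
      using c3 q_ends by (auto simp: eC_def eK_def)
    have sub: "star ?F 0 \<subseteq> {eC 0, eC (c - 1), eK 0}"
    proof
      fix e assume "e \<in> star ?F 0"
      hence e: "e \<in> ?F" "0 \<in> e" "e \<in> edges G" using v(3) by (auto simp: star_def)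
      from e(3) consider i where "i < c" "e = eC i" | i where "i < k" "e = eK i" | j where "j < t" "e = eP j"
        unfolding edges_G by blast
      thus "e \<in> {eC 0, eC (c - 1), eK 0}"
      proof cases
        case (1 i)
        hence "i = 0 \<or> i = c - 1" using in_eC[of 0 i] e(2) c3 by (auto simp: Suc_mod_if split: if_splits)
        thus ?thesis using 1 by auto
      next
        case (2 i)
        hence "q i = 0 \<or> q (Suc i) = 0" using e(2) by (auto simp: eK_def)
        hence "i = 0" using q_eq[of i 0] q_eq[of "Suc i" 0] 2(1) q_ends by auto
        thus ?thesis using 2 by simp
      next
        case (3 j)
        thus ?thesis using nP e by blast
      qed
    qed
    have "eC 0 \<noteq> eC (c - 1)" using inj_onD[OF inj_eC, of 0 "c - 1"] c3 by auto
    moreover have "eC 0 \<noteq> eK 0" "eC (c - 1) \<noteq> eK 0" using eC_eK False c3 by auto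
    moreover have star_eq: "star ?F 0 = {e \<in> {eC 0, eC (c - 1), eK 0}. e \<in> ?F}"
      using sub in0 by (auto simp: star_def)
    moreover have "{e \<in> {eC 0, eC (c - 1), eK 0}. e \<in> ?F} = (if eC 0 \<in> ?F then {eC 0} else {}) \<union>
        (if eC (c - 1) \<in> ?F then {eC (c - 1)} else {}) \<union> (if eK 0 \<in> ?F then {eK 0} else {})" by auto
    ultimately have "card (star ?F 0) = (if eC 0 \<in> ?F then 1 else 0) + (if eC a \<in> ?F then 1 else 0) + (if eK 0 \<in> ?F then 1 else 0)"
      using last by auto
    moreover have "card (star ?F 0) = 0 \<or> card (star ?F 0) = 2" using star_cycle[OF v(1,2)] by simp
    ultimately show ?thesis using len v(1) False ac' by (auto split: if_splits)
  qed
qed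

lemma base_cycle: "is_cycle G [0..<c]"
  unfolding is_cycle_iff using c3 by (auto simp: edges_G simp flip: eC_cyc)

lemma small_cycle:
  assumes "k \<noteq> 0" shows "is_cycle G ([0..<Suc a] @ rev (map q [1..<k]))"
proof (rule append_is_cycle)
  let ?adj = "\<lambda>x y. {x, y} \<in> edges G"
  show "successively ?adj [0..<Suc a]"
    unfolding successively_conv_nth
  proof (intro allI impI)
    fix i assume "Suc i < length [0..<Suc a]"
    hence "eC i = {i, Suc i}" "i < c" "Suc i \<le> a" using ac' by (auto simp: eC_def)
    thus "{[0..<Suc a] ! i, [0..<Suc a] ! Suc i} \<in> edges G" unfolding edges_G by (force simp del: upt_Suc)
  qed
  have "successively ?adj (map q [0..<Suc k])"
    unfolding successively_conv_nth edges_G eK_def by (auto simp del: upt_Suc)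
  hence "successively ?adj (rev (map q [0..<Suc k]))"
    unfolding successively_rev by (simp add: insert_commute del: upt_Suc)
  moreover have "rev (map q [0..<Suc k]) = a # rev (map q [1..<k]) @ [0]"
    using assms by (simp add: q_ends upt_rec[of 0])
  moreover have "last [0..<Suc a] = a" "hd [0..<Suc a] = 0" by (auto simp: hd_append)
  ultimately show "successively ?adj (last [0..<Suc a] # rev (map q [1..<k]) @ [hd [0..<Suc a]])"
    by metis
  have "inj_on q {1..<k}" using q_eq by (auto simp: inj_on_def)
  thus "distinct (rev (map q [1..<k]))" by (simp add: distinct_map)
  show "set [0..<Suc a] \<inter> set (rev (map q [1..<k])) = {}" using q_ge ac' by auto
  show "3 \<le> length [0..<Suc a] + length (rev (map q [1..<k]))" using ka3[OF assms] assms by simp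
qed auto

lemma circumference_G: "circumference G = enat c"
  unfolding circumference_def
proof (rule antisym)
  show "(SUP vs\<in>{vs. is_cycle G vs}. enat (length vs)) \<le> enat c"
  proof (rule SUP_least)
    fix vs assume "vs \<in> {vs. is_cycle G vs}"
    hence "length vs = c \<or> length vs = a + k \<or> length vs = c - a + k" using cycle_lengths by blast
    thus "enat (length vs) \<le> enat c" using ka ac by auto
  qed
  show "enat c \<le> (SUP vs\<in>{vs. is_cycle G vs}. enat (length vs))"
    by (rule SUP_upper2[of "[0..<c]"]) (use base_cycle in auto)
qed

lemma girth_G: "girth G = enat (if k = 0 then c else a + k)"
  unfolding girth_def
proof (rule antisym)
  show "enat (if k = 0 then c else a + k) \<le> (INF vs\<in>{vs. is_cycle G vs}. enat (length vs))"
  proof (rule INF_greatest)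
    fix vs assume "vs \<in> {vs. is_cycle G vs}"
    hence "length vs = c \<or> (k \<noteq> 0 \<and> (length vs = a + k \<or> length vs = c - a + k))" using cycle_lengths by blast
    thus "enat (if k = 0 then c else a + k) \<le> enat (length vs)" using ka ac by auto
  qed
  show "(INF vs\<in>{vs. is_cycle G vs}. enat (length vs)) \<le> enat (if k = 0 then c else a + k)"
  proof (cases "k = 0")
    case True
    thus ?thesis by (intro INF_lower2[of "[0..<c]"]) (use base_cycle in auto)
  next
    case False
    thus ?thesis
      by (intro INF_lower2[of "[0..<Suc a] @ rev (map q [1..<k])"]) (use small_cycle in auto)
  qed
qed

end

text \<open>The distance from \<open>x\<close> to the nearest multiple of \<open>p\<close>, that is,
  the distance to 0 on a circle of length \<open>p\<close>.\<close>

definition wave :: "real \<Rightarrow> real \<Rightarrow> real" where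
  "wave p x = \<bar>x - p * of_int (round (x / p))\<bar>"

lemma wave_le:
  assumes "0 < p" shows "wave p x \<le> \<bar>x - p * of_int n\<bar>"
proof -
  have *: "\<bar>x - p * of_int m\<bar> = p * \<bar>x / p - of_int m\<bar>" for m
  proof -
    have "x - p * of_int m = p * (x / p - of_int m)" using assms by (simp add: field_simps)
    thus ?thesis using assms by (simp add: abs_mult)
  qed
  have "\<bar>x / p - of_int (round (x / p))\<bar> \<le> \<bar>x / p - of_int n\<bar>" by (rule round_diff_minimal)
  thus ?thesis unfolding wave_def * using assms by (simp add: mult_left_mono)
qed

lemma wave_attained: obtains n where "wave p x = \<bar>x - p * of_int n\<bar>"
  by (simp add: wave_def)

lemma wave_lipschitz: assumes "0 < p" shows "\<bar>wave p x - wave p y\<bar> \<le> \<bar>x - y\<bar>"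
proof -
  have "wave p x \<le> wave p y + \<bar>x - y\<bar>" for x y
  proof -
    obtain n where "wave p y = \<bar>y - p * of_int n\<bar>" using wave_attained by blast
    thus ?thesis using wave_le[OF assms, of x n] by linarith
  qed
  from this[of x y] this[of y x] show ?thesis by linarith
qed

lemma wave_periodic: assumes "0 < p" shows "wave p (x + p * of_int m) = wave p x"
proof (rule antisym)
  obtain n where n: "wave p x = \<bar>x - p * of_int n\<bar>" using wave_attained by blast
  show "wave p (x + p * of_int m) \<le> wave p x"
    using wave_le[OF assms, of "x + p * of_int m" "n + m"] n by (simp add: algebra_simps)
  obtain n where n: "wave p (x + p * of_int m) = \<bar>x + p * of_int m - p * of_int n\<bar>" using wave_attained by blast
  show "wave p x \<le> wave p (x + p * of_int m)"
    using wave_le[OF assms, of x "n - m"] n by (simp add: algebra_simps)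
qed

lemma wave_small: assumes "0 < p" "\<bar>x\<bar> \<le> p / 2" shows "wave p x = \<bar>x\<bar>"
proof (rule antisym)
  show "wave p x \<le> \<bar>x\<bar>" using wave_le[OF assms(1), of x 0] by simp
  obtain n where n: "wave p x = \<bar>x - p * of_int n\<bar>" using wave_attained by blast
  show "\<bar>x\<bar> \<le> wave p x"
  proof (cases "n = 0")
    case False
    hence "1 \<le> \<bar>real_of_int n\<bar>" by linarith
    hence "p \<le> \<bar>p * of_int n\<bar>" using assms(1) by (simp add: abs_mult)
    thus ?thesis using n assms(2) by linarith
  qed (use n in simp)
qed

section \<open>The base cycle as an image of the real line\<close>

context theta
begin

definition cv :: "int \<Rightarrow> nat" where "cv z = nat (z mod int c)"

text \<open>The base cycle is covered by the line at unit speed. Arcs through the vertex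
  \<open>0\<close> are then images of ordinary intervals, at the price of period
  \<open>c\<close>.\<close>

definition circ :: "real \<Rightarrow> nat point" where
  "circ x = edge_point (cv \<lfloor>x\<rfloor>) (cv (\<lfloor>x\<rfloor> + 1)) (x - of_int \<lfloor>x\<rfloor>)"

lemma cv_less: "cv z < c"
  using c3 by (simp add: cv_def nat_less_iff)

lemma int_cv: "int (cv z) = z mod int c"
  using c3 by (simp add: cv_def)

lemma cv_Suc: "cv (z + 1) = Suc (cv z) mod c"
proof -
  have "int (cv (z + 1)) = (z mod int c + 1) mod int c" by (simp add: int_cv mod_simps)
  also have "\<dots> = int (Suc (cv z) mod c)" by (simp add: int_cv zmod_int add.commute)
  finally show ?thesis by linarith
qed

lemma cv_R: "(cv z, cv (z + 1)) \<in> R"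
  using cv_less unfolding R_iff edges_G eC_def cv_Suc by blast

lemma cv_eq: "cv z = cv z' \<longleftrightarrow> int c dvd z' - z"
proof -
  have "cv z = cv z' \<longleftrightarrow> z mod int c = z' mod int c" using int_cv by (metis of_nat_eq_iff)
  thus ?thesis by (metis mod_eq_dvd_iff)
qed

lemma circ_eq:
  assumes "of_int z \<le> x" "x \<le> of_int z + 1"
  shows "circ x = edge_point (cv z) (cv (z + 1)) (x - of_int z)"
proof (cases "x = of_int z + 1")
  case True
  hence "\<lfloor>x\<rfloor> = z + 1" by linarith
  thus ?thesis using True by (simp add: circ_def edge_point_def)
next
  case False
  hence "\<lfloor>x\<rfloor> = z" using assms by linarith
  thus ?thesis by (simp add: circ_def)
qed

lemma circ_on_edge:
  assumes "of_int z \<le> x" "x \<le> of_int z + 1"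
  shows "on_edge (circ x) (cv z) (cv (z + 1))" "circ x (cv z) = 1 - (x - of_int z)"
    "circ x (cv (z + 1)) = x - of_int z"
  unfolding circ_eq[OF assms] using assms cv_R
  by (auto intro!: on_edge_edge_point simp: edge_point_apply)

lemma circ_floor:
  "on_edge (circ x) (cv \<lfloor>x\<rfloor>) (cv (\<lfloor>x\<rfloor> + 1))" "circ x (cv \<lfloor>x\<rfloor>) = 1 - (x - of_int \<lfloor>x\<rfloor>)"
    "circ x (cv (\<lfloor>x\<rfloor> + 1)) = x - of_int \<lfloor>x\<rfloor>"
  by (rule circ_on_edge; linarith)+

lemma circ_points: "circ x \<in> points G"
  using circ_floor(1) on_edge_points by blast

lemma circ_periodic: "circ (x + real c) = circ x"
proof -
  have "\<lfloor>x + real c\<rfloor> = \<lfloor>x\<rfloor> + int c" by linarith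
  moreover have "cv (z + int c) = cv z" for z by (simp add: cv_def)
  ultimately show ?thesis unfolding circ_def by (simp add: ac_simps) (metis add.assoc add.commute)
qed

lemma joined_circ:
  assumes "x \<le> y" shows "joined G (circ x) (circ y) (y - x)"
  using assms
proof (induction "nat (\<lfloor>y\<rfloor> - \<lfloor>x\<rfloor>)" arbitrary: x)
  case 0
  hence "\<lfloor>y\<rfloor> = \<lfloor>x\<rfloor>" using floor_mono[of x y] by linarith
  thus ?case using joined_edge[OF circ_floor(1)[of x], of "circ y"] circ_floor[of x] circ_floor[of y] 0(2) by simp
next
  case (Suc n)
  let ?z = "\<lfloor>x\<rfloor>"
  have z: "?z + 1 \<le> \<lfloor>y\<rfloor>" using Suc(2) by linarith
  hence y: "of_int (?z + 1) \<le> y" by linarith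
  have n: "n = nat (\<lfloor>y\<rfloor> - \<lfloor>real_of_int (?z + 1)\<rfloor>)" unfolding floor_of_int using Suc(2) by linarith
  have e: "on_edge (circ (of_int (?z + 1))) (cv ?z) (cv (?z + 1))" "circ (of_int (?z + 1)) (cv ?z) = 0"
    using circ_on_edge[of ?z "of_int (?z + 1)"] by auto
  have "joined G (circ x) (circ y) (\<bar>circ x (cv ?z) - circ (of_int (?z + 1)) (cv ?z)\<bar> + (y - of_int (?z + 1)))"
    by (rule joined_step[OF circ_floor(1) e(1) Suc(1)[OF n y]])
  moreover have "\<bar>circ x (cv ?z) - circ (of_int (?z + 1)) (cv ?z)\<bar> + (y - of_int (?z + 1)) = y - x"
    using e(2) circ_floor(2)[of x] by (simp) linarith
  ultimately show ?case by (simp only:)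
qed

lemma gdist_circ_le: "gdist G (circ x) (circ y) \<le> \<bar>x - y\<bar>"
proof -
  have "gdist G (circ x) (circ y) \<le> y - x" if "x \<le> y" for x y
    using gdist_le[OF joined_circ[OF that]] .
  from this[of x y] this[of y x] show ?thesis using gdist_sym[of "circ x" "circ y"] by (cases "x \<le> y") auto
qed

text \<open>
  A periodic 1-Lipschitz function on the line induces a 1-Lipschitz function on the graph if it
  can be interpolated along the chord.
\<close>

lemma lipschitz_le_gdist:
  fixes H :: "real \<Rightarrow> real"
  assumes lip: "\<And>x y. \<bar>H x - H y\<bar> \<le> \<bar>x - y\<bar>" and per: "\<And>x m. H (x + real c * of_int m) = H x"
    and ch: "\<bar>H 0 - H (real a)\<bar> \<le> real k"
  shows "\<bar>H x - H y\<bar> \<le> gdist G (circ x) (circ y)"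
proof -
  \<comment> \<open>The induced values at the vertices: \<open>H\<close> on the cycle, linear along
    the chord, constant on pendant edges. The inner chord vertex \<open>q i\<close> is
    \<open>c + i - 1\<close>, so \<open>v - c + 1\<close> recovers \<open>i\<close>.\<close>
  define h where "h v = (if v < c then H (real v)
      else if v < c + k then H 0 + real (v - c + 1) / real k * (H (real a) - H 0) else H 0)" for v
  have hC: "h (cv z) = H (of_int z)" for z
  proof -
    have "z = int (cv z) + int c * (z div int c)" by (simp add: int_cv)
    hence "real_of_int z = real (cv z) + real c * of_int (z div int c)"
      by (metis of_int_add of_int_mult of_int_of_nat_eq)
    thus ?thesis using per[of "real (cv z)" "z div int c"] cv_less by (simp add: h_def)
  qed
  have hK: "h (q i) = H 0 + real i / real k * (H (real a) - H 0)" if i: "i \<le> k" "k \<noteq> 0" for i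
  proof -
    consider "i = 0" | "i = k" | "0 < i" "i < k" using i by linarith
    thus ?thesis
    proof cases
      case 3
      hence "q i = c + i - 1" by (simp add: q_ge)
      hence "\<not> q i < c" "q i < c + k" "q i - c + 1 = i" using 3 by auto
      thus ?thesis by (simp add: h_def)
    qed (use i q_ends c3 ac' in \<open>auto simp: h_def\<close>)
  qed
  have h_edge: "\<bar>h u - h v\<bar> \<le> 1" if "(u, v) \<in> R" for u v
  proof -
    have "{u, v} \<in> edges G" using that by (simp add: R_iff)
    then consider i where "i < c" "{u, v} = eC i" | i where "i < k" "{u, v} = eK i" | j where "j < t" "{u, v} = eP j"
      unfolding edges_G by blast
    thus ?thesis
    proof cases
      case (1 i)
      have "h i = H (of_int (int i))" "h (Suc i mod c) = H (of_int (int i + 1))"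
        using hC[of "int i"] hC[of "int i + 1"] 1(1) unfolding cv_Suc by (auto simp: cv_def)
      hence "\<bar>h i - h (Suc i mod c)\<bar> \<le> 1" using lip[of "of_int (int i)" "of_int (int i + 1)"] by simp
      thus ?thesis using 1(2) by (auto simp: eC_def doubleton_eq_iff abs_minus_commute)
    next
      case (2 i)
      hence k: "0 < real k" by simp
      have "h (q (Suc i)) - h (q i) = (H (real a) - H 0) / real k"
        using hK[of i] hK[of "Suc i"] 2(1) by (simp add: field_simps)
      hence "\<bar>h (q (Suc i)) - h (q i)\<bar> \<le> 1" using ch k by (simp add: abs_minus_commute)
      thus ?thesis using 2(2) by (auto simp: eK_def doubleton_eq_iff abs_minus_commute)
    next
      case (3 j)
      have "h 0 = H 0" "h (c + k + j) = H 0" using c3 by (auto simp: h_def)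
      thus ?thesis using 3(2) by (auto simp: eP_def doubleton_eq_iff)
    qed
  qed
  have h_pow: "\<bar>h u - h v\<bar> \<le> real n" if "(u, v) \<in> R ^^ n" for u v n
    using that
  proof (induction n arbitrary: v)
    case (Suc n)
    then obtain w where "(u, w) \<in> R ^^ n" "(w, v) \<in> R" by auto
    thus ?case using Suc.IH[of w] h_edge[of w v] by simp
  qed simp
  have near: "\<bar>H x - h w\<bar> \<le> 1 - circ x w" if "circ x w > 0" for x w
  proof -
    have "w = cv \<lfloor>x\<rfloor> \<or> w = cv (\<lfloor>x\<rfloor> + 1)" using on_edge_pos[OF circ_floor(1) that] .
    thus ?thesis
    proof
      assume "w = cv \<lfloor>x\<rfloor>"
      thus ?thesis using hC[of "\<lfloor>x\<rfloor>"] circ_floor(2)[of x] lip[of x "of_int \<lfloor>x\<rfloor>"] by simp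
    next
      assume w: "w = cv (\<lfloor>x\<rfloor> + 1)"
      have "\<bar>x - of_int (\<lfloor>x\<rfloor> + 1)\<bar> = 1 - (x - of_int \<lfloor>x\<rfloor>)" by linarith
      thus ?thesis unfolding w using hC[of "\<lfloor>x\<rfloor> + 1"] circ_floor(3)[of x] lip[of x "of_int (\<lfloor>x\<rfloor> + 1)"] by simp
    qed
  qed
  \<comment> \<open>The common edge may belong to the chord, but then both points are vertices.
    Comparing through \<open>h\<close> settles this without locating the edge.\<close>
  have vertex: "\<bar>H x - H y\<bar> \<le> \<bar>circ x u - circ y u\<bar>"
    if e: "on_edge (circ x) u v" "on_edge (circ y) u v" "circ x u = 1" for x y u v
  proof -
    have Hx: "H x = h u" using near[of x u] e(3) by simp
    show ?thesis
    proof (cases "circ y u > 0")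
      case True
      thus ?thesis using near[OF True] e(3) Hx by linarith
    next
      case False
      hence y: "circ y u = 0" "circ y v = 1" using e(2) by (auto simp: on_edge_def)
      hence "H y = h v" using near[of y v] by simp
      thus ?thesis using Hx y e(3) h_edge[OF on_edge_R[OF e(1)]] by simp
    qed
  qed
  have along: "\<bar>H x - H y\<bar> \<le> \<bar>circ x u - circ y u\<bar>"
    if e: "on_edge (circ x) u v" "on_edge (circ y) u v" for u v
  proof -
    have e': "on_edge (circ x) v u" "on_edge (circ y) v u" using e on_edge_commute by auto
    note d = on_edge_diff[OF e]
    consider "circ x u = 1" | "circ x v = 1" | "circ y u = 1" | "circ y v = 1"
      | "0 < circ x u" "circ x u < 1" "0 < circ y u" "circ y u < 1"
      using e unfolding on_edge_def by argo
    thus ?thesis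
    proof cases
      case 1
      thus ?thesis using vertex[OF e] by simp
    next
      case 2
      thus ?thesis using vertex[OF e'] d by simp
    next
      case 3
      thus ?thesis using vertex[OF e(2,1)] by (simp add: abs_minus_commute)
    next
      case 4
      thus ?thesis using vertex[OF e'(2,1)] d by (simp add: abs_minus_commute)
    next
      case 5
      let ?z = "\<lfloor>x\<rfloor>" and ?w = "\<lfloor>y\<rfloor>"
      have "{u, v} = {cv ?z, cv (?z + 1)}" "{u, v} = {cv ?w, cv (?w + 1)}"
        using on_edge_interior[OF e(1) circ_floor(1)] on_edge_interior[OF e(2) circ_floor(1)] 5 by auto
      hence "eC (cv ?z) = eC (cv ?w)" by (simp add: eC_def cv_Suc)
      hence zw: "cv ?z = cv ?w" using inj_onD[OF inj_eC] cv_less by auto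
      then obtain m where m: "?w - ?z = int c * m" using cv_eq by (meson dvdE)
      \<comment> \<open>The parameters of two points of one edge may differ by full turns;
        \<open>y'\<close> is the parameter of \<open>circ y\<close> in the same unit interval as
        \<open>x\<close>.\<close>
      define y' where "y' = y - real c * of_int m"
      have "H y' = H y" using per[of y' m] by (simp add: y'_def)
      moreover have "x - y' = (x - of_int ?z) - (y - of_int ?w)"
      proof -
        have "real_of_int ?w - real_of_int ?z = real c * of_int m"
          using m by (metis of_int_diff of_int_mult of_int_of_nat_eq)
        thus ?thesis by (simp add: y'_def)
      qed
      moreover have "\<bar>circ x u - circ y u\<bar> = \<bar>(x - of_int ?z) - (y - of_int ?w)\<bar>"
      proof -
        have "u = cv ?z \<or> u = cv (?z + 1)" using on_edge_pos[OF circ_floor(1)[of x]] 5(1) by blast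
        thus ?thesis
          using circ_floor(2,3)[of x] circ_floor(2,3)[of y] zw cv_Suc[of ?z] cv_Suc[of ?w] by auto
      qed
      ultimately show ?thesis using lip[of x y'] by simp
    qed
  qed
  from circ_points[of x] circ_points[of y] show ?thesis
  proof (cases rule: gdist_cases)
    case (edge u v)
    thus ?thesis using along[of u v] by simp
  next
    case (via u v n)
    thus ?thesis using near[of x u] near[of y v] h_pow[of u v n] by linarith
  qed
qed

text \<open>For an arc of unit speed it suffices that its ends are far enough apart: the triangle
  inequality then forces equality on every subarc.\<close>

lemma circ_geodesic:
  assumes "0 \<le> L" "L \<le> gdist G (circ x) (circ (x + L))"
  shows "is_geodesic G (circ x) (circ (x + L)) (circ ` {x..x + L})"
proof -
  have L: "gdist G (circ x) (circ (x + L)) = L" using gdist_circ_le[of x "x + L"] assms by simp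
  define \<gamma> where "\<gamma> s = circ (x + s)" for s
  have iso: "gdist G (\<gamma> s) (\<gamma> u) = u - s" if "0 \<le> s" "s \<le> u" "u \<le> L" for s u
  proof -
    have "L \<le> gdist G (circ x) (\<gamma> s) + (gdist G (\<gamma> s) (\<gamma> u) + gdist G (\<gamma> u) (circ (x + L)))"
      using L gdist_triangle[of "circ x" "\<gamma> s" "circ (x + L)"] gdist_triangle[of "\<gamma> s" "\<gamma> u" "circ (x + L)"]
        circ_points unfolding \<gamma>_def by (metis add_left_mono order_trans)
    moreover have "gdist G (circ x) (\<gamma> s) \<le> s" "gdist G (\<gamma> u) (circ (x + L)) \<le> L - u" "gdist G (\<gamma> s) (\<gamma> u) \<le> u - s"
      using gdist_circ_le[of x "x + s"] gdist_circ_le[of "x + u" "x + L"] gdist_circ_le[of "x + s" "x + u"] that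
      by (auto simp: \<gamma>_def)
    ultimately show ?thesis by linarith
  qed
  have "circ ` {x..x + L} = \<gamma> ` {0..L}"
  proof -
    have "{x..x + L} = (\<lambda>s. x + s) ` {0..L}" by simp
    thus ?thesis by (simp add: \<gamma>_def image_image del: image_add_atLeastAtMost)
  qed
  moreover have "gdist G (\<gamma> s) (\<gamma> u) = \<bar>s - u\<bar>" if "s \<in> {0..L}" "u \<in> {0..L}" for s u
    using iso[of s u] iso[of u s] that gdist_sym[of "\<gamma> s" "\<gamma> u"] by (cases "s \<le> u") auto
  ultimately show ?thesis
    unfolding is_geodesic_def L using circ_points by (intro exI[of _ \<gamma>]) (auto simp: \<gamma>_def)
qed

text \<open>The bound is realised by a bigon of two half turns of the base cycle. With
  \<open>a = g - k\<close> the first term becomes \<open>k + (c - g) / 4\<close>.\<close>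

lemma hyp_const_theta:
  "min ((real c - real a + 3 * real k) / 4) (real c / 4) \<le> hyp_const G"
proof -
  \<comment> \<open>\<open>b\<close> is the length of the long arc between the ends of the chord.
    The corner \<open>circ (real c - s)\<close> lies on it at distance \<open>s\<close> from
    \<open>0\<close> and \<open>s - k\<close> from \<open>a\<close>, so that the way to
    \<open>0\<close> over the chord ties with the direct one; \<open>s'\<close> is the parameter of
    its antipode.\<close>
  define b where "b = real c - real a"
  define s where "s = (b + real k) / 2"
  define s' where "s' = (real a - real k) / 2"
  \<comment> \<open>The point at distance \<open>r\<close> from the corner towards \<open>0\<close>
    has \<open>s - r\<close> left to \<open>0\<close> and reaches \<open>a\<close> over the chord
    after \<open>s - r + k\<close>. Equating this with \<open>r\<close> gives
    \<open>(s + k) / 2\<close>. The cap \<open>c / 4\<close> is half of a side.\<close>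
  define r where "r = min ((s + real k) / 2) (real c / 4)"
  have c0: "0 < real c" using c3 by simp
  have ka': "real k \<le> real a" "2 * real a \<le> real c" using ka ac by linarith+
  have ss: "s + s' = real c / 2" by (simp add: s_def s'_def b_def field_simps)
  have s: "0 \<le> s'" "real k \<le> s" "s \<le> real c / 2" "0 \<le> r" "r \<le> s" "r \<le> real c / 4" "2 * r - s \<le> real k"
    using ka' by (auto simp: s_def s'_def r_def b_def min_def field_simps)
  define H1 where "H1 x = wave (real c) (x - (real c - s))" for x
  text \<open>
    The points \<open>circ (c - s)\<close> and \<open>circ s'\<close> are antipodal on the cycle, and the chord is no shortcut
    between them, because it joins points whose distances from \<open>circ (c - s)\<close> differ by \<open>k\<close>.
  \<close>
  have d_xy: "real c / 2 \<le> gdist G (circ (real c - s)) (circ (real c + s'))"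
  proof -
    have "\<bar>H1 (real c - s) - H1 (real c + s')\<bar> \<le> gdist G (circ (real c - s)) (circ (real c + s'))"
    proof (rule lipschitz_le_gdist)
      show "\<bar>H1 x - H1 y\<bar> \<le> \<bar>x - y\<bar>" for x y
        using wave_lipschitz[OF c0, of "x - (real c - s)" "y - (real c - s)"] by (simp add: H1_def)
      show per: "H1 (x + real c * of_int m) = H1 x" for x m
        using wave_periodic[OF c0, of "x - (real c - s)" m] by (simp add: H1_def algebra_simps)
      have "H1 0 = s" using per[of 0 1] wave_small[OF c0, of s] s ka' by (simp add: H1_def)
      moreover have "H1 (real a) = s - real k"
        using wave_small[OF c0, of "real a - (real c - s)"] s ka' by (simp add: H1_def s_def b_def field_simps)
      ultimately show "\<bar>H1 0 - H1 (real a)\<bar> \<le> real k" by simp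
    qed
    moreover have "H1 (real c - s) = 0" using wave_small[OF c0, of 0] c0 by (simp add: H1_def)
    moreover have "H1 (real c + s') = real c / 2"
    proof -
      have "real c + s' - (real c - s) = real c / 2" using ss by simp
      thus ?thesis unfolding H1_def using wave_small[OF c0, of "real c / 2"] c0 by (simp only:)
    qed
    ultimately show ?thesis by simp
  qed
  \<comment> \<open>A bump of height \<open>r\<close> at the chosen point that vanishes on the other
    side of the bigon. Along the chord it falls from \<open>max 0 (2 * r - s)\<close> at
    \<open>0\<close> to zero at \<open>a\<close>, and the choice of \<open>r\<close> keeps this
    within slope 1.\<close>
  define H2 where "H2 x = max 0 (r - wave (real c) (x - (real c - s + r)))" for x
  have H2_0: "H2 (s' + u) = 0" if u: "0 \<le> u" "u \<le> real c / 2" for u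
  proof -
    have \<phi>: "s' + u - (real c - s + r) = u - real c / 2 - r" using ss by simp
    have "r \<le> wave (real c) (u - real c / 2 - r)"
    proof (cases "r \<le> u")
      case True
      thus ?thesis using wave_small[OF c0, of "u - real c / 2 - r"] u s(4) by simp
    next
      case False
      have "u - real c / 2 - r + real c * of_int 1 = u + real c / 2 - r" by simp
      hence "wave (real c) (u - real c / 2 - r) = wave (real c) (u + real c / 2 - r)"
        using wave_periodic[OF c0] by metis
      also have "\<dots> = \<bar>u + real c / 2 - r\<bar>"
        by (rule wave_small[OF c0]) (use False u s(6) c0 in linarith)
      finally show ?thesis using u s(6) by linarith
    qed
    thus ?thesis unfolding H2_def \<phi> by simp
  qed
  have H2_le: "\<bar>H2 x - H2 y\<bar> \<le> gdist G (circ x) (circ y)" for x y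
  proof (rule lipschitz_le_gdist)
    show "\<bar>H2 x - H2 y\<bar> \<le> \<bar>x - y\<bar>" for x y
      using wave_lipschitz[OF c0, of "x - (real c - s + r)" "y - (real c - s + r)"] unfolding H2_def by linarith
    show per: "H2 (x + real c * of_int m) = H2 x" for x m
    proof -
      have "x + real c * of_int m - (real c - s + r) = x - (real c - s + r) + real c * of_int m" by simp
      thus ?thesis unfolding H2_def using wave_periodic[OF c0] by metis
    qed
    have "s' + (real a + real k) / 2 = real a" by (simp add: s'_def field_simps)
    moreover have "(real a + real k) / 2 \<le> real c / 2" using ka' by simp
    ultimately have "H2 (real a) = 0" using H2_0[of "(real a + real k) / 2"] by simp
    moreover have "H2 0 = max 0 (r - (s - r))"
    proof -
      have "real c - (real c - s + r) = s - r" by simp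
      moreover have "wave (real c) (s - r) = s - r" using wave_small[OF c0, of "s - r"] s by simp
      ultimately have "H2 (real c) = max 0 (r - (s - r))" by (simp add: H2_def)
      thus ?thesis using per[of 0 1] by simp
    qed
    ultimately show "\<bar>H2 0 - H2 (real a)\<bar> \<le> real k" using s(7) by simp
  qed
  have H2_p: "H2 (real c - s + r) = r" using wave_small[OF c0, of 0] c0 s(4) by (simp add: H2_def)
  let ?x = "circ (real c - s)" and ?y = "circ s'"
  have wrap: "real c - s + real c / 2 = s' + real c" "s' + real c / 2 = real c - s" using ss by auto
  have geo1: "is_geodesic G ?x ?y (circ ` {real c - s..real c - s + real c / 2})"
    using circ_geodesic[of "real c / 2" "real c - s"] d_xy circ_periodic[of s'] c0 wrap(1)
    by (simp add: add.commute)
  have geo2: "is_geodesic G ?y ?x (circ ` {s'..s' + real c / 2})"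
    using circ_geodesic[of "real c / 2" s'] d_xy circ_periodic[of s'] c0 wrap(2) gdist_sym[of ?x ?y]
    by (simp add: add.commute)
  have "r \<le> hyp_const G"
  proof (rule le_hyp_const[OF _ _ circ_points circ_points geo1 geo2])
    show "1 / 2 \<le> real c / 4" using c3 by simp
    show "r' \<le> real c / 4" if "config r' ws us \<alpha> \<alpha>'" for r' ws us \<alpha> \<alpha>'
      using config_le_circumference[OF that circumference_G c3] .
    show "circ (real c - s + r) \<in> circ ` {real c - s..real c - s + real c / 2}"
      using s c0 by (intro imageI) auto
    fix q assume "q \<in> circ ` {s'..s' + real c / 2}"
    then obtain x where x: "q = circ x" "s' \<le> x" "x \<le> s' + real c / 2" by auto
    hence "H2 x = 0" using H2_0[of "x - s'"] by simp
    thus "r \<le> gdist G (circ (real c - s + r)) q" using H2_le[of "real c - s + r" x] H2_p x(1) s(4) by simp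
  qed
  moreover have "(s + real k) / 2 = (real c - real a + 3 * real k) / 4" by (simp add: s_def b_def field_simps)
  ultimately show ?thesis by (simp add: r_def)
qed

end

subsection \<open>The extremal value\<close>

lemma beta_eqI:
  assumes "G \<in> graph_class g c m" "B \<le> hyp_const G"
    and "\<And>G. G \<in> graph_class g c m \<Longrightarrow> hyp_const G \<le> B"
  shows "beta g c m = B"
  unfolding beta_def
proof (rule Greatest_equality)
  have "hyp_const G = B" using assms by (simp add: order_antisym)
  thus "B \<in> hyp_const ` graph_class g c m" using assms(1) by blast
qed (use assms(3) in auto)

lemma graph_classD:
  assumes "G \<in> graph_class g c m" "3 \<le> c"
  shows "cgraph G" "simple_graph G" "girth G = enat g" "circumference G = enat c" "card (edges G) = m"
proof -
  show G: "simple_graph G" "girth G = enat g" "circumference G = enat c" "card (edges G) = m"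
    using assms(1) by (auto simp: graph_class_def)
  obtain vs where vs: "is_cycle G vs" using circumference_cycle[OF G(3)] assms(2) by auto
  hence "cyc_edges vs \<subseteq> edges G" "card (cyc_edges vs) \<noteq> 0"
    using card_cyc_edges[of vs] by (auto simp: is_cycle_iff)
  hence "cyc_edges vs \<subseteq> edges G" "cyc_edges vs \<noteq> {}" by auto
  thus "cgraph G" using assms(1) by unfold_locales (auto simp: graph_class_def)
qed

lemma hyp_const_le_circumference:
  assumes "G \<in> graph_class g c m" "3 \<le> c" shows "hyp_const G \<le> real c / 4"
proof -
  note G = graph_classD[OF assms]
  interpret cgraph G by (rule G(1))
  show ?thesis
    by (rule hyp_const_le) (use assms(2) config_le_circumference[OF _ G(4)] in auto)
qed

lemma hyp_const_le_few_edges: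
  assumes "G \<in> graph_class g c m" "3 \<le> g" "g < c" "m = c + k" "4 * k < g"
  shows "hyp_const G \<le> real k + (real c - real g) / 4"
proof -
  have "3 \<le> c" using assms by linarith
  note G = graph_classD[OF assms(1) this]
  interpret cgraph G by (rule G(1))
  have "1 \<le> k" using admissible_bounds(2)[OF simple G(3,4) assms(2,3) _ finite_edges] G(5) assms(4) by simp
  hence "1 \<le> real k" "real g < real c" using assms(3) by simp_all
  hence "1 / 2 \<le> real k + (real c - real g) / 4" by argo
  thus ?thesis
    using config_le_few_edges[OF _ G(3,4) assms(2,3) _ assms(5)] G(5) assms(4) by (intro hyp_const_le) auto
qed

lemma theta_graph_class:
  assumes "theta c a k" shows "theta_graph c a k t \<in> graph_class (if k = 0 then c else a + k) c (c + k + t)"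
proof -
  interpret theta c a k t by (rule assms)
  show ?thesis
    unfolding graph_class_def using simple_G connected_G girth_G circumference_G card_edges_G by auto
qed

theorem theorem6p1:
  fixes g c m :: nat
  assumes "e_admissible g c m"
    and "3 \<le> g" and "g \<le> c" and "c \<le> m"
  shows "(g = c \<or> (g < c \<and> real m \<ge> real c + real g / 4) \<longrightarrow> beta g c m = real c / 4) \<and>
         (g < c \<and> real m < real c + real g / 4 \<longrightarrow>
            beta g c m = real m - (real g + 3 * real c) / 4)"
proof -
  obtain k where k: "m = c + k" using assms(4) le_Suc_ex by blast
  have c3: "3 \<le> c" using assms by simp
  obtain G0 where G0: "G0 \<in> graph_class g c m" using assms(1) by (auto simp: e_admissible_def)
  have adm: "2 * g \<le> c + 2 * k" "1 \<le> k" if "g < c"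
  proof -
    note G = graph_classD[OF G0 c3]
    interpret cgraph G0 by (rule G(1))
    show "2 * g \<le> c + 2 * k" "1 \<le> k"
      using admissible_bounds[OF simple G(3,4) assms(2) that _ finite_edges] G(5) k by auto
  qed
  have extremal: "\<exists>G\<in>graph_class g c m. min ((real c - real g + 4 * real l) / 4) (real c / 4) \<le> hyp_const G"
    if "g < c" "l = min k (g div 2)" for l
  proof -
    \<comment> \<open>\<open>l \<le> g div 2\<close> makes the chord no longer than the arc
      \<open>g - l\<close>, while \<open>adm\<close> and \<open>g < c\<close> give
      \<open>2 * (g - l) \<le> c\<close> in the two cases of the minimum.\<close>
    have th: "theta c (g - l) l" using that adm assms by unfold_locales auto
    have l: "l \<noteq> 0" "l \<le> k" "l \<le> g" using that adm assms(2) by auto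
    interpret theta c "g - l" l "k - l" by (rule th)
    have "theta_graph c (g - l) l (k - l) \<in> graph_class g c m"
      using theta_graph_class[OF th, of "k - l"] l k by simp
    moreover have "real c - real (g - l) + 3 * real l = real c - real g + 4 * real l" using l by simp
    ultimately show ?thesis using hyp_const_theta by metis
  qed
  have 1: "beta g c m = real c / 4" if "g = c"
  proof -
    \<comment> \<open>A cycle with \<open>k\<close> pendant edges; both terms of the minimum in
      \<open>hyp_const_theta\<close> are then \<open>c / 4\<close>.\<close>
    have th: "theta c 0 0" using c3 by unfold_locales auto
    interpret theta c 0 0 k by (rule th)
    have "theta_graph c 0 0 k \<in> graph_class g c m"
      using theta_graph_class[OF th, of k] that k by simp
    thus ?thesis using hyp_const_theta hyp_const_le_circumference[OF _ c3] by (intro beta_eqI) auto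
  qed
  have 2: "beta g c m = real c / 4" if h: "g < c" "real m \<ge> real c + real g / 4"
  proof -
    have "g \<le> 4 * k" using h(2) k by simp
    \<comment> \<open>Capping the chord at \<open>g div 2\<close> loses nothing, because
      \<open>4 * (g div 2) \<ge> g\<close> already lifts the first term of the minimum to
      \<open>c / 4\<close>.\<close>
    hence "g \<le> 4 * min k (g div 2)" using assms(2) by (auto simp: min_def)
    hence "real g \<le> 4 * real (min k (g div 2))" by linarith
    moreover obtain G where "G \<in> graph_class g c m"
      "min ((real c - real g + 4 * real (min k (g div 2))) / 4) (real c / 4) \<le> hyp_const G"
      using extremal[OF h(1) HOL.refl] by blast
    ultimately show ?thesis
      using hyp_const_le_circumference[OF _ c3] by (intro beta_eqI) auto
  qed
  have 3: "beta g c m = real m - (real g + 3 * real c) / 4" if h: "g < c" "real m < real c + real g / 4"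
  proof -
    have k4: "4 * k < g" using h(2) k by simp
    hence "min k (g div 2) = k" by simp
    then obtain G where "G \<in> graph_class g c m"
      "min ((real c - real g + 4 * real k) / 4) (real c / 4) \<le> hyp_const G"
      using extremal[OF h(1), of k] by auto
    moreover have "4 * real k < real g" using k4 by simp
    hence "min ((real c - real g + 4 * real k) / 4) (real c / 4) = real k + (real c - real g) / 4"
      by (simp add: min_def field_simps)
    ultimately have "beta g c m = real k + (real c - real g) / 4"
      using hyp_const_le_few_edges[OF _ assms(2) h(1) k k4] by (intro beta_eqI) auto
    thus ?thesis using k by (simp add: field_simps)
  qed
  show ?thesis using 1 2 3 by blast
qed

end
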